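(* Let $G\supset G'$ be a real reductive linear Lie group and an algebraic reductive subgroup, and let $(\lambda,\nu)$ be a pair of $(\mathfrak Z_G,\mathfrak Z_{G'})$-infinitesimal characters. The map $$\psi:G\times G'\to G,\qquad (g,g')\mapsto(g')^{-1}g$$ induces by pull-back a bijection $$\psi^*:\operatorname{Sh}(\lambda,\nu)\overset\sim\to C^\infty((G\times G')/(K\times K');\chi^R_{\lambda,\nu})^{\operatorname{diag}G'}.$$
   Context: $K$ is a maximal compact subgroup of $G$ such that $K':=K\cap G'$ is maximal compact in $G'$; $\mathfrak g\supset\mathfrak g'$ are the Lie algebras. For a Lie group $G$, $X\in\mathfrak g$, $f\in C^\infty(G)$: $(L_Xf)(g)=\frac{d}{dt}|_{t=0}f(\exp(-tX)g)$, $(R_Xf)(g)=\frac{d}{dt}|_{t=0}f(g\exp(tX))$, extended to $U(\mathfrak g_{\mathbb C})$. $\mathfrak Z_G:=U(\mathfrak g_{\mathbb C})^G$. With $\mathfrak j$ a Cartan subalgebra and $W(\mathfrak j_{\mathbb C}):=N_{\widetilde G}(\mathfrak j_{\mathbb C})/Z_{\widetilde G}(\mathfrak j_{\mathbb C})$ ($\widetilde G$ generated by $\operatorname{Ad}(G)$ and $\operatorname{Int}(\mathfrak g_{\mathbb C})$), the Harish-Chandra isomorphism identifies algebra homomorphisms $\chi_\lambda:\mathfrak Z_G\to\mathbb C$ with $\lambda\in\mathfrak j_{\mathbb C}^\vee/W(\mathfrak j_{\mathbb C})$; similarly for $G'$, and $\chi_{\lambda,\nu}$ is the corresponding character of $\mathfrak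 Z_{G\times G'}\simeq\mathfrak Z_G\otimes\mathfrak Z_{G'}$. $\operatorname{Sh}(\lambda,\nu)$ is the space of $f\in C^\infty(G)$ with $f(k'gk)=f(g)$ ($k'\in K'$, $k\in K$), $R_uf=\chi_\lambda(u)f$ ($u\in\mathfrak Z_G$), $L_vf=\chi_\nu(v)f$ ($v\in\mathfrak Z_{G'}$). $C^\infty((G\times G')/(K\times K');\chi^R_{\lambda,\nu})$ is the space of smooth functions $F$ on $(G\times G')/(K\times K')$ (viewed as right $(K\times K')$-invariant functions on $G\times G'$) with $R_uF=\chi_{\lambda,\nu}(u)F$ for all $u\in\mathfrak Z_{G\times G'}$. The superscript $\operatorname{diag}G'$ denotes invariants under left translation by $\{(x,x):x\in G'\}$. *)

theory Defs
  imports "HOL-Analysis.Analysis" "HOL-Algebra.QuotRing"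
begin

section \<open>Linear Lie groups and their Lie algebras\<close>

text \<open>
  A linear Lie group is a monoid record over a Euclidean space whose multiplication is the
  (total, bilinear) product of the ambient associative algebra and whose carrier is the group.
  Thus the same record also multiplies Lie algebra elements, and \<^const>\<open>DirProd\<close>
  of two such records is again of this kind, with ambient algebra the product algebra.
\<close>

definition linear_group :: "(real^'n^'n) set \<Rightarrow> (real^'n^'n) monoid"
  where "linear_group S = \<lparr>carrier = S, mult = (**), one = mat 1\<rparr>"

definition Exp :: "('a::euclidean_space) monoid \<Rightarrow> 'a \<Rightarrow> 'a"
  where "Exp G X = (\<Sum>k. (1 / fact k) *\<^sub>R (X [^]\<^bsub>G\<^esub> (k::nat)))"

definition Lie :: "('a::euclidean_space) monoid \<Rightarrow> 'a set"
  where "Lie G = {X. \<forall>t::real. Exp G (t *\<^sub>R X) \<in> carrier G}"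

definition bracket :: "('a::euclidean_space) monoid \<Rightarrow> 'a \<Rightarrow> 'a \<Rightarrow> 'a"
  where "bracket G X Y = X \<otimes>\<^bsub>G\<^esub> Y - Y \<otimes>\<^bsub>G\<^esub> X"

definition Ad :: "('a::euclidean_space) monoid \<Rightarrow> 'a \<Rightarrow> 'a \<Rightarrow> 'a"
  where "Ad G g X = g \<otimes>\<^bsub>G\<^esub> X \<otimes>\<^bsub>G\<^esub> (inv\<^bsub>G\<^esub> g)"

text \<open>The pair \<open>(X, Y)\<close> stands for the element \<open>X + \<i>Y\<close> of the complexification.\<close>

definition complexify :: "'a set \<Rightarrow> ('a \<times> 'a) set"
  where "complexify V = V \<times> V"

definition scaleCx :: "complex \<Rightarrow> ('a::real_vector) \<times> 'a \<Rightarrow> 'a \<times> 'a"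
  where "scaleCx c Z = (Re c *\<^sub>R fst Z - Im c *\<^sub>R snd Z, Re c *\<^sub>R snd Z + Im c *\<^sub>R fst Z)"

definition bracketCx :: "('a::euclidean_space) monoid \<Rightarrow> 'a \<times> 'a \<Rightarrow> 'a \<times> 'a \<Rightarrow> 'a \<times> 'a"
  where "bracketCx G Z W =
    (bracket G (fst Z) (fst W) - bracket G (snd Z) (snd W),
     bracket G (fst Z) (snd W) + bracket G (snd Z) (fst W))"

abbreviation LieCx :: "('a::euclidean_space) monoid \<Rightarrow> ('a \<times> 'a) set"
  where "LieCx G \<equiv> complexify (Lie G)"

abbreviation AdCx :: "('a::euclidean_space) monoid \<Rightarrow> 'a \<Rightarrow> 'a \<times> 'a \<Rightarrow> 'a \<times> 'a"
  where "AdCx G g \<equiv> map_prod (Ad G g) (Ad G g)"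


section \<open>Reductive groups\<close>

definition algebraic_group :: "(real^'n^'n) set \<Rightarrow> bool"
  where "algebraic_group H \<longleftrightarrow>
    subgroup H (linear_group {A. invertible A}) \<and>
    (\<exists>P. (\<forall>p\<in>P. real_polynomial_function p) \<and> H = {A. invertible A \<and> (\<forall>p\<in>P. p A = 0)})"

definition unipotent :: "real^'n^'n \<Rightarrow> bool"
  where "unipotent A \<longleftrightarrow> (\<exists>k::nat. (A - mat 1) [^]\<^bsub>linear_group UNIV\<^esub> k = 0)"

text \<open>
  Triviality of the unipotent radical. Connectedness of \<open>U\<close> need not be required,
  since unipotent algebraic groups in characteristic zero are connected.
\<close>

definition reductive_algebraic_group :: "(real^'n^'n) set \<Rightarrow> bool"
  where "reductive_algebraic_group H \<longleftrightarrow>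
    algebraic_group H \<and>
    (\<forall>U. U \<lhd> linear_group H \<and> algebraic_group U \<and> (\<forall>u\<in>U. unipotent u) \<longrightarrow> U = {mat 1})"

definition real_reductive_linear_group :: "(real^'n^'n) set \<Rightarrow> bool"
  where "real_reductive_linear_group G \<longleftrightarrow>
    (\<exists>H. reductive_algebraic_group H \<and> subgroup G (linear_group H) \<and> openin (top_of_set H) G)"

text \<open>
  Openness of \<open>G'\<close> in \<open>H\<close> is needed, because \<open>H\<close> is not required to lie in
  the algebraic group containing \<open>G\<close>, and an intersection of reductive groups may fail to be
  reductive.
\<close>

definition algebraic_reductive_subgroup :: "(real^'n^'n) set \<Rightarrow> (real^'n^'n) set \<Rightarrow> bool"
  where "algebraic_reductive_subgroup G' G \<longleftrightarrow>
    (\<exists>H. reductive_algebraic_group H \<and> G' = G \<inter> H \<and> openin (top_of_set H) G')"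

definition maximal_compact_subgroup :: "(real^'n^'n) set \<Rightarrow> (real^'n^'n) set \<Rightarrow> bool"
  where "maximal_compact_subgroup K G \<longleftrightarrow>
    subgroup K (linear_group G) \<and> compact K \<and>
    (\<forall>L. subgroup L (linear_group G) \<and> compact L \<and> K \<subseteq> L \<longrightarrow> L = K)"


section \<open>The universal enveloping algebra\<close>

text \<open>
  Free unital associative \<open>\<complex>\<close>-algebra on the set \<open>V\<close>: finitely supported
  functions on words over \<open>V\<close> with the convolution product.
\<close>

definition free_algebra :: "'v set \<Rightarrow> ('v list \<Rightarrow> complex) ring"
  where "free_algebra V =
    \<lparr>carrier = {p. finite {w. p w \<noteq> 0} \<and> (\<forall>w. p w \<noteq> 0 \<longrightarrow> set w \<subseteq> V)},
     mult = (\<lambda>p q w. \<Sum>k\<le>length w. p (take k w) * q (drop k w)),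
     one = (\<lambda>w. of_bool (w = [])),
     zero = (\<lambda>w. 0),
     add = (\<lambda>p q w. p w + q w)\<rparr>"

definition word :: "'v list \<Rightarrow> 'v list \<Rightarrow> complex"
  where "word v = (\<lambda>w. of_bool (w = v))"

definition push :: "('v \<Rightarrow> 'w) \<Rightarrow> ('v list \<Rightarrow> complex) \<Rightarrow> 'w list \<Rightarrow> complex"
  where "push \<phi> p = (\<lambda>w. \<Sum>v | p v \<noteq> 0 \<and> map \<phi> v = w. p v)"

text \<open>
  The first two families of relations turn the free algebra on the set \<open>\<gg>\<^sub>\<complex>\<close> into
  the tensor algebra of the vector space \<open>\<gg>\<^sub>\<complex>\<close>.
\<close>

definition U_relations ::
  "('a::euclidean_space) monoid \<Rightarrow> (('a \<times> 'a) list \<Rightarrow> complex) set"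
  where "U_relations G =
    {(\<lambda>w. word [X + Y] w - word [X] w - word [Y] w) | X Y. X \<in> LieCx G \<and> Y \<in> LieCx G} \<union>
    {(\<lambda>w. word [scaleCx c X] w - c * word [X] w) | c X. X \<in> LieCx G} \<union>
    {(\<lambda>w. word [X, Y] w - word [Y, X] w - word [bracketCx G X Y] w) | X Y.
        X \<in> LieCx G \<and> Y \<in> LieCx G}"

definition U_ideal :: "('a::euclidean_space) monoid \<Rightarrow> (('a \<times> 'a) list \<Rightarrow> complex) set"
  where "U_ideal G = Idl\<^bsub>free_algebra (LieCx G)\<^esub> (U_relations G)"

definition U_alg :: "('a::euclidean_space) monoid \<Rightarrow> (('a \<times> 'a) list \<Rightarrow> complex) set ring"
  where "U_alg G = free_algebra (LieCx G) Quot U_ideal G"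

definition U_class ::
  "('a::euclidean_space) monoid \<Rightarrow> (('a \<times> 'a) list \<Rightarrow> complex) \<Rightarrow>
    (('a \<times> 'a) list \<Rightarrow> complex) set"
  where "U_class G p = U_ideal G +>\<^bsub>free_algebra (LieCx G)\<^esub> p"

definition U_scalar ::
  "('a::euclidean_space) monoid \<Rightarrow> complex \<Rightarrow> (('a \<times> 'a) list \<Rightarrow> complex) set"
  where "U_scalar G c = U_class G (\<lambda>w. c * word [] w)"

text \<open>
  The algebra homomorphism into \<open>U(\<hh>\<^sub>\<complex>)\<close> induced by a complex Lie algebra
  homomorphism \<open>\<phi> : \<gg>\<^sub>\<complex> \<rightarrow> \<hh>\<^sub>\<complex>\<close>, where \<open>H\<close> is the target group.
\<close>

definition U_map ::
  "('b::euclidean_space) monoid \<Rightarrow> ('a \<times> 'a \<Rightarrow> 'b \<times> 'b) \<Rightarrow>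
    (('a \<times> 'a) list \<Rightarrow> complex) set \<Rightarrow> (('b \<times> 'b) list \<Rightarrow> complex) set"
  where "U_map H \<phi> u = the_elem ((\<lambda>p. U_class H (push \<phi> p)) ` u)"

definition ZG :: "('a::euclidean_space) monoid \<Rightarrow> (('a \<times> 'a) list \<Rightarrow> complex) set set"
  where "ZG G = {u \<in> carrier (U_alg G). \<forall>g\<in>carrier G. U_map G (AdCx G g) u = u}"

definition ZG_characters ::
  "('a::euclidean_space) monoid \<Rightarrow> ((('a \<times> 'a) list \<Rightarrow> complex) set \<Rightarrow> complex) set"
  where "ZG_characters G = {chi \<in> extensional (ZG G).
    (\<forall>u\<in>ZG G. \<forall>v\<in>ZG G.
        chi (u \<oplus>\<^bsub>U_alg G\<^esub> v) = chi u + chi v \<and> chi (u \<otimes>\<^bsub>U_alg G\<^esub> v) = chi u * chi v) \<and>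
    (\<forall>c. chi (U_scalar G c) = c)}"

text \<open>
  The unique character of \<open>\<ZZ>\<^bsub>G\<times>G'\<^esub> \<simeq> \<ZZ>\<^sub>G \<otimes> \<ZZ>\<^bsub>G'\<^esub>\<close> corresponding to a pair of
  characters; the two factors are embedded via \<open>X \<mapsto> (X, 0)\<close> and \<open>X \<mapsto> (0, X)\<close>.
\<close>

definition product_character ::
  "('a::euclidean_space) monoid \<Rightarrow> ('b::euclidean_space) monoid \<Rightarrow>
    ((('a \<times> 'a) list \<Rightarrow> complex) set \<Rightarrow> complex) \<Rightarrow>
    ((('b \<times> 'b) list \<Rightarrow> complex) set \<Rightarrow> complex) \<Rightarrow>
    (((('a \<times> 'b) \<times> ('a \<times> 'b)) list \<Rightarrow> complex) set \<Rightarrow> complex)"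
  where "product_character G G' chi chi' =
    (THE \<xi>. \<xi> \<in> ZG_characters (G \<times>\<times> G') \<and>
      (\<forall>u\<in>ZG G. \<forall>v\<in>ZG G'.
        \<xi> (U_map (G \<times>\<times> G') (map_prod (\<lambda>X. (X, 0)) (\<lambda>X. (X, 0))) u
            \<otimes>\<^bsub>U_alg (G \<times>\<times> G')\<^esub>
           U_map (G \<times>\<times> G') (map_prod (Pair 0) (Pair 0)) v) = chi u * chi' v))"


section \<open>The Harish-Chandra parametrization\<close>

definition cartan_subalgebra :: "('a::euclidean_space) monoid \<Rightarrow> 'a set \<Rightarrow> bool"
  where "cartan_subalgebra G \<jj> \<longleftrightarrow>
    subspace \<jj> \<and> \<jj> \<subseteq> Lie G \<and> (\<forall>X\<in>\<jj>. \<forall>Y\<in>\<jj>. bracket G X Y \<in> \<jj>) \<and>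
    (\<exists>n. \<forall>Xs. \<forall>Y\<in>\<jj>. length Xs = n \<and> set Xs \<subseteq> \<jj> \<longrightarrow> foldr (bracket G) Xs Y = 0) \<and>
    {X \<in> Lie G. \<forall>Y\<in>\<jj>. bracket G X Y \<in> \<jj>} = \<jj>"

definition dualCx :: "('a::euclidean_space) set \<Rightarrow> ('a \<times> 'a \<Rightarrow> complex) set"
  where "dualCx \<jj> = {\<mu> \<in> extensional (complexify \<jj>).
    (\<forall>X\<in>complexify \<jj>. \<forall>Y\<in>complexify \<jj>. \<mu> (X + Y) = \<mu> X + \<mu> Y) \<and>
    (\<forall>c. \<forall>X\<in>complexify \<jj>. \<mu> (scaleCx c X) = c * \<mu> X)}"

text \<open>
  The group generated by \<open>Ad(G)\<close> and \<open>Int(\<gg>\<^sub>\<complex>)\<close>; the generating set is closed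
  under inverses, so closure under composition suffices.
\<close>

inductive_set G_tilde :: "('a::euclidean_space) monoid \<Rightarrow> ('a \<times> 'a \<Rightarrow> 'a \<times> 'a) set"
  for G :: "'a monoid" where
  Ad: "g \<in> carrier G \<Longrightarrow> AdCx G g \<in> G_tilde G"
| Int: "X \<in> LieCx G \<Longrightarrow> (\<lambda>Y. \<Sum>k. (1 / fact k) *\<^sub>R ((bracketCx G X ^^ k) Y)) \<in> G_tilde G"
| comp: "a \<in> G_tilde G \<Longrightarrow> b \<in> G_tilde G \<Longrightarrow> a \<circ> b \<in> G_tilde G"

text \<open>
  The quotient of the normalizer by the centralizer, realized as the group of restrictions to
  \<open>\<jj>\<^sub>\<complex>\<close> of elements of the normalizer.
\<close>

definition weyl_group :: "('a::euclidean_space) monoid \<Rightarrow> 'a set \<Rightarrow> ('a \<times> 'a \<Rightarrow> 'a \<times> 'a) set"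
  where "weyl_group G \<jj> =
    {restrict a (complexify \<jj>) | a. a \<in> G_tilde G \<and> a ` complexify \<jj> = complexify \<jj>}"

definition dual_mod_weyl ::
  "('a::euclidean_space) monoid \<Rightarrow> 'a set \<Rightarrow> ('a \<times> 'a \<Rightarrow> complex) set set"
  where "dual_mod_weyl G \<jj> =
    (\<lambda>\<mu>. (\<lambda>s. restrict (\<mu> \<circ> s) (complexify \<jj>)) ` weyl_group G \<jj>) ` dualCx \<jj>"

definition root_space ::
  "('a::euclidean_space) monoid \<Rightarrow> 'a set \<Rightarrow> ('a \<times> 'a \<Rightarrow> complex) \<Rightarrow> ('a \<times> 'a) set"
  where "root_space G \<jj> \<alpha> =
    {X \<in> LieCx G. \<forall>H\<in>complexify \<jj>. bracketCx G H X = scaleCx (\<alpha> H) X}"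

definition roots :: "('a::euclidean_space) monoid \<Rightarrow> 'a set \<Rightarrow> ('a \<times> 'a \<Rightarrow> complex) set"
  where "roots G \<jj> =
    {\<alpha> \<in> dualCx \<jj>. (\<exists>H\<in>complexify \<jj>. \<alpha> H \<noteq> 0) \<and> root_space G \<jj> \<alpha> \<noteq> {0}}"

definition positive_system ::
  "('a::euclidean_space) monoid \<Rightarrow> 'a set \<Rightarrow> ('a \<times> 'a \<Rightarrow> complex) set \<Rightarrow> bool"
  where "positive_system G \<jj> P \<longleftrightarrow>
    P \<subseteq> roots G \<jj> \<and>
    (\<forall>\<alpha>\<in>roots G \<jj>. \<alpha> \<in> P \<longleftrightarrow> (\<lambda>H\<in>complexify \<jj>. - \<alpha> H) \<notin> P) \<and>
    (\<forall>\<alpha>\<in>P. \<forall>\<beta>\<in>P. (\<lambda>H\<in>complexify \<jj>. \<alpha> H + \<beta> H) \<in> roots G \<jj> \<longrightarrow>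
        (\<lambda>H\<in>complexify \<jj>. \<alpha> H + \<beta> H) \<in> P)"

text \<open>
  \<open>\<chi> = \<chi>\<^sub>\<lambda>\<close> for the Weyl group orbit \<open>\<Lambda>\<close> of \<open>\<lambda>\<close>: if
  \<open>z \<in> p + U(\<gg>\<^sub>\<complex>)\<nn>\<^sup>+\<close> with \<open>p \<in> U(\<jj>\<^sub>\<complex>) = S(\<jj>\<^sub>\<complex>)\<close>, then
  \<open>\<chi>(z)\<close> is the value of \<open>p\<close> at \<open>\<lambda> - \<rho>\<close>. Here \<open>p\<close> and \<open>q \<in> U(\<gg>\<^sub>\<complex>)\<nn>\<^sup>+\<close> are
  represented by linear combinations of words over \<open>\<jj>\<^sub>\<complex>\<close>, and of words
  ending in a positive root vector, respectively.
\<close>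

definition harish_chandra_character ::
  "('a::euclidean_space) monoid \<Rightarrow> 'a set \<Rightarrow> ('a \<times> 'a \<Rightarrow> complex) set \<Rightarrow>
    ((('a \<times> 'a) list \<Rightarrow> complex) set \<Rightarrow> complex) \<Rightarrow> bool"
  where "harish_chandra_character G \<jj> \<Lambda> chi \<longleftrightarrow>
    chi \<in> ZG_characters G \<and>
    (\<exists>lam\<in>\<Lambda>. \<exists>P. positive_system G \<jj> P \<and>
      (\<forall>z\<in>ZG G. \<forall>p\<in>carrier (free_algebra (complexify \<jj>)).
        \<forall>q\<in>carrier (free_algebra (LieCx G)).
          (\<forall>w. q w \<noteq> 0 \<longrightarrow> w \<noteq> [] \<and> last w \<in> (\<Union>\<alpha>\<in>P. root_space G \<jj> \<alpha>)) \<and>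
          z = U_class G (p \<oplus>\<^bsub>free_algebra (LieCx G)\<^esub> q) \<longrightarrow>
          chi z = (\<Sum>w | p w \<noteq> 0.
            p w * prod_list (map (\<lambda>H. lam H - (\<Sum>\<alpha>\<in>P. \<alpha> H) / 2) w))))"


section \<open>Smooth functions and invariant differential operators\<close>

fun Ck_on :: "nat \<Rightarrow> ('a::euclidean_space \<Rightarrow> complex) \<Rightarrow> 'a set \<Rightarrow> bool" where
  "Ck_on 0 f S \<longleftrightarrow> continuous_on S f"
| "Ck_on (Suc k) f S \<longleftrightarrow>
    f differentiable_on S \<and> (\<forall>v. Ck_on k (\<lambda>x. frechet_derivative f (at x) v) S)"

text \<open>
  Functions on a group are extensional functions on the ambient space. Smoothness on the
  embedded submanifold \<open>G\<close> means being locally the restriction of a smooth function.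
\<close>

definition C_infinity :: "('a::euclidean_space) monoid \<Rightarrow> ('a \<Rightarrow> complex) set"
  where "C_infinity G = {f \<in> extensional (carrier G).
    \<forall>g\<in>carrier G. \<exists>S h. open S \<and> g \<in> S \<and> (\<forall>k. Ck_on k h S) \<and>
      (\<forall>x\<in>S \<inter> carrier G. f x = h x)}"

definition R_vec :: "('a::euclidean_space) monoid \<Rightarrow> 'a \<Rightarrow> ('a \<Rightarrow> complex) \<Rightarrow> 'a \<Rightarrow> complex"
  where "R_vec G X f =
    (\<lambda>g\<in>carrier G. vector_derivative (\<lambda>t. f (g \<otimes>\<^bsub>G\<^esub> Exp G (t *\<^sub>R X))) (at 0))"

definition L_vec :: "('a::euclidean_space) monoid \<Rightarrow> 'a \<Rightarrow> ('a \<Rightarrow> complex) \<Rightarrow> 'a \<Rightarrow> complex"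
  where "L_vec G X f =
    (\<lambda>g\<in>carrier G. vector_derivative (\<lambda>t. f (Exp G ((- t) *\<^sub>R X) \<otimes>\<^bsub>G\<^esub> g)) (at 0))"

text \<open>
  Extension of a representation \<open>D\<close> of \<open>\<gg>\<close> on functions on \<open>S\<close>, first complex linearly to
  \<open>\<gg>\<^sub>\<complex>\<close>, then to linear combinations of words, and finally to classes in
  \<open>U(\<gg>\<^sub>\<complex>)\<close> (on smooth functions the result does not depend on the representative).
\<close>

definition act_Cx ::
  "'a set \<Rightarrow> ('a \<Rightarrow> ('a \<Rightarrow> complex) \<Rightarrow> 'a \<Rightarrow> complex) \<Rightarrow>
    'a \<times> 'a \<Rightarrow> ('a \<Rightarrow> complex) \<Rightarrow> 'a \<Rightarrow> complex"
  where "act_Cx S D Z f = (\<lambda>g\<in>S. D (fst Z) f g + \<i> * D (snd Z) f g)"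

definition act_free ::
  "'a set \<Rightarrow> ('a \<Rightarrow> ('a \<Rightarrow> complex) \<Rightarrow> 'a \<Rightarrow> complex) \<Rightarrow>
    (('a \<times> 'a) list \<Rightarrow> complex) \<Rightarrow> ('a \<Rightarrow> complex) \<Rightarrow> 'a \<Rightarrow> complex"
  where "act_free S D p f = (\<lambda>g\<in>S. \<Sum>w | p w \<noteq> 0. p w * foldr (act_Cx S D) w f g)"

definition act_U ::
  "'a set \<Rightarrow> ('a \<Rightarrow> ('a \<Rightarrow> complex) \<Rightarrow> 'a \<Rightarrow> complex) \<Rightarrow>
    (('a \<times> 'a) list \<Rightarrow> complex) set \<Rightarrow> ('a \<Rightarrow> complex) \<Rightarrow> 'a \<Rightarrow> complex"
  where "act_U S D u f = the_elem ((\<lambda>p. act_free S D p f) ` u)"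

definition R_op ::
  "('a::euclidean_space) monoid \<Rightarrow> (('a \<times> 'a) list \<Rightarrow> complex) set \<Rightarrow>
    ('a \<Rightarrow> complex) \<Rightarrow> 'a \<Rightarrow> complex"
  where "R_op G = act_U (carrier G) (R_vec G)"

definition L_op ::
  "('a::euclidean_space) monoid \<Rightarrow> (('a \<times> 'a) list \<Rightarrow> complex) set \<Rightarrow>
    ('a \<Rightarrow> complex) \<Rightarrow> 'a \<Rightarrow> complex"
  where "L_op G = act_U (carrier G) (L_vec G)"


section \<open>Shintani functions\<close>

definition Sh ::
  "(real^'n^'n) set \<Rightarrow> (real^'n^'n) set \<Rightarrow> (real^'n^'n) set \<Rightarrow> (real^'n^'n) set \<Rightarrow>
    ((((real^'n^'n) \<times> (real^'n^'n)) list \<Rightarrow> complex) set \<Rightarrow> complex) \<Rightarrow>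
    ((((real^'n^'n) \<times> (real^'n^'n)) list \<Rightarrow> complex) set \<Rightarrow> complex) \<Rightarrow>
    (real^'n^'n \<Rightarrow> complex) set"
  where "Sh G G' K K' chi chi' = {f \<in> C_infinity (linear_group G).
    (\<forall>k'\<in>K'. \<forall>g\<in>G. \<forall>k\<in>K. f (k' ** g ** k) = f g) \<and>
    (\<forall>u\<in>ZG (linear_group G). \<forall>g\<in>G. R_op (linear_group G) u f g = chi u * f g) \<and>
    (\<forall>v\<in>ZG (linear_group G'). \<forall>g\<in>G. L_op (linear_group G) v f g = chi' v * f g)}"

definition C_infinity_eigen ::
  "('a::euclidean_space) monoid \<Rightarrow> 'a set \<Rightarrow> ((('a \<times> 'a) list \<Rightarrow> complex) set \<Rightarrow> complex) \<Rightarrow>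
    ('a \<Rightarrow> complex) set"
  where "C_infinity_eigen G K chi = {F \<in> C_infinity G.
    (\<forall>g\<in>carrier G. \<forall>k\<in>K. F (g \<otimes>\<^bsub>G\<^esub> k) = F g) \<and>
    (\<forall>u\<in>ZG G. \<forall>g\<in>carrier G. R_op G u F g = chi u * F g)}"

definition left_invariants ::
  "('a::euclidean_space) monoid \<Rightarrow> 'a set \<Rightarrow> ('a \<Rightarrow> complex) set \<Rightarrow> ('a \<Rightarrow> complex) set"
  where "left_invariants G D V = {F \<in> V. \<forall>d\<in>D. \<forall>g\<in>carrier G. F (d \<otimes>\<^bsub>G\<^esub> g) = F g}"

definition psi :: "(real^'n^'n) set \<Rightarrow> (real^'n^'n) \<times> (real^'n^'n) \<Rightarrow> real^'n^'n"
  where "psi G = (\<lambda>(g, g'). inv\<^bsub>linear_group G\<^esub> g' ** g)"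

definition psi_pullback ::
  "(real^'n^'n) set \<Rightarrow> (real^'n^'n) set \<Rightarrow> (real^'n^'n \<Rightarrow> complex) \<Rightarrow>
    (real^'n^'n) \<times> (real^'n^'n) \<Rightarrow> complex"
  where "psi_pullback G G' f = restrict (f \<circ> psi G) (G \<times> G')"

end

theory Submission
  imports Defs "HOL-Library.Function_Algebras"
begin

text \<open>
  Put \<open>F(g, g') = f(g'\<^sup>-\<^sup>1 g)\<close>. Then \<open>R\<^bsub>(X, 0)\<^esub> F\<close> and \<open>R\<^bsub>(0, Y)\<^esub> F\<close> are the pull-backs
  of \<open>R\<^sub>X f\<close> and \<open>L\<^sub>Y f\<close>, diagonally invariant functions are determined by their values on
  \<open>G \<times> {1}\<close>, and the invariance conditions under \<open>K\<close> and \<open>K'\<close> match. What remains is that a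
  pair of eigencharacters amounts to one eigencharacter of \<open>\<ZZ>\<^bsub>G\<times>G'\<^esub>\<close>, i.e. that
  \<open>\<ZZ>\<^bsub>G\<times>G'\<^esub> = \<ZZ>\<^sub>G \<otimes> \<ZZ>\<^bsub>G'\<^esub>\<close>. This is seen on the dual side: linear forms on
  \<open>U(\<gg>\<^sub>\<complex>)\<close> are functions on words that respect the defining relations, and those of
  \<open>U((\<gg> \<times> \<gg>')\<^sub>\<complex>)\<close> correspond, by unshuffling words, to bilinear forms on
  \<open>U(\<gg>\<^sub>\<complex>) \<times> U(\<gg>'\<^sub>\<complex>)\<close>. That the operators \<open>R\<^sub>u\<close> and \<open>L\<^sub>u\<close> are well defined rests on
  the Lie-Trotter product formula (the Lie algebra of a closed group is a Lie algebra) and on the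
  symmetry of second derivatives.
\<close>


section \<open>The free algebra and its pairing with functions on words\<close>

text \<open>\<open>U_alg\<close> is a bare quotient of the algebra of words, so no normal form
  (Poincare-Birkhoff-Witt basis) is at hand to compare classes. A double annihilator argument
  replaces it: words are a basis of the free algebra, so every function \<open>F\<close> on words is
  a linear form, evaluated by \<open>pairing\<close>, and over a field an element killed by all
  forms vanishing on the ideal lies in the ideal. Equality of classes, invariance and products
  become identities between finite sums. \<open>product_character\<close> is a definite description
  and says nothing until existence and uniqueness are shown. Uniqueness needs products of embedded
  invariants to span the invariants of the product group. For existence, a character is extended to
  a form on the whole enveloping algebra; the extension is only linear, and multiplicativity is
  recovered on decomposed elements, whose factors are invariant. On the analytic side functions live
  on the group only. Translations are flows of vector fields that are linear on the ambient algebra,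
  so derivatives can be computed from any local smooth extension.\<close>

definition pairing :: "('v list \<Rightarrow> complex) \<Rightarrow> ('v list \<Rightarrow> complex) \<Rightarrow> complex"
  where "pairing p F = (\<Sum>w | p w \<noteq> 0. p w * F w)"

abbreviation fin_supp :: "('v list \<Rightarrow> complex) \<Rightarrow> bool"
  where "fin_supp p \<equiv> finite {w. p w \<noteq> 0}"

lemma pairing_superset:
  assumes "finite A" "{w. p w \<noteq> 0} \<subseteq> A"
  shows "pairing p F = (\<Sum>w\<in>A. p w * F w)"
  unfolding pairing_def using assms by (intro sum.mono_neutral_left) auto

lemma pairing_word [simp]: "pairing (word v) F = F v"
  by (subst pairing_superset[of "{v}"]) (auto simp: word_def)

lemma fin_supp_word [simp]: "fin_supp (word v)"
  by (rule finite_subset[of _ "{v}"]) (auto simp: word_def)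

lemma fin_supp_add: "fin_supp p \<Longrightarrow> fin_supp q \<Longrightarrow> fin_supp (\<lambda>w. p w + q w)"
  by (rule finite_subset[of _ "{w. p w \<noteq> 0} \<union> {w. q w \<noteq> 0}"]) auto

lemma fin_supp_diff: "fin_supp p \<Longrightarrow> fin_supp q \<Longrightarrow> fin_supp (\<lambda>w. p w - q w)"
  by (rule finite_subset[of _ "{w. p w \<noteq> 0} \<union> {w. q w \<noteq> 0}"]) auto

lemma fin_supp_scale: "fin_supp p \<Longrightarrow> fin_supp (\<lambda>w. c * p w)"
  by (rule finite_subset[of _ "{w. p w \<noteq> 0}"]) auto

lemma pairing_add:
  assumes "fin_supp p" "fin_supp q"
  shows "pairing (\<lambda>w. p w + q w) F = pairing p F + pairing q F"
proof -
  let ?A = "{w. p w \<noteq> 0} \<union> {w. q w \<noteq> 0}"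
  have "pairing r F = (\<Sum>w\<in>?A. r w * F w)" if "{w. r w \<noteq> 0} \<subseteq> ?A" for r
    using that assms by (intro pairing_superset) auto
  moreover have "{w. p w + q w \<noteq> 0} \<subseteq> ?A" by auto
  ultimately show ?thesis
    by (simp add: sum.distrib[symmetric] distrib_right)
qed

lemma pairing_scale: "pairing (\<lambda>w. c * p w) F = c * pairing p F"
proof (cases "c = 0")
  case False
  then show ?thesis
    by (simp add: pairing_def sum_distrib_left mult.assoc)
qed (simp add: pairing_def)

lemma pairing_diff:
  assumes "fin_supp p" "fin_supp q"
  shows "pairing (\<lambda>w. p w - q w) F = pairing p F - pairing q F"
  using pairing_add[OF assms(1) fin_supp_scale[OF assms(2)], of "-1" F]
  by (simp add: pairing_scale[of "-1", simplified])

lemma pairing_cong: "(\<And>w. p w \<noteq> 0 \<Longrightarrow> F w = H w) \<Longrightarrow> pairing p F = pairing p H"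
  by (simp add: pairing_def)

lemma pairing_right_add: "pairing p (\<lambda>w. F w + H w) = pairing p F + pairing p H"
  by (simp add: pairing_def sum.distrib algebra_simps)

lemma pairing_right_scale: "pairing p (\<lambda>w. c * F w) = c * pairing p F"
  by (simp add: pairing_def sum_distrib_left mult.left_commute)

lemma pairing_right_scale': "pairing p (\<lambda>w. F w * c) = pairing p F * c"
  by (simp add: pairing_def sum_distrib_right mult.assoc)

lemma pairing_right_zero [simp]: "pairing p (\<lambda>w. 0) = 0"
  by (simp add: pairing_def)

lemma pairing_delta: "fin_supp p \<Longrightarrow> pairing p (\<lambda>v. of_bool (v = w)) = p w"
  by (subst pairing_superset[of "insert w {w. p w \<noteq> 0}"]) (auto simp: of_bool_def if_distrib cong: if_cong)

text \<open>The forms that are 1 at one word and 0 elsewhere read off coefficients. Ring laws can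
  therefore be checked after applying \<open>pairing\<close>, where convolution is easy to
  handle.\<close>

lemma pairing_eqI:
  "\<lbrakk>fin_supp p; fin_supp q; \<And>F. pairing p F = pairing q F\<rbrakk> \<Longrightarrow> p = q"
  by (rule ext) (metis pairing_delta)

lemma free_algebra_carrier_iff:
  "p \<in> carrier (free_algebra V) \<longleftrightarrow> fin_supp p \<and> (\<forall>w. p w \<noteq> 0 \<longrightarrow> set w \<subseteq> V)"
  by (simp add: free_algebra_def)

lemma free_algebra_simps:
  "zero (free_algebra V) = (\<lambda>w. 0)" "one (free_algebra V) = word []"
  "p \<oplus>\<^bsub>free_algebra V\<^esub> q = (\<lambda>w. p w + q w)"
  by (simp_all add: free_algebra_def word_def)

lemma fin_supp_carrier: "p \<in> carrier (free_algebra V) \<Longrightarrow> fin_supp p"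
  by (simp add: free_algebra_carrier_iff)

text \<open>Convolution does not see the alphabet \<open>V\<close>; rewriting every product to the
  one over \<open>UNIV\<close> lets a single set of rules serve all enveloping algebras.\<close>

abbreviation free_mult ::
  "('v list \<Rightarrow> complex) \<Rightarrow> ('v list \<Rightarrow> complex) \<Rightarrow> 'v list \<Rightarrow> complex"
  where "free_mult p q \<equiv> p \<otimes>\<^bsub>free_algebra UNIV\<^esub> q"

lemma free_mult_eq: "p \<otimes>\<^bsub>free_algebra V\<^esub> q = free_mult p q"
  by (simp add: free_algebra_def)

lemma free_mult_nonzero:
  "free_mult p q w \<noteq> 0 \<Longrightarrow> \<exists>u v. w = u @ v \<and> p u \<noteq> 0 \<and> q v \<noteq> 0"
proof -
  assume "free_mult p q w \<noteq> 0"
  then have "(\<Sum>k\<le>length w. p (take k w) * q (drop k w)) \<noteq> 0"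
    by (simp add: free_algebra_def)
  then obtain k where "p (take k w) * q (drop k w) \<noteq> 0"
    by (rule sum.not_neutral_contains_not_neutral)
  then show ?thesis
    by (metis append_take_drop_id mult_eq_0_iff)
qed

lemma free_mult_supp:
  "{w. free_mult p q w \<noteq> 0} \<subseteq> (\<lambda>(u, v). u @ v) ` ({w. p w \<noteq> 0} \<times> {w. q w \<noteq> 0})"
  using free_mult_nonzero by fastforce

lemma fin_supp_mult: "fin_supp p \<Longrightarrow> fin_supp q \<Longrightarrow> fin_supp (free_mult p q)"
  by (rule finite_subset[OF free_mult_supp]) auto

text \<open>Multiplication is the bilinear extension of concatenation. All later computations with
  products go through this rule, which trades convolution for nested sums over two words.\<close>

lemma pairing_mult:
  assumes "fin_supp p" "fin_supp q"
  shows "pairing (free_mult p q) F = pairing p (\<lambda>u. pairing q (\<lambda>v. F (u @ v)))"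
proof -
  let ?S = "{w. p w \<noteq> 0} \<times> {w. q w \<noteq> 0}"
  let ?c = "\<lambda>(u, v). u @ v"
  have fin: "finite ?S" using assms by auto
  \<comment> \<open>The cuts of \<open>w\<close> at the positions 0 up to \<open>length w\<close>
    are exactly the pairs with concatenation \<open>w\<close>; pairs outside the supports contribute
    0. The sum over all pairs is then grouped by concatenation.\<close>
  have eq: "free_mult p q w = (\<Sum>(u, v) | (u, v) \<in> ?S \<and> ?c (u, v) = w. p u * q v)" for w
  proof -
    have "free_mult p q w = (\<Sum>(u, v)\<in>(\<lambda>k. (take k w, drop k w)) ` {..length w}. p u * q v)"
      unfolding free_algebra_def
      by (subst sum.reindex) (auto simp: inj_on_def dest: arg_cong[where f = length])
    also have "\<dots> = (\<Sum>(u, v) | (u, v) \<in> ?S \<and> ?c (u, v) = w. p u * q v)"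
    proof (rule sum.mono_neutral_right)
      show "{(u, v). (u, v) \<in> ?S \<and> ?c (u, v) = w} \<subseteq> (\<lambda>k. (take k w, drop k w)) ` {..length w}"
      proof clarify
        fix u v
        show "(u, v) \<in> (\<lambda>k. (take k (u @ v), drop k (u @ v))) ` {..length (u @ v)}"
          by (rule image_eqI[of _ _ "length u"]) auto
      qed
    qed auto
    finally show ?thesis .
  qed
  have "pairing (free_mult p q) F = (\<Sum>w\<in>?c ` ?S. free_mult p q w * F w)"
    using fin free_mult_supp by (intro pairing_superset) auto
  also have "\<dots> = (\<Sum>w\<in>?c ` ?S. \<Sum>x | x \<in> ?S \<and> ?c x = w. p (fst x) * q (snd x) * F (?c x))"
    unfolding eq sum_distrib_right
    by (intro sum.cong refl) (auto simp: case_prod_beta)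
  also have "\<dots> = (\<Sum>x\<in>?S. p (fst x) * q (snd x) * F (?c x))"
    using fin by (intro sum.group) auto
  also have "\<dots> = pairing p (\<lambda>u. pairing q (\<lambda>v. F (u @ v)))"
    by (simp add: pairing_def sum.cartesian_product sum_distrib_left case_prod_beta mult.assoc)
  finally show ?thesis .
qed

lemma word_in_carrier [simp]: "word w \<in> carrier (free_algebra V) \<longleftrightarrow> set w \<subseteq> V"
  by (simp add: free_algebra_carrier_iff) (auto simp: word_def)

lemma carrier_add:
  "p \<in> carrier (free_algebra V) \<Longrightarrow> q \<in> carrier (free_algebra V) \<Longrightarrow>
    (\<lambda>w. p w + q w) \<in> carrier (free_algebra V)"
  by (auto simp: free_algebra_carrier_iff fin_supp_add) (metis add.right_neutral subsetD add_0)

lemma carrier_scale: "p \<in> carrier (free_algebra V) \<Longrightarrow> (\<lambda>w. c * p w) \<in> carrier (free_algebra V)"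
  by (auto simp: free_algebra_carrier_iff fin_supp_scale)

lemma carrier_diff:
  "p \<in> carrier (free_algebra V) \<Longrightarrow> q \<in> carrier (free_algebra V) \<Longrightarrow>
    (\<lambda>w. p w - q w) \<in> carrier (free_algebra V)"
  using carrier_add[of p V "\<lambda>w. - 1 * q w"] carrier_scale[of q V "-1"] by simp

lemma carrier_mult:
  "p \<in> carrier (free_algebra V) \<Longrightarrow> q \<in> carrier (free_algebra V) \<Longrightarrow>
    free_mult p q \<in> carrier (free_algebra V)"
  using free_mult_nonzero[of p q] fin_supp_mult[of p q]
  unfolding free_algebra_carrier_iff by (smt (verit) le_sup_iff set_append)

lemma carrier_zero: "(\<lambda>w. 0) \<in> carrier (free_algebra V)"
  by (simp add: free_algebra_carrier_iff)

lemma ring_free_algebra: "ring (free_algebra V)"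
proof (rule ringI)
  show "abelian_group (free_algebra V)"
  proof (rule abelian_groupI)
    fix p assume "p \<in> carrier (free_algebra V)"
    then show "\<exists>q\<in>carrier (free_algebra V). q \<oplus>\<^bsub>free_algebra V\<^esub> p = \<zero>\<^bsub>free_algebra V\<^esub>"
      by (intro bexI[of _ "\<lambda>w. - 1 * p w"] carrier_scale) (auto simp: free_algebra_simps)
  qed (auto simp: free_algebra_simps carrier_add carrier_zero algebra_simps)
  show "Group.monoid (free_algebra V)"
  proof (rule Group.monoidI)
    show "\<one>\<^bsub>free_algebra V\<^esub> \<in> carrier (free_algebra V)"
      by (simp add: free_algebra_simps)
  next
    fix p q r
    assume "p \<in> carrier (free_algebra V)" "q \<in> carrier (free_algebra V)" "r \<in> carrier (free_algebra V)"
    then show "p \<otimes>\<^bsub>free_algebra V\<^esub> q \<otimes>\<^bsub>free_algebra V\<^esub> r =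
        p \<otimes>\<^bsub>free_algebra V\<^esub> (q \<otimes>\<^bsub>free_algebra V\<^esub> r)"
      unfolding free_mult_eq[of V]
      by (intro pairing_eqI) (simp_all add: fin_supp_carrier fin_supp_mult pairing_mult)
  next
    fix p assume "p \<in> carrier (free_algebra V)"
    then show "\<one>\<^bsub>free_algebra V\<^esub> \<otimes>\<^bsub>free_algebra V\<^esub> p = p"
      "p \<otimes>\<^bsub>free_algebra V\<^esub> \<one>\<^bsub>free_algebra V\<^esub> = p"
      unfolding free_mult_eq[of V] free_algebra_simps
      by (intro pairing_eqI; simp add: fin_supp_carrier fin_supp_mult pairing_mult)+
  qed (simp add: carrier_mult free_mult_eq[of V])
next
  fix p q r
  assume "p \<in> carrier (free_algebra V)" "q \<in> carrier (free_algebra V)" "r \<in> carrier (free_algebra V)"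
  then show "(p \<oplus>\<^bsub>free_algebra V\<^esub> q) \<otimes>\<^bsub>free_algebra V\<^esub> r =
      p \<otimes>\<^bsub>free_algebra V\<^esub> r \<oplus>\<^bsub>free_algebra V\<^esub> q \<otimes>\<^bsub>free_algebra V\<^esub> r"
    "r \<otimes>\<^bsub>free_algebra V\<^esub> (p \<oplus>\<^bsub>free_algebra V\<^esub> q) =
      r \<otimes>\<^bsub>free_algebra V\<^esub> p \<oplus>\<^bsub>free_algebra V\<^esub> r \<otimes>\<^bsub>free_algebra V\<^esub> q"
    unfolding free_mult_eq[of V] free_algebra_simps
    by (intro pairing_eqI; simp add: fin_supp_carrier fin_supp_mult fin_supp_add pairing_mult
          pairing_add pairing_right_add)+
qed

lemma push_nonzero: "push \<phi> p w \<noteq> 0 \<Longrightarrow> \<exists>v. p v \<noteq> 0 \<and> map \<phi> v = w"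
  unfolding push_def by (erule sum.not_neutral_contains_not_neutral) blast

lemma fin_supp_push: "fin_supp p \<Longrightarrow> fin_supp (push \<phi> p)"
proof (rule finite_subset)
  show "{w. push \<phi> p w \<noteq> 0} \<subseteq> map \<phi> ` {w. p w \<noteq> 0}"
    using push_nonzero[of \<phi> p] by blast
qed simp

lemma pairing_push:
  assumes "fin_supp p"
  shows "pairing (push \<phi> p) F = pairing p (\<lambda>w. F (map \<phi> w))"
proof -
  have "pairing (push \<phi> p) F = (\<Sum>w\<in>map \<phi> ` {w. p w \<noteq> 0}. push \<phi> p w * F w)"
    using assms push_nonzero[of \<phi> p] by (intro pairing_superset) auto
  also have "\<dots> = (\<Sum>w\<in>map \<phi> ` {w. p w \<noteq> 0}. \<Sum>v | v \<in> {v. p v \<noteq> 0} \<and> map \<phi> v = w. p v * F (map \<phi> v))"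
    unfolding push_def sum_distrib_right by (intro sum.cong) auto
  also have "\<dots> = pairing p (\<lambda>w. F (map \<phi> w))"
    unfolding pairing_def using assms by (intro sum.group) auto
  finally show ?thesis .
qed

lemma push_in_carrier:
  assumes "p \<in> carrier (free_algebra V)" "\<And>X. X \<in> V \<Longrightarrow> \<phi> X \<in> W"
  shows "push \<phi> p \<in> carrier (free_algebra W)"
  using assms push_nonzero[of \<phi> p] fin_supp_push[of p \<phi>]
  by (fastforce simp: free_algebra_carrier_iff)

text \<open>A basis of the subspace \<open>S\<close> together with \<open>p\<close> is independent,
  so some linear map on the space of all functions is 0 on the basis and 1 at \<open>p\<close>. Its
  values on single words give \<open>F\<close>.\<close>

lemma separating_functional:
  fixes S :: "('v list \<Rightarrow> complex) set"
  assumes zero: "(\<lambda>w. 0) \<in> S"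
    and add: "\<And>p q. p \<in> S \<Longrightarrow> q \<in> S \<Longrightarrow> (\<lambda>w. p w + q w) \<in> S"
    and scale: "\<And>c p. p \<in> S \<Longrightarrow> (\<lambda>w. c * p w) \<in> S"
    and fin: "\<And>p. p \<in> S \<Longrightarrow> fin_supp p"
    and p: "p \<notin> S" "fin_supp p"
  obtains F where "\<And>q. q \<in> S \<Longrightarrow> pairing q F = 0" "pairing p F = 1"
proof -
  let ?s = "\<lambda>(c::complex) (q::'v list \<Rightarrow> complex) w. c * q w"
  interpret vs: vector_space ?s
    by standard (auto simp: fun_eq_iff algebra_simps)
  have "vector_space ((*) :: complex \<Rightarrow> complex \<Rightarrow> complex)"
    by (rule vector_space.intro) (simp_all add: distrib_left distrib_right)
  then interpret vp: vector_space_pair ?s "(*)"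
    by (intro vector_space_pair.intro vs.vector_space_axioms)
  have sub: "vs.subspace S"
    unfolding vs.subspace_def using zero add scale
    by (auto simp: zero_fun_def plus_fun_def)
  obtain B where B: "B \<subseteq> S" "vs.independent B" "vs.span B = S"
    using vs.maximal_independent_subset[of S] sub by (metis vs.span_minimal subset_antisym)
  have "vs.independent (insert p B)"
    using B p by (simp add: vs.independent_insertI)
  then obtain L where L: "Vector_Spaces.linear ?s (*) L" "\<forall>x\<in>insert p B. L x = (if x = p then 1 else 0)"
    using vp.linear_independent_extend[of "insert p B" "\<lambda>x. if x = p then 1 else 0"] by blast
  interpret L: Vector_Spaces.linear ?s "(*)" L by (rule L)
  have LS: "L q = 0" if "q \<in> S" for q
  proof -
    have "q \<in> vs.span B" using that B by simp
    then show ?thesis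
    proof (induction rule: vs.span_induct_alt)
      case base show ?case using L.zero by (simp add: zero_fun_def)
    next
      case (step c x y)
      have "x \<noteq> p" using step B p by auto
      then show ?case using step L(2) L.add[of "?s c x" y] L.scale[of c x] by (auto simp: plus_fun_def)
    qed
  qed
  \<comment> \<open>Finite support matters here: only then is \<open>q\<close> a finite combination
    of words, so that \<open>L q\<close> is determined by the values of \<open>L\<close> on
    words.\<close>
  have pair: "pairing q (\<lambda>w. L (word w)) = L q" if "fin_supp q" for q
  proof -
    have "q = (\<Sum>v | q v \<noteq> 0. ?s (q v) (word v))"
    proof
      fix w
      have "(\<Sum>v\<in>A. ?s (q v) (word v)) w = (\<Sum>v\<in>A. q v * word v w)" if "finite A" for A
        using that by induction auto
      from this[OF that] have "(\<Sum>v | q v \<noteq> 0. ?s (q v) (word v)) w = (\<Sum>v | q v \<noteq> 0. q v * word v w)" .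
      also have "\<dots> = q w"
        using that by (auto simp: word_def of_bool_def if_distrib cong: if_cong)
      finally show "q w = (\<Sum>v | q v \<noteq> 0. ?s (q v) (word v)) w" ..
    qed
    then have "L q = L (\<Sum>v | q v \<noteq> 0. ?s (q v) (word v))" by simp
    also have "\<dots> = (\<Sum>v | q v \<noteq> 0. q v * L (word v))"
      unfolding L.sum L.scale ..
    finally show ?thesis by (simp add: pairing_def)
  qed
  show ?thesis
    by (rule that[of "\<lambda>w. L (word w)"]) (use pair LS L(2) p fin in auto)
qed


section \<open>The dual of the enveloping algebra\<close>

text \<open>The relations are imposed between arbitrary words \<open>x\<close> and \<open>y\<close>,
  because the ideal they generate is two-sided. Only letters from \<open>LieCx G\<close> are
  constrained; values on other words are irrelevant for elements of the free algebra over
  \<open>LieCx G\<close>.\<close>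

definition dual_U :: "('a::euclidean_space) monoid \<Rightarrow> (('a \<times> 'a) list \<Rightarrow> complex) set"
  where "dual_U G = {F. \<forall>x y X Y. set x \<subseteq> LieCx G \<longrightarrow> set y \<subseteq> LieCx G \<longrightarrow> X \<in> LieCx G \<longrightarrow> Y \<in> LieCx G \<longrightarrow>
    F (x @ [X + Y] @ y) = F (x @ [X] @ y) + F (x @ [Y] @ y) \<and>
    (\<forall>c. F (x @ [scaleCx c X] @ y) = c * F (x @ [X] @ y)) \<and>
    F (x @ [X, Y] @ y) - F (x @ [Y, X] @ y) = F (x @ [bracketCx G X Y] @ y)}"

lemma dual_UI:
  assumes "\<And>x y X Y. set x \<subseteq> LieCx G \<Longrightarrow> set y \<subseteq> LieCx G \<Longrightarrow> X \<in> LieCx G \<Longrightarrow> Y \<in> LieCx G \<Longrightarrow>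
      F (x @ [X + Y] @ y) = F (x @ [X] @ y) + F (x @ [Y] @ y)"
    and "\<And>x y c X. set x \<subseteq> LieCx G \<Longrightarrow> set y \<subseteq> LieCx G \<Longrightarrow> X \<in> LieCx G \<Longrightarrow>
      F (x @ [scaleCx c X] @ y) = c * F (x @ [X] @ y)"
    and "\<And>x y X Y. set x \<subseteq> LieCx G \<Longrightarrow> set y \<subseteq> LieCx G \<Longrightarrow> X \<in> LieCx G \<Longrightarrow> Y \<in> LieCx G \<Longrightarrow>
      F (x @ [X, Y] @ y) - F (x @ [Y, X] @ y) = F (x @ [bracketCx G X Y] @ y)"
  shows "F \<in> dual_U G"
  unfolding dual_U_def mem_Collect_eq using assms by blast

lemma
  assumes "F \<in> dual_U G" "set x \<subseteq> LieCx G" "set y \<subseteq> LieCx G" "X \<in> LieCx G"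
  shows dual_U_add: "Y \<in> LieCx G \<Longrightarrow> F (x @ (X + Y) # y) = F (x @ X # y) + F (x @ Y # y)"
    and dual_U_scale: "F (x @ scaleCx c X # y) = c * F (x @ X # y)"
    and dual_U_bracket: "Y \<in> LieCx G \<Longrightarrow>
      F (x @ X # Y # y) = F (x @ Y # X # y) + F (x @ bracketCx G X Y # y)"
proof -
  have *: "F (x @ [X + Y] @ y) = F (x @ [X] @ y) + F (x @ [Y] @ y)"
    "F (x @ [scaleCx c X] @ y) = c * F (x @ [X] @ y)"
    "F (x @ [X, Y] @ y) - F (x @ [Y, X] @ y) = F (x @ [bracketCx G X Y] @ y)"
    if "Y \<in> LieCx G" for Y
    using assms that unfolding dual_U_def mem_Collect_eq by blast+
  show "Y \<in> LieCx G \<Longrightarrow> F (x @ (X + Y) # y) = F (x @ X # y) + F (x @ Y # y)"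
    using *(1)[of Y] by simp
  show "F (x @ scaleCx c X # y) = c * F (x @ X # y)"
    using *(2)[of X] assms by simp
  show "Y \<in> LieCx G \<Longrightarrow> F (x @ X # Y # y) = F (x @ Y # X # y) + F (x @ bracketCx G X Y # y)"
    using *(3)[of Y] by (simp add: diff_eq_eq)
qed

lemma U_relations_cases:
  assumes "p \<in> U_relations G"
  obtains (add) X Y where "X \<in> LieCx G" "Y \<in> LieCx G"
      "p = (\<lambda>w. word [X + Y] w - word [X] w - word [Y] w)"
    | (scale) c X where "X \<in> LieCx G" "p = (\<lambda>w. word [scaleCx c X] w - c * word [X] w)"
    | (bracket) X Y where "X \<in> LieCx G" "Y \<in> LieCx G"
      "p = (\<lambda>w. word [X, Y] w - word [Y, X] w - word [bracketCx G X Y] w)"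
  using assms unfolding U_relations_def by blast

lemma pairing_words_diff:
  "pairing (\<lambda>w. word a w - word b w - word c w) F = F a - F b - F c"
  "pairing (\<lambda>w. word a w - z * word b w) F = F a - z * F b"
  by (simp_all add: pairing_diff[OF fin_supp_diff] pairing_diff fin_supp_scale pairing_scale)

text \<open>These two closure properties are what makes every relation an element of the free
  algebra over \<open>LieCx G\<close>. Isolating them keeps the algebra free of analysis; closed
  linear groups satisfy them by the product formula below.\<close>

locale lie_closed =
  fixes G :: "'a::euclidean_space monoid"
  assumes Lie_subspace: "subspace (Lie G)"
    and Lie_bracket: "X \<in> Lie G \<Longrightarrow> Y \<in> Lie G \<Longrightarrow> bracket G X Y \<in> Lie G"
begin

lemma LieCx_add: "X \<in> LieCx G \<Longrightarrow> Y \<in> LieCx G \<Longrightarrow> X + Y \<in> LieCx G"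
  using Lie_subspace by (cases X; cases Y) (simp add: complexify_def subspace_add)

lemma LieCx_scale: "X \<in> LieCx G \<Longrightarrow> scaleCx c X \<in> LieCx G"
  using Lie_subspace by (auto simp: complexify_def scaleCx_def subspace_add subspace_diff subspace_scale)

lemma LieCx_bracket: "X \<in> LieCx G \<Longrightarrow> Y \<in> LieCx G \<Longrightarrow> bracketCx G X Y \<in> LieCx G"
  using Lie_subspace Lie_bracket
  by (auto simp: complexify_def bracketCx_def subspace_add subspace_diff)

lemma LieCx_zero: "0 \<in> LieCx G"
  using subspace_0[OF Lie_subspace] by (simp add: complexify_def zero_prod_def)

lemma dual_U_zero:
  "F \<in> dual_U G \<Longrightarrow> set x \<subseteq> LieCx G \<Longrightarrow> set y \<subseteq> LieCx G \<Longrightarrow> F (x @ 0 # y) = 0"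
  using dual_U_add[of F G x y 0 0] LieCx_zero by simp

abbreviation FA :: "(('a \<times> 'a) list \<Rightarrow> complex) ring"
  where "FA \<equiv> free_algebra (LieCx G)"

sublocale FA: ring FA
  by (rule ring_free_algebra)

lemma U_relations_carrier: "U_relations G \<subseteq> carrier FA"
proof
  fix p assume "p \<in> U_relations G"
  then show "p \<in> carrier FA"
    by (cases rule: U_relations_cases)
      (simp_all add: carrier_diff carrier_scale LieCx_add LieCx_scale LieCx_bracket)
qed

lemma ideal_U_ideal: "ideal (U_ideal G) FA"
  unfolding U_ideal_def by (rule FA.genideal_ideal[OF U_relations_carrier])

sublocale UI: ideal "U_ideal G" FA
  by (rule ideal_U_ideal)

lemma U_relations_U_ideal: "U_relations G \<subseteq> U_ideal G"
  unfolding U_ideal_def by (rule FA.genideal_self[OF U_relations_carrier])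

lemma U_ideal_carrier: "p \<in> U_ideal G \<Longrightarrow> p \<in> carrier FA"
  by (rule UI.a_Hcarr)

lemma pairing_translate:
  assumes "p \<in> U_ideal G" "set x \<subseteq> LieCx G" "set y \<subseteq> LieCx G"
  shows "\<exists>q\<in>U_ideal G. \<forall>F. pairing q F = pairing p (\<lambda>w. F (x @ w @ y))"
proof
  show "free_mult (word x) (free_mult p (word y)) \<in> U_ideal G"
    using assms UI.I_l_closed UI.I_r_closed by (simp add: free_mult_eq[of "LieCx G"])
  show "\<forall>F. pairing (free_mult (word x) (free_mult p (word y))) F = pairing p (\<lambda>w. F (x @ w @ y))"
    using fin_supp_carrier[OF U_ideal_carrier[OF assms(1)]]
    by (simp add: pairing_mult fin_supp_mult)
qed

lemma dual_UI_annihilator: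
  assumes "\<And>p. p \<in> U_ideal G \<Longrightarrow> pairing p F = 0"
  shows "F \<in> dual_U G"
proof (rule dual_UI)
  fix x y X Y assume xy: "set x \<subseteq> LieCx G" "set y \<subseteq> LieCx G" and X: "X \<in> LieCx G"
  have *: "pairing p (\<lambda>w. F (x @ w @ y)) = 0" if "p \<in> U_relations G" for p
  proof -
    have "p \<in> U_ideal G" using that U_relations_U_ideal by blast
    then obtain q where "q \<in> U_ideal G" "\<forall>F. pairing q F = pairing p (\<lambda>w. F (x @ w @ y))"
      using pairing_translate[OF _ xy] by blast
    then show ?thesis using assms[of q] by simp
  qed
  have "(\<lambda>w. word [scaleCx c X] w - c * word [X] w) \<in> U_relations G" for c
    unfolding U_relations_def using X by blast
  from *[OF this] show "F (x @ [scaleCx c X] @ y) = c * F (x @ [X] @ y)" for c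
    by (simp add: pairing_words_diff)
  assume Y: "Y \<in> LieCx G"
  have "(\<lambda>w. word [X + Y] w - word [X] w - word [Y] w) \<in> U_relations G"
    unfolding U_relations_def using X Y by blast
  from *[OF this] show "F (x @ [X + Y] @ y) = F (x @ [X] @ y) + F (x @ [Y] @ y)"
    by (simp add: pairing_words_diff diff_eq_eq add.commute)
  have "(\<lambda>w. word [X, Y] w - word [Y, X] w - word [bracketCx G X Y] w) \<in> U_relations G"
    unfolding U_relations_def using X Y by blast
  from *[OF this] show "F (x @ [X, Y] @ y) - F (x @ [Y, X] @ y) = F (x @ [bracketCx G X Y] @ y)"
    by (simp add: pairing_words_diff)
qed

text \<open>The ideal is defined as the smallest one containing the relations, so it suffices to
  enclose it in a suitable ideal. Elements killed by \<open>F\<close> alone need not form one; those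
  killed between any two words do, since multiplication only lengthens these words.\<close>

lemma dual_U_annihilates:
  assumes F: "F \<in> dual_U G" and p: "p \<in> U_ideal G"
  shows "pairing p F = 0"
proof -
  let ?V = "LieCx G"
  let ?J = "{p \<in> carrier FA. \<forall>x y. set x \<subseteq> ?V \<longrightarrow> set y \<subseteq> ?V \<longrightarrow> pairing p (\<lambda>w. F (x @ w @ y)) = 0}"
  have "ideal ?J FA"
  proof (rule idealI)
    show "ring FA" ..
    show "subgroup ?J (add_monoid FA)"
    proof (rule FA.add.subgroupI)
      fix p assume p: "p \<in> ?J"
      have "\<ominus>\<^bsub>FA\<^esub> p = (\<lambda>w. - 1 * p w)"
        using p carrier_scale[of p ?V "-1"]
        by (intro FA.minus_equality) (auto simp: free_algebra_simps)
      then show "\<ominus>\<^bsub>FA\<^esub> p \<in> ?J"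
        using p carrier_scale[of p ?V "-1"] pairing_scale[of "-1" p] by auto
    next
      show "p \<oplus>\<^bsub>FA\<^esub> q \<in> ?J" if "p \<in> ?J" "q \<in> ?J" for p q
        using that by (auto simp: free_algebra_simps carrier_add pairing_add fin_supp_carrier)
      have "(\<lambda>w. 0) \<in> ?J" by (auto simp: carrier_zero pairing_def)
      then show "?J \<noteq> {}" by blast
    qed auto
  next
    fix p q assume p: "p \<in> ?J" and q: "q \<in> carrier FA"
    have fin: "fin_supp p" "fin_supp q" using p q by (auto simp: fin_supp_carrier)
    have qV: "set w \<subseteq> ?V" if "q w \<noteq> 0" for w
      using q that by (auto simp: free_algebra_carrier_iff)
    have pV: "set w \<subseteq> ?V" if "p w \<noteq> 0" for w
      using p that by (auto simp: free_algebra_carrier_iff)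
    have "pairing (free_mult q p) (\<lambda>w. F (x @ w @ y)) = 0" if "set x \<subseteq> ?V" "set y \<subseteq> ?V" for x y
    proof -
      have "pairing (free_mult q p) (\<lambda>w. F (x @ w @ y)) =
          pairing q (\<lambda>u. pairing p (\<lambda>v. F ((x @ u) @ v @ y)))"
        by (simp add: pairing_mult fin)
      also have "\<dots> = pairing q (\<lambda>u. 0)"
        using p qV that by (intro pairing_cong) (auto simp del: append_assoc)
      finally show ?thesis by simp
    qed
    then show "q \<otimes>\<^bsub>FA\<^esub> p \<in> ?J"
      using p q by (auto simp: free_mult_eq[of ?V] carrier_mult)
    have "pairing (free_mult p q) (\<lambda>w. F (x @ w @ y)) = 0" if "set x \<subseteq> ?V" "set y \<subseteq> ?V" for x y
    proof -
      have "pairing (free_mult p q) (\<lambda>w. F (x @ w @ y)) =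
          pairing p (\<lambda>u. pairing q (\<lambda>v. F (x @ u @ v @ y)))"
        by (simp add: pairing_mult fin)
      also have "\<dots> = pairing q (\<lambda>v. pairing p (\<lambda>u. F (x @ u @ v @ y)))"
        unfolding pairing_def sum_distrib_left by (subst sum.swap) (simp add: mult.left_commute)
      also have "\<dots> = pairing q (\<lambda>v. 0)"
        using p qV that by (intro pairing_cong) auto
      finally show ?thesis by simp
    qed
    then show "p \<otimes>\<^bsub>FA\<^esub> q \<in> ?J"
      using p q by (auto simp: free_mult_eq[of ?V] carrier_mult)
  qed
  moreover have "U_relations G \<subseteq> ?J"
  proof
    fix p assume p: "p \<in> U_relations G"
    have "pairing p (\<lambda>w. F (x @ w @ y)) = 0" if "set x \<subseteq> ?V" "set y \<subseteq> ?V" for x y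
    proof -
      from p show ?thesis
      proof (cases rule: U_relations_cases)
        case (add X Y)
        then show ?thesis using dual_U_add[OF F that add(1,2)] by (simp add: pairing_words_diff)
      next
        case (scale c X)
        then show ?thesis using dual_U_scale[OF F that scale(1)] by (simp add: pairing_words_diff)
      next
        case (bracket X Y)
        then show ?thesis using dual_U_bracket[OF F that bracket(1,2)] by (simp add: pairing_words_diff)
      qed
    qed
    then show "p \<in> ?J" using p U_relations_carrier by blast
  qed
  ultimately have "U_ideal G \<subseteq> ?J"
    unfolding U_ideal_def by (rule FA.genideal_minimal)
  then have "pairing p (\<lambda>w. F ([] @ w @ [])) = 0" using p by (auto simp del: append.simps append_Nil2)
  then show ?thesis by simp
qed

lemma scale_U_ideal: "p \<in> U_ideal G \<Longrightarrow> (\<lambda>w. c * p w) \<in> U_ideal G"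
proof -
  assume p: "p \<in> U_ideal G"
  have "free_mult (\<lambda>w. c * word [] w) p \<in> U_ideal G"
    using UI.I_l_closed[OF p, of "\<lambda>w. c * word [] w"]
    by (simp add: free_mult_eq[of "LieCx G"] carrier_scale)
  also have "free_mult (\<lambda>w. c * word [] w) p = (\<lambda>w. c * p w)"
    using U_ideal_carrier[OF p]
    by (intro pairing_eqI) (auto simp: fin_supp_carrier fin_supp_mult fin_supp_scale pairing_mult pairing_scale)
  finally show ?thesis .
qed

lemma add_U_ideal: "p \<in> U_ideal G \<Longrightarrow> q \<in> U_ideal G \<Longrightarrow> (\<lambda>w. p w + q w) \<in> U_ideal G"
  using UI.a_closed[of p q] by (simp add: free_algebra_simps)

lemma zero_U_ideal: "(\<lambda>w. 0) \<in> U_ideal G"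
  using UI.zero_closed by (simp add: free_algebra_simps)

text \<open>The double annihilator: an element outside the ideal is separated from it by a form
  vanishing on the ideal, and such a form respects all relations.\<close>

lemma U_ideal_iff:
  assumes "p \<in> carrier FA"
  shows "p \<in> U_ideal G \<longleftrightarrow> (\<forall>F\<in>dual_U G. pairing p F = 0)"
proof (intro iffI ballI)
  assume *: "\<forall>F\<in>dual_U G. pairing p F = 0"
  show "p \<in> U_ideal G"
  proof (rule ccontr)
    assume "p \<notin> U_ideal G"
    show False
      by (rule separating_functional[OF zero_U_ideal add_U_ideal scale_U_ideal
            fin_supp_carrier[OF U_ideal_carrier] \<open>p \<notin> U_ideal G\<close> fin_supp_carrier[OF assms]])
        (use * dual_UI_annihilator in force)+
  qed
qed (auto simp: dual_U_annihilates)

lemma U_class_eq_iff: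
  assumes "p \<in> carrier FA" "q \<in> carrier FA"
  shows "U_class G p = U_class G q \<longleftrightarrow> (\<forall>F\<in>dual_U G. pairing p F = pairing q F)"
proof -
  have minus: "p \<ominus>\<^bsub>FA\<^esub> q = (\<lambda>w. p w - q w)"
  proof -
    have "\<ominus>\<^bsub>FA\<^esub> q = (\<lambda>w. - 1 * q w)"
      using assms carrier_scale[of q "LieCx G" "-1"]
      by (intro FA.minus_equality) (auto simp: free_algebra_simps)
    then show ?thesis by (simp add: a_minus_def free_algebra_simps)
  qed
  have "U_class G p = U_class G q \<longleftrightarrow> p \<in> U_ideal G +>\<^bsub>FA\<^esub> q"
    unfolding U_class_def using assms
    by (metis UI.a_rcos_self UI.a_repr_independence')
  also have "\<dots> \<longleftrightarrow> (\<lambda>w. p w - q w) \<in> U_ideal G"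
    using UI.a_rcos_module_minus[of q p] assms minus FA.ring_axioms by simp
  also have "\<dots> \<longleftrightarrow> (\<forall>F\<in>dual_U G. pairing p F = pairing q F)"
    using assms by (simp add: U_ideal_iff carrier_diff pairing_diff fin_supp_carrier)
  finally show ?thesis .
qed

lemma U_class_mem:
  assumes "p \<in> carrier FA" "q \<in> U_class G p"
  shows "q \<in> carrier FA" "U_class G q = U_class G p"
  using assms unfolding U_class_def
  by (auto dest: UI.a_elemrcos_carrier UI.a_repr_independence')

lemma U_class_self: "p \<in> carrier FA \<Longrightarrow> p \<in> U_class G p"
  unfolding U_class_def by (rule UI.a_rcos_self)

text \<open>Maps on classes such as \<open>U_map\<close> and \<open>act_U\<close> are defined as the
  unique element of an image. This evaluates them on a representative once independence of the
  representative is known.\<close>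

lemma the_elem_U_class:
  assumes "p \<in> carrier FA" "\<And>q. q \<in> carrier FA \<Longrightarrow> U_class G q = U_class G p \<Longrightarrow> h q = h p"
  shows "the_elem (h ` U_class G p) = h p"
proof -
  have "h ` U_class G p = {h p}"
  proof (intro equalityI subsetI)
    fix z assume "z \<in> h ` U_class G p"
    then obtain q where "q \<in> U_class G p" "z = h q" by blast
    then show "z \<in> {h p}" using U_class_mem[OF assms(1)] assms(2)[of q] by simp
  qed (use U_class_self[OF assms(1)] in simp)
  then show ?thesis by simp
qed

lemma U_alg_carrier: "u \<in> carrier (U_alg G) \<longleftrightarrow> (\<exists>p\<in>carrier FA. u = U_class G p)"
  by (auto simp: U_alg_def FactRing_def A_RCOSETS_def RCOSETS_def U_class_def a_r_coset_def)

lemma U_alg_mult: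
  "p \<in> carrier FA \<Longrightarrow> q \<in> carrier FA \<Longrightarrow>
    U_class G p \<otimes>\<^bsub>U_alg G\<^esub> U_class G q = U_class G (free_mult p q)"
  by (simp add: U_alg_def FactRing_def U_class_def UI.rcoset_mult_add free_mult_eq[of "LieCx G"])

lemma U_alg_add:
  "p \<in> carrier FA \<Longrightarrow> q \<in> carrier FA \<Longrightarrow>
    U_class G p \<oplus>\<^bsub>U_alg G\<^esub> U_class G q = U_class G (\<lambda>w. p w + q w)"
  using UI.a_rcos_sum[of p q]
  by (simp add: U_alg_def FactRing_def U_class_def free_algebra_simps)

end

definition lie_hom ::
  "('a::euclidean_space) monoid \<Rightarrow> ('b::euclidean_space) monoid \<Rightarrow> ('a \<times> 'a \<Rightarrow> 'b \<times> 'b) \<Rightarrow> bool"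
  where "lie_hom G H \<phi> \<longleftrightarrow> \<phi> ` LieCx G \<subseteq> LieCx H \<and>
    (\<forall>X\<in>LieCx G. \<forall>Y\<in>LieCx G. \<phi> (X + Y) = \<phi> X + \<phi> Y \<and>
       \<phi> (bracketCx G X Y) = bracketCx H (\<phi> X) (\<phi> Y)) \<and>
    (\<forall>X\<in>LieCx G. \<forall>c. \<phi> (scaleCx c X) = scaleCx c (\<phi> X))"

text \<open>The transpose of the algebra map induced by a Lie algebra homomorphism. That transposes
  preserve \<open>dual_U\<close> is the dual way to say that the map is well defined on
  classes.\<close>

lemma dual_U_comp_hom:
  assumes "lie_hom G H \<phi>" "F \<in> dual_U H"
  shows "(\<lambda>w. F (map \<phi> w)) \<in> dual_U G"
proof (rule dual_UI)
  fix x y X Y assume *: "set x \<subseteq> LieCx G" "set y \<subseteq> LieCx G" "X \<in> LieCx G"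
  then have map: "set (map \<phi> x) \<subseteq> LieCx H" "set (map \<phi> y) \<subseteq> LieCx H" "\<phi> X \<in> LieCx H"
    using assms unfolding lie_hom_def by auto
  then show "F (map \<phi> (x @ [scaleCx c X] @ y)) = c * F (map \<phi> (x @ [X] @ y))" for c
    using * assms dual_U_scale[OF assms(2) map] by (auto simp: lie_hom_def)
  assume Y: "Y \<in> LieCx G"
  then have "\<phi> Y \<in> LieCx H" using assms unfolding lie_hom_def by auto
  then show "F (map \<phi> (x @ [X + Y] @ y)) = F (map \<phi> (x @ [X] @ y)) + F (map \<phi> (x @ [Y] @ y))"
    "F (map \<phi> (x @ [X, Y] @ y)) - F (map \<phi> (x @ [Y, X] @ y)) = F (map \<phi> (x @ [bracketCx G X Y] @ y))"
    using * Y assms dual_U_add[OF assms(2) map] dual_U_bracket[OF assms(2) map]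
    by (auto simp: lie_hom_def)
qed

lemma U_map_class:
  assumes "lie_closed G" "lie_closed H" "lie_hom G H \<phi>" "p \<in> carrier (free_algebra (LieCx G))"
  shows "U_map H \<phi> (U_class G p) = U_class H (push \<phi> p)"
proof -
  interpret G: lie_closed G by fact
  interpret H: lie_closed H by fact
  show ?thesis unfolding U_map_def
  proof (rule G.the_elem_U_class[OF assms(4)])
    fix q assume q: "q \<in> carrier G.FA" "U_class G q = U_class G p"
    have c: "push \<phi> r \<in> carrier H.FA" if "r \<in> carrier G.FA" for r
      using assms(3) that by (intro push_in_carrier[OF that]) (auto simp: lie_hom_def)
    show "U_class H (push \<phi> q) = U_class H (push \<phi> p)"
      using q assms c by (simp add: H.U_class_eq_iff G.U_class_eq_iff pairing_push fin_supp_carrier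
          dual_U_comp_hom)
  qed
qed


section \<open>Characters of the invariants\<close>

text \<open>Transposes of one-sided multiplications, here by a letter and below by words, keep a
  form in \<open>dual_U\<close>. In a product one factor can thus be frozen while a property of the
  other is applied.\<close>

lemma dual_U_Cons: "F \<in> dual_U G \<Longrightarrow> X \<in> LieCx G \<Longrightarrow> (\<lambda>w. F (X # w)) \<in> dual_U G"
proof (rule dual_UI)
  fix x y U V c
  assume *: "F \<in> dual_U G" "X \<in> LieCx G" "set x \<subseteq> LieCx G" "set y \<subseteq> LieCx G" "U \<in> LieCx G"
  then have x: "set (X # x) \<subseteq> LieCx G" by simp
  show "F (X # x @ [scaleCx c U] @ y) = c * F (X # x @ [U] @ y)"
    using dual_U_scale[OF *(1) x *(4,5)] by simp
  assume V: "V \<in> LieCx G"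
  show "F (X # x @ [U + V] @ y) = F (X # x @ [U] @ y) + F (X # x @ [V] @ y)"
    using dual_U_add[OF *(1) x *(4,5) V] by simp
  show "F (X # x @ [U, V] @ y) - F (X # x @ [V, U] @ y) = F (X # x @ [bracketCx G U V] @ y)"
    using dual_U_bracket[OF *(1) x *(4,5) V] by simp
qed

lemma dual_U_prefix: "F \<in> dual_U G \<Longrightarrow> set x \<subseteq> LieCx G \<Longrightarrow> (\<lambda>w. F (x @ w)) \<in> dual_U G"
proof (induction x arbitrary: F)
  case (Cons X x)
  have "(\<lambda>w. F (X # w)) \<in> dual_U G" using Cons.prems by (intro dual_U_Cons) auto
  from Cons.IH[OF this] show ?case using Cons.prems by simp
qed simp

lemma dual_U_suffix: "F \<in> dual_U G \<Longrightarrow> set z \<subseteq> LieCx G \<Longrightarrow> (\<lambda>w. F (w @ z)) \<in> dual_U G"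
proof (rule dual_UI)
  fix x y U V c
  assume *: "F \<in> dual_U G" "set z \<subseteq> LieCx G" "set x \<subseteq> LieCx G" "set y \<subseteq> LieCx G" "U \<in> LieCx G"
  then have y: "set (y @ z) \<subseteq> LieCx G" by simp
  show "F ((x @ [scaleCx c U] @ y) @ z) = c * F ((x @ [U] @ y) @ z)"
    using dual_U_scale[OF *(1,3) y *(5)] by simp
  assume V: "V \<in> LieCx G"
  show "F ((x @ [U + V] @ y) @ z) = F ((x @ [U] @ y) @ z) + F ((x @ [V] @ y) @ z)"
    using dual_U_add[OF *(1,3) y *(5) V] by simp
  show "F ((x @ [U, V] @ y) @ z) - F ((x @ [V, U] @ y) @ z) = F ((x @ [bracketCx G U V] @ y) @ z)"
    using dual_U_bracket[OF *(1,3) y *(5) V] by simp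
qed

lemma dual_U_scaled: "F \<in> dual_U G \<Longrightarrow> (\<lambda>w. c * F w) \<in> dual_U G"
proof (rule dual_UI)
  fix x y U V d
  assume *: "F \<in> dual_U G" "set x \<subseteq> LieCx G" "set y \<subseteq> LieCx G" "U \<in> LieCx G"
  show "c * F (x @ [scaleCx d U] @ y) = d * (c * F (x @ [U] @ y))"
    using dual_U_scale[OF *] by simp
  assume V: "V \<in> LieCx G"
  show "c * F (x @ [U + V] @ y) = c * F (x @ [U] @ y) + c * F (x @ [V] @ y)"
    using dual_U_add[OF * V] by (simp add: distrib_left)
  show "c * F (x @ [U, V] @ y) - c * F (x @ [V, U] @ y) = c * F (x @ [bracketCx G U V] @ y)"
    using dual_U_bracket[OF * V] by (simp add: distrib_left)
qed

locale lie_group_data = lie_closed +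
  assumes Ad_hom: "g \<in> carrier G \<Longrightarrow> lie_hom G G (AdCx G g)"
begin

lemma ZG_class_iff:
  assumes p: "p \<in> carrier FA"
  shows "U_class G p \<in> ZG G \<longleftrightarrow>
    (\<forall>g\<in>carrier G. \<forall>F\<in>dual_U G. pairing p (\<lambda>w. F (map (AdCx G g) w)) = pairing p F)"
proof -
  have *: "U_map G (AdCx G g) (U_class G p) = U_class G p \<longleftrightarrow>
      (\<forall>F\<in>dual_U G. pairing p (\<lambda>w. F (map (AdCx G g) w)) = pairing p F)"
    if g: "g \<in> carrier G" for g
  proof -
    have c: "push (AdCx G g) p \<in> carrier FA"
      using Ad_hom[OF g] by (intro push_in_carrier[OF p]) (auto simp: lie_hom_def)
    show ?thesis
      unfolding U_map_class[OF lie_closed_axioms lie_closed_axioms Ad_hom[OF g] p]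
        U_class_eq_iff[OF c p] pairing_push[OF fin_supp_carrier[OF p]] ..
  qed
  have "U_class G p \<in> carrier (U_alg G)" using p U_alg_carrier by blast
  then have "U_class G p \<in> ZG G \<longleftrightarrow> (\<forall>g\<in>carrier G. U_map G (AdCx G g) (U_class G p) = U_class G p)"
    unfolding ZG_def by blast
  also have "\<dots> \<longleftrightarrow> (\<forall>g\<in>carrier G. \<forall>F\<in>dual_U G. pairing p (\<lambda>w. F (map (AdCx G g) w)) = pairing p F)"
    by (rule ball_cong[OF refl *])
  finally show ?thesis .
qed

lemma ZG_cases:
  assumes "u \<in> ZG G"
  obtains p where "p \<in> carrier FA" "u = U_class G p"
proof -
  have "u \<in> carrier (U_alg G)" using assms by (simp add: ZG_def)
  then show thesis unfolding U_alg_carrier by (elim bexE) (rule that)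
qed

lemma ZG_add:
  assumes "p \<in> carrier FA" "q \<in> carrier FA" "U_class G p \<in> ZG G" "U_class G q \<in> ZG G"
  shows "U_class G (\<lambda>w. p w + q w) \<in> ZG G"
  using assms by (simp add: ZG_class_iff carrier_add pairing_add fin_supp_carrier)

lemma ZG_scale:
  assumes "p \<in> carrier FA" "U_class G p \<in> ZG G"
  shows "U_class G (\<lambda>w. c * p w) \<in> ZG G"
  using assms by (simp add: ZG_class_iff carrier_scale pairing_scale)

text \<open>Ad acts on a concatenation factor by factor. It is first removed from \<open>q\<close>,
  with the transformed prefix frozen, and then from \<open>p\<close>, with the suffix
  frozen.\<close>

lemma ZG_mult:
  assumes "p \<in> carrier FA" "q \<in> carrier FA" "U_class G p \<in> ZG G" "U_class G q \<in> ZG G"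
  shows "U_class G (free_mult p q) \<in> ZG G"
  unfolding ZG_class_iff[OF carrier_mult[OF assms(1,2)]]
proof (intro ballI)
  fix g F assume g: "g \<in> carrier G" and F: "F \<in> dual_U G"
  let ?m = "map (AdCx G g)"
  have V: "set (?m u) \<subseteq> LieCx G" if "set u \<subseteq> LieCx G" for u
    using Ad_hom[OF g] that unfolding lie_hom_def by auto
  have pV: "set u \<subseteq> LieCx G" if "p u \<noteq> 0" for u
    using that assms(1) by (simp add: free_algebra_carrier_iff)
  have qV: "set u \<subseteq> LieCx G" if "q u \<noteq> 0" for u
    using that assms(2) by (simp add: free_algebra_carrier_iff)
  have fin: "fin_supp p" "fin_supp q" using assms by (simp_all add: fin_supp_carrier)
  have "pairing (free_mult p q) (\<lambda>w. F (?m w)) = pairing p (\<lambda>u. pairing q (\<lambda>v. F (?m u @ ?m v)))"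
    by (simp add: pairing_mult fin)
  also have "\<dots> = pairing p (\<lambda>u. pairing q (\<lambda>v. F (?m u @ v)))"
  proof (rule pairing_cong)
    fix u assume "p u \<noteq> 0"
    then have "(\<lambda>v. F (?m u @ v)) \<in> dual_U G" using pV V by (intro dual_U_prefix[OF F]) auto
    from bspec[OF bspec[OF assms(4)[unfolded ZG_class_iff[OF assms(2)]] g] this]
    show "pairing q (\<lambda>v. F (?m u @ ?m v)) = pairing q (\<lambda>v. F (?m u @ v))" .
  qed
  also have "\<dots> = pairing q (\<lambda>v. pairing p (\<lambda>u. F (?m u @ v)))"
    unfolding pairing_def sum_distrib_left by (subst sum.swap) (simp add: mult.left_commute)
  also have "\<dots> = pairing q (\<lambda>v. pairing p (\<lambda>u. F (u @ v)))"
  proof (rule pairing_cong)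
    fix v assume "q v \<noteq> 0"
    then have "(\<lambda>u. F (u @ v)) \<in> dual_U G" using qV by (intro dual_U_suffix[OF F]) auto
    from bspec[OF bspec[OF assms(3)[unfolded ZG_class_iff[OF assms(1)]] g] this]
    show "pairing p (\<lambda>u. F (?m u @ v)) = pairing p (\<lambda>u. F (u @ v))" .
  qed
  also have "\<dots> = pairing p (\<lambda>u. pairing q (\<lambda>v. F (u @ v)))"
    unfolding pairing_def sum_distrib_left by (subst sum.swap) (simp add: mult.left_commute)
  also have "\<dots> = pairing (free_mult p q) F" by (simp add: pairing_mult fin)
  finally show "pairing (free_mult p q) (\<lambda>w. F (?m w)) = pairing (free_mult p q) F" .
qed

lemma ZG_scalar: "U_class G (\<lambda>w. c * word [] w) \<in> ZG G"
  by (simp add: ZG_class_iff carrier_scale pairing_scale)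

lemma ZG_zero: "U_class G (\<lambda>w. 0) \<in> ZG G"
  using ZG_scalar[of 0] by simp

lemma ZG_one: "U_class G (word []) \<in> ZG G"
  using ZG_scalar[of 1] by simp

context
  fixes chi assumes chi: "chi \<in> ZG_characters G"
begin

lemma character_add:
  assumes "p \<in> carrier FA" "q \<in> carrier FA" "U_class G p \<in> ZG G" "U_class G q \<in> ZG G"
  shows "chi (U_class G (\<lambda>w. p w + q w)) = chi (U_class G p) + chi (U_class G q)"
  using chi assms U_alg_add[of p q] unfolding ZG_characters_def by fastforce

lemma character_mult:
  assumes "p \<in> carrier FA" "q \<in> carrier FA" "U_class G p \<in> ZG G" "U_class G q \<in> ZG G"
  shows "chi (U_class G (free_mult p q)) = chi (U_class G p) * chi (U_class G q)"
  using chi assms U_alg_mult[of p q] unfolding ZG_characters_def by fastforce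

lemma character_scalar: "chi (U_class G (\<lambda>w. c * word [] w)) = c"
  using chi unfolding ZG_characters_def U_scalar_def by blast

lemma character_zero: "chi (U_class G (\<lambda>w. 0)) = 0"
  using character_scalar[of 0] by simp

lemma character_one: "chi (U_class G (word [])) = 1"
  using character_scalar[of 1] by simp

lemma character_scale:
  assumes p: "p \<in> carrier FA" "U_class G p \<in> ZG G"
  shows "chi (U_class G (\<lambda>w. c * p w)) = c * chi (U_class G p)"
proof -
  have "free_mult (\<lambda>w. c * word [] w) p = (\<lambda>w. c * p w)"
    using fin_supp_carrier[OF p(1)]
    by (intro pairing_eqI) (auto simp: fin_supp_mult fin_supp_scale pairing_mult pairing_scale)
  then show ?thesis
    using character_mult[OF _ p(1) ZG_scalar p(2), of c] character_scalar[of c]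
    by (simp add: carrier_scale)
qed

text \<open>A character is in particular a linear form on a subspace of the enveloping algebra and
  so extends to all of it. The extension is found as a form that kills the kernel of
  \<open>chi\<close>, lifted to the free algebra, and is 1 at the unit. It is in general not
  multiplicative.\<close>

lemma character_functional:
  obtains F where "F \<in> dual_U G"
    "\<And>p. p \<in> carrier FA \<Longrightarrow> U_class G p \<in> ZG G \<Longrightarrow> pairing p F = chi (U_class G p)"
proof -
  let ?S = "{p \<in> carrier FA. U_class G p \<in> ZG G \<and> chi (U_class G p) = 0}"
  have 1: "(\<lambda>w. 0) \<in> ?S" using ZG_zero character_zero carrier_zero by blast
  have 2: "(\<lambda>w. p w + q w) \<in> ?S" if "p \<in> ?S" "q \<in> ?S" for p q
    using that ZG_add character_add by (simp add: carrier_add)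
  have 3: "(\<lambda>w. c * p w) \<in> ?S" if "p \<in> ?S" for c p
    using that ZG_scale character_scale by (simp add: carrier_scale)
  have 4: "fin_supp p" if "p \<in> ?S" for p using that fin_supp_carrier by blast
  have 5: "word [] \<notin> ?S" using character_one by simp
  obtain F where F: "\<And>q. q \<in> ?S \<Longrightarrow> pairing q F = 0" "pairing (word []) F = 1"
    by (rule separating_functional[OF 1 2 3 4 5 fin_supp_word]) blast+
  show ?thesis
  proof (rule that)
    show "F \<in> dual_U G"
    proof (rule dual_UI_annihilator)
      fix p assume p: "p \<in> U_ideal G"
      have "U_class G p = U_class G (\<lambda>w. 0)"
        using p U_ideal_carrier[OF p] dual_U_annihilates[OF _ p]
        by (simp add: U_class_eq_iff carrier_zero) (simp add: pairing_def)
      then have "p \<in> ?S" using U_ideal_carrier[OF p] ZG_zero character_zero by simp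
      then show "pairing p F = 0" by (rule F)
    qed
    fix p assume p: "p \<in> carrier FA" "U_class G p \<in> ZG G"
    \<comment> \<open>Subtracting from \<open>p\<close> its character value times the unit lands in
      the kernel, which \<open>F\<close> kills; since \<open>F\<close> is 1 at the unit, it takes
      the prescribed value at \<open>p\<close>.\<close>
    define c where "c = - chi (U_class G p)"
    have "(\<lambda>w. p w + c * word [] w) \<in> ?S"
      using p character_add[OF p(1) _ p(2) ZG_scalar[of c]] character_scalar[of c]
        ZG_add[OF p(1) _ p(2) ZG_scalar[of c]]
      by (simp add: carrier_add carrier_scale) (simp add: c_def)
    from F(1)[OF this] show "pairing p F = chi (U_class G p)"
      using F(2) fin_supp_carrier[OF p(1)]
      by (simp add: pairing_add fin_supp_scale pairing_scale) (simp add: c_def)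
  qed
qed

lemma character_sum:
  assumes "finite A" "\<And>i. i \<in> A \<Longrightarrow> p i \<in> carrier FA" "\<And>i. i \<in> A \<Longrightarrow> U_class G (p i) \<in> ZG G"
  shows "(\<lambda>w. \<Sum>i\<in>A. p i w) \<in> carrier FA \<and> U_class G (\<lambda>w. \<Sum>i\<in>A. p i w) \<in> ZG G \<and>
    chi (U_class G (\<lambda>w. \<Sum>i\<in>A. p i w)) = (\<Sum>i\<in>A. chi (U_class G (p i)))"
  using assms
proof (induction A)
  case (insert i A)
  then show ?case
    using carrier_add[of "p i" _ "\<lambda>w. \<Sum>i\<in>A. p i w"] ZG_add[of "p i" "\<lambda>w. \<Sum>i\<in>A. p i w"]
      character_add[of "p i" "\<lambda>w. \<Sum>i\<in>A. p i w"] by simp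
qed (simp add: carrier_zero ZG_zero character_zero)

end

end


section \<open>Products of groups\<close>

abbreviation emb1 :: "'a \<times> 'a \<Rightarrow> ('a::zero \<times> 'b::zero) \<times> ('a \<times> 'b)"
  where "emb1 \<equiv> map_prod (\<lambda>X. (X, 0)) (\<lambda>X. (X, 0))"

abbreviation emb2 :: "'b \<times> 'b \<Rightarrow> ('a::zero \<times> 'b::zero) \<times> ('a \<times> 'b)"
  where "emb2 \<equiv> map_prod (Pair 0) (Pair 0)"

text \<open>Expanding every letter \<open>(X, Y)\<close> of a word into \<open>X \<otimes> 1 + 1 \<otimes> Y\<close> turns the word into a
  sum of pairs of words, on which the form \<open>\<beta>\<close> is evaluated.\<close>

fun unshuffle ::
  "(('a \<times> 'a) list \<Rightarrow> ('b \<times> 'b) list \<Rightarrow> complex) \<Rightarrow> (('a \<times> 'b) \<times> ('a \<times> 'b)) list \<Rightarrow> complex" where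
  "unshuffle \<beta> [] = \<beta> [] []"
| "unshuffle \<beta> (Z # w) =
    unshuffle (\<lambda>a b. \<beta> (map_prod fst fst Z # a) b) w + unshuffle (\<lambda>a b. \<beta> a (map_prod snd snd Z # b)) w"

lemma unshuffle_add: "unshuffle (\<lambda>a b. \<beta> a b + \<gamma> a b) w = unshuffle \<beta> w + unshuffle \<gamma> w"
  by (induction w arbitrary: \<beta> \<gamma>) simp_all

lemma unshuffle_scale: "unshuffle (\<lambda>a b. c * \<beta> a b) w = c * unshuffle \<beta> w"
  by (induction w arbitrary: \<beta>) (simp_all add: distrib_left)

lemma unshuffle_zero: "unshuffle (\<lambda>a b. 0) w = 0"
  by (induction w) simp_all

lemma unshuffle_map:
  assumes "\<And>Z. Z \<in> set w \<Longrightarrow> map_prod fst fst (\<Phi> Z) = \<phi> (map_prod fst fst Z)"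
    and "\<And>Z. Z \<in> set w \<Longrightarrow> map_prod snd snd (\<Phi> Z) = \<psi> (map_prod snd snd Z)"
  shows "unshuffle \<beta> (map \<Phi> w) = unshuffle (\<lambda>a b. \<beta> (map \<phi> a) (map \<psi> b)) w"
  using assms by (induction w arbitrary: \<beta>) auto

lemma sum_lessThan_add: "(\<Sum>i<m + n. f i) = (\<Sum>i<m. f i) + (\<Sum>i<n. f (m + i))"
  for f :: "nat \<Rightarrow> 'c::comm_monoid_add"
  by (induction n) (simp_all add: add.assoc)

text \<open>The point is the order of quantifiers: the pairs of words depend on \<open>w\<close>
  only and not on the form. They are the terms of the coproduct-like expansion of \<open>w\<close>,
  twice as many for each further letter.\<close>

lemma unshuffle_words:
  "\<exists>(n::nat) a b. \<forall>\<beta>. unshuffle \<beta> w = (\<Sum>i<n. \<beta> (a i) (b i)) \<and>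
    (\<forall>i<n. set (a i) \<subseteq> map_prod fst fst ` set w \<and> set (b i) \<subseteq> map_prod snd snd ` set w)"
proof (induction w)
  case Nil
  show ?case by (rule exI[of _ 1], rule exI[of _ "\<lambda>_. []"], rule exI[of _ "\<lambda>_. []"]) simp
next
  case (Cons Z w)
  then obtain n :: nat and a b where
    IH: "\<And>\<beta>. unshuffle \<beta> w = (\<Sum>i<n. \<beta> (a i) (b i))"
      "\<And>i. i < n \<Longrightarrow> set (a i) \<subseteq> map_prod fst fst ` set w \<and> set (b i) \<subseteq> map_prod snd snd ` set w"
    by blast
  \<comment> \<open>The first \<open>n\<close> terms put the new letter into the left word, the next
    \<open>n\<close> put it into the right word.\<close>
  define a' where "a' i = (if i < n then map_prod fst fst Z # a i else a (i - n))" for i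
  define b' where "b' i = (if i < n then b i else map_prod snd snd Z # b (i - n))" for i
  have "unshuffle \<beta> (Z # w) = (\<Sum>i<n + n. \<beta> (a' i) (b' i))" for \<beta>
  proof -
    have "(\<Sum>i<n + n. \<beta> (a' i) (b' i)) = (\<Sum>i<n. \<beta> (a' i) (b' i)) + (\<Sum>i<n. \<beta> (a' (n + i)) (b' (n + i)))"
      by (rule sum_lessThan_add)
    then show ?thesis by (simp add: IH(1) a'_def b'_def)
  qed
  moreover have "set (a' i) \<subseteq> map_prod fst fst ` set (Z # w) \<and> set (b' i) \<subseteq> map_prod snd snd ` set (Z # w)"
    if "i < n + n" for i
  proof (cases "i < n")
    case True
    then show ?thesis using IH(2)[of i] by (auto simp: a'_def b'_def)
  next
    case False
    then have "i - n < n" using that by linarith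
    from IH(2)[OF this] show ?thesis using False by (auto simp: a'_def b'_def)
  qed
  ultimately show ?case
    by (intro exI[of _ "n + n"] exI[of _ a'] exI[of _ b']) blast
qed

abbreviation pairing2 ::
  "('v list \<Rightarrow> complex) \<Rightarrow> ('w list \<Rightarrow> complex) \<Rightarrow> ('v list \<Rightarrow> 'w list \<Rightarrow> complex) \<Rightarrow> complex"
  where "pairing2 p q \<beta> \<equiv> pairing p (\<lambda>u. pairing q (\<beta> u))"

lemma pairing_swap: "pairing p (\<lambda>u. pairing q (\<lambda>v. \<beta> u v)) = pairing q (\<lambda>v. pairing p (\<lambda>u. \<beta> u v))"
  unfolding pairing_def sum_distrib_left by (subst sum.swap) (simp add: mult.left_commute)

text \<open>Collects what the tensor decomposition needs to know about a product of groups. The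
  assumptions on units and on Ad allow invariance under \<open>(g, 1)\<close> and
  \<open>(1, h)\<close> to be tested separately.\<close>

locale lie_product = G: lie_group_data G + H: lie_group_data H + P: lie_group_data "G \<times>\<times> H"
  for G :: "'a::euclidean_space monoid" and H :: "'b::euclidean_space monoid" +
  assumes Lie_P: "Lie (G \<times>\<times> H) = Lie G \<times> Lie H"
    and bracket_0: "bracket G X 0 = 0" "bracket G 0 X = 0" "bracket H Y 0 = 0" "bracket H 0 Y = 0"
    and one_carrier: "\<one>\<^bsub>G\<^esub> \<in> carrier G" "\<one>\<^bsub>H\<^esub> \<in> carrier H"
    and Ad_one: "Ad G \<one>\<^bsub>G\<^esub> X = X" "Ad H \<one>\<^bsub>H\<^esub> Y = Y"
    and Ad_0: "g \<in> carrier G \<Longrightarrow> Ad G g 0 = 0" "h \<in> carrier H \<Longrightarrow> Ad H h 0 = 0"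
    and Ad_P: "g \<in> carrier G \<Longrightarrow> h \<in> carrier H \<Longrightarrow> Ad (G \<times>\<times> H) (g, h) (X, Y) = (Ad G g X, Ad H h Y)"
begin

abbreviation "P \<equiv> G \<times>\<times> H"

lemma bracket_P: "bracket P (X, Y) (X', Y') = (bracket G X X', bracket H Y Y')"
  by (simp add: bracket_def DirProd_def)

lemma bracketCx_P:
  "map_prod fst fst (bracketCx P Z W) = bracketCx G (map_prod fst fst Z) (map_prod fst fst W)"
  "map_prod snd snd (bracketCx P Z W) = bracketCx H (map_prod snd snd Z) (map_prod snd snd W)"
  by (cases Z; cases W; auto simp: bracketCx_def bracket_P split: prod.splits)+

lemma scaleCx_P:
  "map_prod fst fst (scaleCx c Z) = scaleCx c (map_prod fst fst Z)"
  "map_prod snd snd (scaleCx c Z) = scaleCx c (map_prod snd snd Z)"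
  by (simp_all add: scaleCx_def)

lemma add_P:
  "map_prod fst fst (Z + W) = map_prod fst fst Z + map_prod fst fst W"
  "map_prod snd snd (Z + W) = map_prod snd snd Z + map_prod snd snd W"
  by (cases Z; cases W; simp)+

lemma LieCx_P_iff: "Z \<in> LieCx P \<longleftrightarrow> map_prod fst fst Z \<in> LieCx G \<and> map_prod snd snd Z \<in> LieCx H"
  by (cases Z) (auto simp: complexify_def Lie_P)

lemma emb_in: "X \<in> LieCx G \<Longrightarrow> emb1 X \<in> LieCx P" "Y \<in> LieCx H \<Longrightarrow> emb2 Y \<in> LieCx P"
  using subspace_0[OF G.Lie_subspace] subspace_0[OF H.Lie_subspace]
  by (cases X; cases Y; simp add: complexify_def Lie_P)+

lemma map_emb_in:
  "set a \<subseteq> LieCx G \<Longrightarrow> set (map emb1 a) \<subseteq> LieCx P"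
  "set b \<subseteq> LieCx H \<Longrightarrow> set (map emb2 b) \<subseteq> LieCx P"
  using emb_in by fastforce+

lemma emb1_hom: "lie_hom G P emb1"
  unfolding lie_hom_def using emb_in
  by (auto simp: bracketCx_def bracket_P bracket_0 scaleCx_def)

lemma emb2_hom: "lie_hom H P emb2"
  unfolding lie_hom_def using emb_in
  by (auto simp: bracketCx_def bracket_P bracket_0 scaleCx_def)

lemma emb_decomp: "Z = emb1 (map_prod fst fst Z) + emb2 (map_prod snd snd Z)"
  for Z :: "('a \<times> 'b) \<times> ('a \<times> 'b)"
  by (cases Z) auto

lemma emb_commute: "bracketCx P (emb2 Y) (emb1 X) = 0"
  by (cases X; cases Y) (simp add: bracketCx_def bracket_P bracket_0 zero_prod_def)

lemma emb_proj [simp]: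
  "map_prod fst fst (emb1 X) = X" "map_prod snd snd (emb1 X) = 0"
  "map_prod fst fst (emb2 Y) = 0" "map_prod snd snd (emb2 Y) = Y"
  by (cases X; cases Y; simp add: zero_prod_def)+

lemma unshuffle_cong:
  assumes "set w \<subseteq> LieCx P"
    and "\<And>a b. set a \<subseteq> LieCx G \<Longrightarrow> set b \<subseteq> LieCx H \<Longrightarrow> \<beta> a b = \<gamma> a b"
  shows "unshuffle \<beta> w = unshuffle \<gamma> w"
  using assms
proof (induction w arbitrary: \<beta> \<gamma>)
  case (Cons Z w)
  then have Z: "map_prod fst fst Z \<in> LieCx G" "map_prod snd snd Z \<in> LieCx H"
    using LieCx_P_iff[of Z] by simp_all
  show ?case
    unfolding unshuffle.simps using Cons Z by (intro arg_cong2[where f = "(+)"] Cons.IH) auto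
qed simp

text \<open>These are the linear forms on the tensor product of the two enveloping algebras, written
  as functions of two words; no tensor product has to be constructed.\<close>

definition bidual :: "(('a \<times> 'a) list \<Rightarrow> ('b \<times> 'b) list \<Rightarrow> complex) set"
  where "bidual = {\<beta>. (\<forall>b. set b \<subseteq> LieCx H \<longrightarrow> (\<lambda>a. \<beta> a b) \<in> dual_U G) \<and>
    (\<forall>a. set a \<subseteq> LieCx G \<longrightarrow> \<beta> a \<in> dual_U H)}"

lemma bidual_Cons:
  assumes "\<beta> \<in> bidual"
  shows "X \<in> LieCx G \<Longrightarrow> (\<lambda>a b. \<beta> (X # a) b) \<in> bidual"
    "Y \<in> LieCx H \<Longrightarrow> (\<lambda>a b. \<beta> a (Y # b)) \<in> bidual"
  using assms dual_U_Cons[of _ G X] dual_U_Cons[of _ H Y] unfolding bidual_def by auto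

text \<open>The assignment of X \<otimes> 1 + 1 \<otimes> Y to \<open>(X, Y)\<close> is a Lie
  algebra homomorphism, because left and right factors commute. The induction on \<open>x\<close>
  strips the letters in front, each turning \<beta> into another form in
  \<open>bidual\<close>.\<close>

lemma unshuffle_dual:
  assumes "\<beta> \<in> bidual"
  shows "unshuffle \<beta> \<in> dual_U P"
proof (rule dual_UI)
  let ?f = "map_prod fst fst" and ?s = "map_prod snd snd"
  fix x y Z W
  assume x: "set x \<subseteq> LieCx P" and y: "set y \<subseteq> LieCx P" and Z: "Z \<in> LieCx P"
  note Z' = Z[unfolded LieCx_P_iff]
  show "unshuffle \<beta> (x @ [scaleCx c Z] @ y) = c * unshuffle \<beta> (x @ [Z] @ y)" for c
    using assms x
  proof (induction x arbitrary: \<beta>)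
    case Nil
    have "unshuffle (\<lambda>a b. \<beta> (?f (scaleCx c Z) # a) b) y = unshuffle (\<lambda>a b. c * \<beta> (?f Z # a) b) y"
      using Nil Z' dual_U_scale[of "\<lambda>a. \<beta> a b" G "[]" for b]
      by (intro unshuffle_cong[OF y]) (auto simp: scaleCx_P bidual_def)
    moreover have "unshuffle (\<lambda>a b. \<beta> a (?s (scaleCx c Z) # b)) y = unshuffle (\<lambda>a b. c * \<beta> a (?s Z # b)) y"
      using Nil Z' dual_U_scale[of "\<beta> a" H "[]" for a]
      by (intro unshuffle_cong[OF y]) (auto simp: scaleCx_P bidual_def)
    ultimately show ?case by (simp add: unshuffle_scale distrib_left)
  next
    case (Cons U x)
    then have "?f U \<in> LieCx G" "?s U \<in> LieCx H" using LieCx_P_iff[of U] by simp_all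
    then show ?case
      using Cons.IH[OF bidual_Cons(1)[OF Cons.prems(1)]] Cons.IH[OF bidual_Cons(2)[OF Cons.prems(1)]]
        Cons.prems(2) by (simp add: distrib_left)
  qed
  assume W: "W \<in> LieCx P"
  note W' = W[unfolded LieCx_P_iff]
  show "unshuffle \<beta> (x @ [Z + W] @ y) = unshuffle \<beta> (x @ [Z] @ y) + unshuffle \<beta> (x @ [W] @ y)"
    using assms x
  proof (induction x arbitrary: \<beta>)
    case Nil
    have "unshuffle (\<lambda>a b. \<beta> (?f (Z + W) # a) b) y = unshuffle (\<lambda>a b. \<beta> (?f Z # a) b + \<beta> (?f W # a) b) y"
      using Nil Z' W' dual_U_add[of "\<lambda>a. \<beta> a b" G "[]" for b]
      by (intro unshuffle_cong[OF y]) (auto simp: add_P bidual_def)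
    moreover have "unshuffle (\<lambda>a b. \<beta> a (?s (Z + W) # b)) y = unshuffle (\<lambda>a b. \<beta> a (?s Z # b) + \<beta> a (?s W # b)) y"
      using Nil Z' W' dual_U_add[of "\<beta> a" H "[]" for a]
      by (intro unshuffle_cong[OF y]) (auto simp: add_P bidual_def)
    ultimately show ?case by (simp add: unshuffle_add)
  next
    case (Cons U x)
    then have "?f U \<in> LieCx G" "?s U \<in> LieCx H" using LieCx_P_iff[of U] by simp_all
    then show ?case
      using Cons.IH[OF bidual_Cons(1)[OF Cons.prems(1)]] Cons.IH[OF bidual_Cons(2)[OF Cons.prems(1)]]
        Cons.prems(2) by simp
  qed
  show "unshuffle \<beta> (x @ [Z, W] @ y) - unshuffle \<beta> (x @ [W, Z] @ y) = unshuffle \<beta> (x @ [bracketCx P Z W] @ y)"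
    using assms x
  proof (induction x arbitrary: \<beta>)
    case Nil
    \<comment> \<open>Of the four ways to distribute \<open>Z\<close> and \<open>W\<close>, the two
      mixed ones give the same terms for either order and cancel. Only the terms with both letters
      on one side need the bracket relation of that side.\<close>
    have "unshuffle (\<lambda>a b. \<beta> (?f Z # ?f W # a) b) y =
        unshuffle (\<lambda>a b. \<beta> (?f W # ?f Z # a) b + \<beta> (?f (bracketCx P Z W) # a) b) y"
    proof (rule unshuffle_cong[OF y])
      fix a b assume "set a \<subseteq> LieCx G" "set b \<subseteq> LieCx H"
      then show "\<beta> (?f Z # ?f W # a) b = \<beta> (?f W # ?f Z # a) b + \<beta> (?f (bracketCx P Z W) # a) b"
        using Nil Z' W' dual_U_bracket[of "\<lambda>a. \<beta> a b" G "[]" a "?f Z" "?f W"]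
        by (simp add: bracketCx_P bidual_def)
    qed
    moreover have "unshuffle (\<lambda>a b. \<beta> a (?s Z # ?s W # b)) y =
        unshuffle (\<lambda>a b. \<beta> a (?s W # ?s Z # b) + \<beta> a (?s (bracketCx P Z W) # b)) y"
    proof (rule unshuffle_cong[OF y])
      fix a b assume "set a \<subseteq> LieCx G" "set b \<subseteq> LieCx H"
      then show "\<beta> a (?s Z # ?s W # b) = \<beta> a (?s W # ?s Z # b) + \<beta> a (?s (bracketCx P Z W) # b)"
        using Nil Z' W' dual_U_bracket[of "\<beta> a" H "[]" b "?s Z" "?s W"]
        by (simp add: bracketCx_P bidual_def)
    qed
    ultimately show ?case by (simp add: unshuffle_add)
  next
    case (Cons U x)
    then have "?f U \<in> LieCx G" "?s U \<in> LieCx H" using LieCx_P_iff[of U] by simp_all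
    then show ?case
      using Cons.IH[OF bidual_Cons(1)[OF Cons.prems(1)]] Cons.IH[OF bidual_Cons(2)[OF Cons.prems(1)]]
        Cons.prems(2) by (simp add: add_diff_add)
  qed
qed

text \<open>An embedded letter has a zero component in the other factor, and a form that is linear
  in each letter vanishes on words with a zero letter. Of the whole expansion a single term
  survives.\<close>

lemma unshuffle_emb:
  assumes "\<beta> \<in> bidual" "set a \<subseteq> LieCx G" "set b \<subseteq> LieCx H"
  shows "unshuffle \<beta> (map emb1 a @ map emb2 b) = \<beta> a b"
  using assms
proof (induction a arbitrary: \<beta>)
  case Nil
  from Nil.prems(1,3) show ?case
  proof (induction b arbitrary: \<beta>)
    case (Cons Y b)
    have "unshuffle (\<lambda>a b. \<beta> (0 # a) b) (map emb2 b) = unshuffle (\<lambda>(a::('a \<times> 'a) list) b. 0) (map emb2 b)"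
      using Cons.prems map_emb_in(2)[of b] G.dual_U_zero[of "\<lambda>a. \<beta> a b" "[]" for b]
      by (intro unshuffle_cong) (auto simp: bidual_def)
    then show ?case
      using Cons.IH[OF bidual_Cons(2)[OF Cons.prems(1)]] Cons.prems(2) by (simp add: unshuffle_zero)
  qed simp
next
  case (Cons X a)
  have "unshuffle (\<lambda>a b. \<beta> a (0 # b)) (map emb1 a @ map emb2 b) = unshuffle (\<lambda>a b. 0) (map emb1 a @ map emb2 b)"
    using Cons.prems map_emb_in(1)[of a] map_emb_in(2)[of b] H.dual_U_zero[of "\<beta> a" "[]" for a]
    by (intro unshuffle_cong) (auto simp: bidual_def)
  then show ?case
    using Cons.IH[OF bidual_Cons(1)[OF Cons.prems(1)]] Cons.prems(2,3) by (simp add: unshuffle_zero)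
qed

lemma dual_U_emb_commute:
  assumes "F \<in> dual_U P" "set x \<subseteq> LieCx P" "set y \<subseteq> LieCx P" "set a \<subseteq> LieCx G" "Y \<in> LieCx H"
  shows "F (x @ emb2 Y # map emb1 a @ y) = F (x @ map emb1 a @ emb2 Y # y)"
  using assms(2,4)
proof (induction a arbitrary: x)
  case (Cons X a)
  have X: "emb1 X \<in> LieCx P" "emb2 Y \<in> LieCx P" using emb_in Cons.prems assms(5) by simp_all
  have r: "set (map emb1 a @ y) \<subseteq> LieCx P" using map_emb_in(1)[of a] Cons.prems assms(3) by simp
  have "F (x @ emb2 Y # emb1 X # map emb1 a @ y) = F (x @ emb1 X # emb2 Y # map emb1 a @ y)"
    using dual_U_bracket[OF assms(1) Cons.prems(1) r X(2,1)]
      P.dual_U_zero[OF assms(1) Cons.prems(1) r] by (simp add: emb_commute)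
  also have "\<dots> = F (x @ emb1 X # map emb1 a @ emb2 Y # y)"
    using Cons.IH[of "x @ [emb1 X]"] Cons.prems X by simp
  finally show ?case by simp
qed simp

lemma dual_U_emb_commute_list:
  assumes "F \<in> dual_U P" "set x \<subseteq> LieCx P" "set y \<subseteq> LieCx P" "set a \<subseteq> LieCx G" "set b \<subseteq> LieCx H"
  shows "F (x @ map emb2 b @ map emb1 a @ y) = F (x @ map emb1 a @ map emb2 b @ y)"
  using assms(2,5)
proof (induction b arbitrary: x)
  case (Cons Y b)
  have Y: "emb2 Y \<in> LieCx P" using emb_in Cons.prems by simp
  have r: "set (map emb2 b @ y) \<subseteq> LieCx P" using map_emb_in(2)[of b] Cons.prems assms(3) by simp
  have "F (x @ emb2 Y # map emb2 b @ map emb1 a @ y) = F (x @ emb2 Y # map emb1 a @ map emb2 b @ y)"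
    using Cons.IH[of "x @ [emb2 Y]"] Cons.prems Y by simp
  also have "\<dots> = F (x @ map emb1 a @ emb2 Y # map emb2 b @ y)"
    using dual_U_emb_commute[OF assms(1) Cons.prems(1) r assms(4), of Y] Cons.prems(2) by simp
  finally show ?case by simp
qed simp

text \<open>Each letter splits into its two embedded components, and the \<open>emb2\<close> part
  moves to the right past all \<open>emb1\<close> letters because they commute. Together with
  \<open>unshuffle_emb\<close> this identifies forms on U of the product with \<open>bidual\<close>,
  up to values on irrelevant words.\<close>

lemma dual_U_eq_unshuffle:
  assumes "F \<in> dual_U P" "set w \<subseteq> LieCx P"
  shows "F w = unshuffle (\<lambda>a b. F (map emb1 a @ map emb2 b)) w"
  using assms
proof (induction w arbitrary: F)
  case (Cons Z w)
  let ?X = "map_prod fst fst Z" and ?Y = "map_prod snd snd Z"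
  have Z: "?X \<in> LieCx G" "?Y \<in> LieCx H" and w: "set w \<subseteq> LieCx P"
    using Cons.prems LieCx_P_iff[of Z] by simp_all
  have "F (Z # w) = F (emb1 ?X # w) + F (emb2 ?Y # w)"
    using dual_U_add[OF Cons.prems(1), of "[]" w "emb1 ?X" "emb2 ?Y"] emb_in Z w
    by (simp add: emb_decomp[of Z, symmetric] del: emb_proj)
  also have "F (emb1 ?X # w) = unshuffle (\<lambda>a b. F (emb1 ?X # map emb1 a @ map emb2 b)) w"
    by (rule Cons.IH[OF dual_U_Cons[OF Cons.prems(1)] w]) (rule emb_in(1)[OF Z(1)])
  also have "F (emb2 ?Y # w) = unshuffle (\<lambda>a b. F (emb2 ?Y # map emb1 a @ map emb2 b)) w"
    by (rule Cons.IH[OF dual_U_Cons[OF Cons.prems(1)] w]) (rule emb_in(2)[OF Z(2)])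
  also have "\<dots> = unshuffle (\<lambda>a b. F (map emb1 a @ emb2 ?Y # map emb2 b)) w"
  proof (rule unshuffle_cong[OF w])
    fix a b assume "set a \<subseteq> LieCx G" "set b \<subseteq> LieCx H"
    then show "F (emb2 ?Y # map emb1 a @ map emb2 b) = F (map emb1 a @ emb2 ?Y # map emb2 b)"
      using dual_U_emb_commute[OF Cons.prems(1), of "[]" "map emb2 b" a ?Y] map_emb_in(2)[of b] Z
      by simp
  qed
  finally show ?case by simp
qed simp

lemma bidual_of_dual:
  assumes "F \<in> dual_U P"
  shows "(\<lambda>a b. F (map emb1 a @ map emb2 b)) \<in> bidual"
  unfolding bidual_def mem_Collect_eq
  using dual_U_comp_hom[OF emb1_hom dual_U_suffix[OF assms]]
    dual_U_comp_hom[OF emb2_hom dual_U_prefix[OF assms]] map_emb_in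
  by blast

lemma bidual_tensor: "\<alpha> \<in> dual_U G \<Longrightarrow> \<alpha>' \<in> dual_U H \<Longrightarrow> (\<lambda>a b. \<alpha> a * \<alpha>' b) \<in> bidual"
  using dual_U_scaled[of \<alpha>' H] dual_U_scaled[of \<alpha> G] unfolding bidual_def
  by (simp add: mult.commute[where b = "\<alpha>' _"])

end

text \<open>One member of a dual basis. The set \<open>?S\<close> consists of all representatives of
  classes in the span of the other \<open>b i\<close>; it contains the whole ideal of relations, so
  a form that separates \<open>b j\<close> from it descends to the enveloping algebra.\<close>

lemma (in lie_closed) dual_basis_functional:
  assumes "finite A" "\<And>i. i \<in> A \<Longrightarrow> b i \<in> carrier FA" "j \<in> A"
    and indep: "\<not> (\<exists>c. \<forall>F\<in>dual_U G. pairing (b j) F = (\<Sum>i\<in>A - {j}. c i * pairing (b i) F))"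
  obtains F where "F \<in> dual_U G" "pairing (b j) F = 1" "\<And>i. i \<in> A - {j} \<Longrightarrow> pairing (b i) F = 0"
proof -
  let ?S = "{q \<in> carrier FA. \<exists>c. \<forall>F\<in>dual_U G. pairing q F = (\<Sum>i\<in>A - {j}. c i * pairing (b i) F)}"
  have 1: "(\<lambda>w. 0) \<in> ?S"
    using carrier_zero by (auto simp: pairing_def intro!: exI[of _ "\<lambda>_. 0"])
  have 2: "(\<lambda>w. p w + q w) \<in> ?S" if pq: "p \<in> ?S" "q \<in> ?S" for p q
  proof -
    have fin: "fin_supp p" "fin_supp q" using pq fin_supp_carrier by blast+
    from pq(1) obtain c where c: "\<forall>F\<in>dual_U G. pairing p F = (\<Sum>i\<in>A - {j}. c i * pairing (b i) F)"
      by blast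
    from pq(2) obtain d where d: "\<forall>F\<in>dual_U G. pairing q F = (\<Sum>i\<in>A - {j}. d i * pairing (b i) F)"
      by blast
    from c d have "\<forall>F\<in>dual_U G. pairing (\<lambda>w. p w + q w) F = (\<Sum>i\<in>A - {j}. (c i + d i) * pairing (b i) F)"
      by (simp add: pairing_add[OF fin] distrib_right sum.distrib)
    moreover have "(\<lambda>w. p w + q w) \<in> carrier FA" using pq by (simp add: carrier_add)
    ultimately show ?thesis by (intro CollectI conjI exI[of _ "\<lambda>i. c i + d i"])
  qed
  have 3: "(\<lambda>w. z * p w) \<in> ?S" if p: "p \<in> ?S" for z p
  proof -
    obtain c where "\<forall>F\<in>dual_U G. pairing p F = (\<Sum>i\<in>A - {j}. c i * pairing (b i) F)"
      using p by blast
    then have "\<forall>F\<in>dual_U G. pairing (\<lambda>w. z * p w) F = (\<Sum>i\<in>A - {j}. (z * c i) * pairing (b i) F)"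
      by (simp add: pairing_scale sum_distrib_left mult.assoc)
    moreover have "(\<lambda>w. z * p w) \<in> carrier FA" using p by (simp add: carrier_scale)
    ultimately show ?thesis by (intro CollectI conjI exI[of _ "\<lambda>i. z * c i"])
  qed
  have 4: "fin_supp p" if "p \<in> ?S" for p using that fin_supp_carrier by blast
  have 5: "b j \<notin> ?S" using indep by blast
  obtain F where F: "\<And>q. q \<in> ?S \<Longrightarrow> pairing q F = 0" "pairing (b j) F = 1"
    by (rule separating_functional[OF 1 2 3 4 5 fin_supp_carrier[OF assms(2)[OF assms(3)]]]) blast+
  show ?thesis
  proof (rule that)
    show "F \<in> dual_U G"
    proof (rule dual_UI_annihilator)
      fix p assume p: "p \<in> U_ideal G"
      then have "\<forall>F\<in>dual_U G. pairing p F = (\<Sum>i\<in>A - {j}. 0 * pairing (b i) F)"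
        by (simp add: dual_U_annihilates)
      then have "p \<in> ?S" using U_ideal_carrier[OF p] by (intro CollectI conjI exI[of _ "\<lambda>i. 0"])
      then show "pairing p F = 0" by (rule F)
    qed
    fix i assume i: "i \<in> A - {j}"
    have "\<forall>F\<in>dual_U G. pairing (b i) F = (\<Sum>k\<in>A - {j}. of_bool (k = i) * pairing (b k) F)"
      using i assms(1) by (simp add: of_bool_def if_distrib[where f = "\<lambda>x. x * _"] cong: if_cong)
    then have "b i \<in> ?S" using i assms(2) by (intro CollectI conjI exI[of _ "\<lambda>k. of_bool (k = i)"]) auto
    then show "pairing (b i) F = 0" by (rule F)
  qed (rule F)
qed

lemma pairing2_tensor: "pairing2 a b (\<lambda>u v. \<alpha> u * \<alpha>' v) = pairing a \<alpha> * pairing b \<alpha>'"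
  by (simp add: pairing_right_scale pairing_right_scale')

lemma pairing_emb_mult:
  assumes "fin_supp a" "fin_supp b"
  shows "pairing (free_mult (push \<phi> a) (push \<psi> b)) F = pairing2 a b (\<lambda>u v. F (map \<phi> u @ map \<psi> v))"
  using assms by (simp add: pairing_mult fin_supp_push pairing_push)

lemma pairing_sum_left:
  "finite A \<Longrightarrow> (\<And>i. i \<in> A \<Longrightarrow> fin_supp (p i)) \<Longrightarrow>
    fin_supp (\<lambda>w. \<Sum>i\<in>A. p i w) \<and> pairing (\<lambda>w. \<Sum>i\<in>A. p i w) F = (\<Sum>i\<in>A. pairing (p i) F)"
proof (induction A rule: finite_induct)
  case (insert i A)
  then show ?case using fin_supp_add[of "p i" "\<lambda>w. \<Sum>i\<in>A. p i w"] pairing_add[of "p i" "\<lambda>w. \<Sum>i\<in>A. p i w"]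
    by simp
qed (simp add: pairing_def)

lemma pairing_sum_right: "pairing p (\<lambda>w. \<Sum>i\<in>A. F i w) = (\<Sum>i\<in>A. pairing p (F i))"
  unfolding pairing_def sum_distrib_left by (rule sum.swap)

section \<open>Shortest representations by tensors, and invariants of a product group\<close>

context lie_product
begin

text \<open>Says that \<open>p\<close> corresponds to the tensor sum of the \<open>a i\<close>
  \<otimes> \<open>b i\<close>, with equality of tensors tested against all bilinear forms in
  \<open>bidual\<close>.\<close>

definition represents ::
  "((('a \<times> 'b) \<times> ('a \<times> 'b)) list \<Rightarrow> complex) \<Rightarrow> 'i set \<Rightarrow>
    ('i \<Rightarrow> ('a \<times> 'a) list \<Rightarrow> complex) \<Rightarrow> ('i \<Rightarrow> ('b \<times> 'b) list \<Rightarrow> complex) \<Rightarrow> bool"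
  where "represents p A a b \<longleftrightarrow> finite A \<and> a ` A \<subseteq> carrier G.FA \<and> b ` A \<subseteq> carrier H.FA \<and>
    (\<forall>\<beta>\<in>bidual. pairing p (unshuffle \<beta>) = (\<Sum>i\<in>A. pairing2 (a i) (b i) \<beta>))"

text \<open>Terms are indexed by a word in the support of \<open>p\<close> together with a position
  in its expansion, and the coefficient of the word is absorbed into the left factor. The index type
  is fixed so that cardinalities of representations can be compared within one type.\<close>

lemma represents_exists:
  assumes p: "p \<in> carrier P.FA"
  shows "\<exists>(A :: ((('a \<times> 'b) \<times> ('a \<times> 'b)) list \<times> nat) set) a b. represents p A a b"
proof -
  have "\<forall>w :: (('a \<times> 'b) \<times> ('a \<times> 'b)) list. \<exists>(n::nat) a b. \<forall>\<beta>. unshuffle \<beta> w = (\<Sum>i<n. \<beta> (a i) (b i)) \<and>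
      (\<forall>i<n. set (a i) \<subseteq> map_prod fst fst ` set w \<and> set (b i) \<subseteq> map_prod snd snd ` set w)"
    by (rule allI) (rule unshuffle_words)
  from choice[OF this] obtain n :: "_ \<Rightarrow> nat" where "\<forall>w :: (('a \<times> 'b) \<times> ('a \<times> 'b)) list. \<exists>a b. \<forall>\<beta>. unshuffle \<beta> w = (\<Sum>i<n w. \<beta> (a i) (b i)) \<and>
      (\<forall>i<n w. set (a i) \<subseteq> map_prod fst fst ` set w \<and> set (b i) \<subseteq> map_prod snd snd ` set w)"
    by (rule exE)
  from choice[OF this] obtain a where "\<forall>w. \<exists>b. \<forall>\<beta>. unshuffle \<beta> w = (\<Sum>i<n w. \<beta> (a w i) (b i)) \<and>
      (\<forall>i<n w. set (a w i) \<subseteq> map_prod fst fst ` set w \<and> set (b i) \<subseteq> map_prod snd snd ` set w)"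
    by (rule exE)
  from choice[OF this] obtain b where b: "\<forall>w. \<forall>\<beta>. unshuffle \<beta> w = (\<Sum>i<n w. \<beta> (a w i) (b w i)) \<and>
      (\<forall>i<n w. set (a w i) \<subseteq> map_prod fst fst ` set w \<and> set (b w i) \<subseteq> map_prod snd snd ` set w)"
    by (rule exE)
  have eq: "unshuffle \<beta> w = (\<Sum>i<n w. \<beta> (a w i) (b w i))" for w \<beta>
    using b by blast
  have sub: "set (a w i) \<subseteq> map_prod fst fst ` set w \<and> set (b w i) \<subseteq> map_prod snd snd ` set w"
    if "i < n w" for w i
    using b that by blast
  let ?A = "SIGMA w:{w. p w \<noteq> 0}. {..<n w}"
  let ?a = "\<lambda>(w, i) x. p w * word (a w i) x" and ?b = "\<lambda>(w, i). word (b w i)"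
  have fin: "finite ?A" using fin_supp_carrier[OF p] by auto
  have in_V: "set (a w i) \<subseteq> LieCx G \<and> set (b w i) \<subseteq> LieCx H" if "p w \<noteq> 0" "i < n w" for w i
  proof -
    have "set w \<subseteq> LieCx P" using p that by (simp add: free_algebra_carrier_iff)
    then have "map_prod fst fst Z \<in> LieCx G \<and> map_prod snd snd Z \<in> LieCx H" if "Z \<in> set w" for Z
      using LieCx_P_iff[of Z] that by (meson subsetD)
    then have "map_prod fst fst ` set w \<subseteq> LieCx G" "map_prod snd snd ` set w \<subseteq> LieCx H"
      by (simp_all only: image_subset_iff) simp_all
    then show ?thesis using sub[OF that(2)] by blast
  qed
  have "represents p ?A ?a ?b"
    unfolding represents_def
  proof (intro conjI ballI fin)
    show "?a ` ?A \<subseteq> carrier G.FA" "?b ` ?A \<subseteq> carrier H.FA"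
      using in_V by (auto intro!: carrier_scale)
    fix \<beta> assume "\<beta> \<in> bidual"
    have "pairing p (unshuffle \<beta>) = (\<Sum>w | p w \<noteq> 0. \<Sum>i<n w. p w * \<beta> (a w i) (b w i))"
      by (simp add: pairing_def eq sum_distrib_left)
    also have "\<dots> = (\<Sum>(w, i)\<in>?A. p w * \<beta> (a w i) (b w i))"
      using fin_supp_carrier[OF p] by (intro sum.Sigma) auto
    also have "\<dots> = (\<Sum>i\<in>?A. pairing2 (?a i) (?b i) \<beta>)"
      by (intro sum.cong) (auto simp: pairing_scale)
    finally show "pairing p (unshuffle \<beta>) = (\<Sum>i\<in>?A. pairing2 (?a i) (?b i) \<beta>)" .
  qed
  then show ?thesis by blast
qed

text \<open>Substituting the linear relation for \<open>b j\<close> and expanding distributes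
  \<open>a j\<close> over the remaining left factors. So a dependence among the right factors always
  shortens the representation.\<close>

lemma represents_reduce_right:
  assumes rep: "represents p A a b" and j: "j \<in> A"
    and c: "\<forall>F\<in>dual_U H. pairing (b j) F = (\<Sum>i\<in>A - {j}. c i * pairing (b i) F)"
  shows "represents p (A - {j}) (\<lambda>i w. a i w + c i * a j w) b"
  unfolding represents_def
proof (intro conjI ballI)
  have A: "finite A" "\<And>i. i \<in> A \<Longrightarrow> a i \<in> carrier G.FA" "\<And>i. i \<in> A \<Longrightarrow> b i \<in> carrier H.FA"
    using rep unfolding represents_def by auto
  show "finite (A - {j})" "b ` (A - {j}) \<subseteq> carrier H.FA" using A by auto
  show "(\<lambda>i w. a i w + c i * a j w) ` (A - {j}) \<subseteq> carrier G.FA"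
    using A j by (auto intro!: carrier_add carrier_scale)
  fix \<beta> assume \<beta>: "\<beta> \<in> bidual"
  have "pairing2 (a j) (b j) \<beta> = pairing (a j) (\<lambda>u. \<Sum>i\<in>A - {j}. c i * pairing (b i) (\<beta> u))"
    using A(2)[OF j] \<beta> c by (intro pairing_cong) (auto simp: free_algebra_carrier_iff bidual_def)
  also have "\<dots> = (\<Sum>i\<in>A - {j}. c i * pairing2 (a j) (b i) \<beta>)"
    by (simp add: pairing_sum_right pairing_right_scale)
  finally have jj: "pairing2 (a j) (b j) \<beta> = (\<Sum>i\<in>A - {j}. c i * pairing2 (a j) (b i) \<beta>)" .
  have "pairing p (unshuffle \<beta>) = pairing2 (a j) (b j) \<beta> + (\<Sum>i\<in>A - {j}. pairing2 (a i) (b i) \<beta>)"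
    using rep \<beta> A(1) j unfolding represents_def by (simp add: sum.remove)
  also have "\<dots> = (\<Sum>i\<in>A - {j}. pairing2 (\<lambda>w. a i w + c i * a j w) (b i) \<beta>)"
    unfolding jj sum.distrib[symmetric]
    using fin_supp_carrier[OF A(2)] fin_supp_carrier[OF A(2)[OF j]]
    by (intro sum.cong) (auto simp: pairing_add fin_supp_scale pairing_scale)
  finally show "pairing p (unshuffle \<beta>) = (\<Sum>i\<in>A - {j}. pairing2 (\<lambda>w. a i w + c i * a j w) (b i) \<beta>)" .
qed

lemma represents_reduce_left:
  assumes rep: "represents p A a b" and j: "j \<in> A"
    and c: "\<forall>F\<in>dual_U G. pairing (a j) F = (\<Sum>i\<in>A - {j}. c i * pairing (a i) F)"
  shows "represents p (A - {j}) a (\<lambda>i w. b i w + c i * b j w)"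
  unfolding represents_def
proof (intro conjI ballI)
  have A: "finite A" "\<And>i. i \<in> A \<Longrightarrow> a i \<in> carrier G.FA" "\<And>i. i \<in> A \<Longrightarrow> b i \<in> carrier H.FA"
    using rep unfolding represents_def by auto
  show "finite (A - {j})" "a ` (A - {j}) \<subseteq> carrier G.FA" using A by auto
  show "(\<lambda>i w. b i w + c i * b j w) ` (A - {j}) \<subseteq> carrier H.FA"
    using A j by (auto intro!: carrier_add carrier_scale)
  fix \<beta> assume \<beta>: "\<beta> \<in> bidual"
  have "pairing2 (a j) (b j) \<beta> = pairing (b j) (\<lambda>v. pairing (a j) (\<lambda>u. \<beta> u v))"
    by (rule pairing_swap)
  also have "\<dots> = pairing (b j) (\<lambda>v. \<Sum>i\<in>A - {j}. c i * pairing (a i) (\<lambda>u. \<beta> u v))"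
    using A(3)[OF j] \<beta> c by (intro pairing_cong) (auto simp: free_algebra_carrier_iff bidual_def)
  also have "\<dots> = (\<Sum>i\<in>A - {j}. c i * pairing2 (a i) (b j) \<beta>)"
    by (simp add: pairing_sum_right pairing_right_scale pairing_swap[of "b j"])
  finally have jj: "pairing2 (a j) (b j) \<beta> = (\<Sum>i\<in>A - {j}. c i * pairing2 (a i) (b j) \<beta>)" .
  have "pairing p (unshuffle \<beta>) = pairing2 (a j) (b j) \<beta> + (\<Sum>i\<in>A - {j}. pairing2 (a i) (b i) \<beta>)"
    using rep \<beta> A(1) j unfolding represents_def by (simp add: sum.remove)
  also have "\<dots> = (\<Sum>i\<in>A - {j}. pairing2 (a i) (\<lambda>w. b i w + c i * b j w) \<beta>)"
    unfolding jj sum.distrib[symmetric]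
    using fin_supp_carrier[OF A(3)] fin_supp_carrier[OF A(3)[OF j]]
    by (intro sum.cong) (auto simp: pairing_add fin_supp_scale pairing_scale
        pairing_right_add pairing_right_scale)
  finally show "pairing p (unshuffle \<beta>) = (\<Sum>i\<in>A - {j}. pairing2 (a i) (\<lambda>w. b i w + c i * b j w) \<beta>)" .
qed

text \<open>Ad of \<open>(g, h)\<close> acts componentwise on letters, hence separately on the two
  words of the expansion. This transports invariance of \<open>p\<close> to bilinear forms.\<close>

lemma pairing_unshuffle_Ad:
  assumes p: "p \<in> carrier P.FA" "U_class P p \<in> ZG P" and gh: "g \<in> carrier G" "h \<in> carrier H"
    and \<beta>: "\<beta> \<in> bidual"
  shows "pairing p (unshuffle (\<lambda>a b. \<beta> (map (AdCx G g) a) (map (AdCx H h) b))) = pairing p (unshuffle \<beta>)"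
proof -
  have gh': "(g, h) \<in> carrier P" using gh by simp
  have "pairing p (unshuffle \<beta>) = pairing p (\<lambda>w. unshuffle \<beta> (map (AdCx P (g, h)) w))"
    using bspec[OF bspec[OF p(2)[unfolded P.ZG_class_iff[OF p(1)]] gh'] unshuffle_dual[OF \<beta>]] by simp
  also have "\<dots> = pairing p (unshuffle (\<lambda>a b. \<beta> (map (AdCx G g) a) (map (AdCx H h) b)))"
    using gh by (intro pairing_cong unshuffle_map) (auto simp: Ad_P)
  finally show ?thesis ..
qed

lemma AdCx_one: "map (AdCx G \<one>\<^bsub>G\<^esub>) a = a" "map (AdCx H \<one>\<^bsub>H\<^esub>) b = b"
  by (auto intro!: map_idI simp: Ad_one)

text \<open>In a representation with the least number of terms, both families of factors are linearly
  independent, so that invariance of the sum forces invariance of each factor.\<close>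

lemma ZG_product_decomposition:
  assumes u: "u \<in> ZG P"
  obtains A :: "((('a \<times> 'b) \<times> ('a \<times> 'b)) list \<times> nat) set" and a b where "finite A"
    "\<And>i. i \<in> A \<Longrightarrow> a i \<in> carrier G.FA" "\<And>i. i \<in> A \<Longrightarrow> b i \<in> carrier H.FA"
    "\<And>i. i \<in> A \<Longrightarrow> U_class G (a i) \<in> ZG G" "\<And>i. i \<in> A \<Longrightarrow> U_class H (b i) \<in> ZG H"
    "u = U_class P (\<lambda>w. \<Sum>i\<in>A. free_mult (push emb1 (a i)) (push emb2 (b i)) w)"
proof -
  obtain p where p: "p \<in> carrier P.FA" and up: "u = U_class P p"
    using u by (rule P.ZG_cases)
  note pZ = u[unfolded up]
  let ?R = "\<lambda>(A :: ((('a \<times> 'b) \<times> ('a \<times> 'b)) list \<times> nat) set, a, b). represents p A a b"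
  obtain t where t: "?R t" "\<And>t'. ?R t' \<Longrightarrow> card (fst t) \<le> card (fst t')"
    using represents_exists[OF p] ex_has_least_nat[of ?R _ "\<lambda>t. card (fst t)"] by fastforce
  obtain A a b where t_eq: "t = (A, a, b)" by (cases t)
  have rep: "represents p A a b" using t(1) by (simp add: t_eq)
  have min: "card A \<le> card A'" if "represents p A' a' b'"
    for A' :: "((('a \<times> 'b) \<times> ('a \<times> 'b)) list \<times> nat) set" and a' b'
    using t(2)[of "(A', a', b')"] that by (simp add: t_eq)
  have A: "finite A" "\<And>i. i \<in> A \<Longrightarrow> a i \<in> carrier G.FA" "\<And>i. i \<in> A \<Longrightarrow> b i \<in> carrier H.FA"
    using rep unfolding represents_def by auto
  have smaller: "card (A - {j}) < card A" if "j \<in> A" for j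
    using card_Diff1_less[OF A(1) that] .
  have eval: "pairing p (unshuffle \<beta>) = (\<Sum>i\<in>A. pairing2 (a i) (b i) \<beta>)" if "\<beta> \<in> bidual" for \<beta>
    using rep that unfolding represents_def by blast
  have aZ: "U_class G (a j) \<in> ZG G" if j: "j \<in> A" for j
    unfolding G.ZG_class_iff[OF A(2)[OF j]]
  proof (intro ballI)
    fix g \<alpha> assume g: "g \<in> carrier G" and \<alpha>: "\<alpha> \<in> dual_U G"
    \<comment> \<open>Otherwise dropping the index \<open>j\<close> would give a representation with
      fewer terms than the minimal one.\<close>
    have indep: "\<not> (\<exists>c. \<forall>F\<in>dual_U H. pairing (b j) F = (\<Sum>i\<in>A - {j}. c i * pairing (b i) F))"
      using represents_reduce_right[OF rep j] min smaller[OF j] by (meson not_less)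
    obtain F where F: "F \<in> dual_U H" "pairing (b j) F = 1" "\<And>i. i \<in> A - {j} \<Longrightarrow> pairing (b i) F = 0"
      by (rule H.dual_basis_functional[OF A(1,3) j indep]) blast+
    \<comment> \<open>Contracting the right factors with the dual basis element \<open>F\<close>
      kills every term but the one with index \<open>j\<close>, so \<open>a j\<close> is recovered
      from \<open>p\<close>.\<close>
    have ev: "pairing p (unshuffle (\<lambda>a b. \<gamma> a * F b)) = pairing (a j) \<gamma>" if "\<gamma> \<in> dual_U G" for \<gamma>
      using eval[OF bidual_tensor[OF that F(1)]] j A(1) F(2,3)
      by (simp add: pairing2_tensor sum.remove)
    \<comment> \<open>Invariance of \<open>p\<close> under \<open>(g, 1)\<close> leaves the
      contraction with \<open>F\<close> unchanged and is therefore inherited by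
      \<open>a j\<close>.\<close>
    show "pairing (a j) (\<lambda>w. \<alpha> (map (AdCx G g) w)) = pairing (a j) \<alpha>"
      using pairing_unshuffle_Ad[OF p pZ g one_carrier(2) bidual_tensor[OF \<alpha> F(1)]]
        ev[OF \<alpha>] ev[OF dual_U_comp_hom[OF G.Ad_hom[OF g] \<alpha>]]
      by (simp only: AdCx_one)
  qed
  have bZ: "U_class H (b j) \<in> ZG H" if j: "j \<in> A" for j
    unfolding H.ZG_class_iff[OF A(3)[OF j]]
  proof (intro ballI)
    fix h \<alpha> assume h: "h \<in> carrier H" and \<alpha>: "\<alpha> \<in> dual_U H"
    have indep: "\<not> (\<exists>c. \<forall>F\<in>dual_U G. pairing (a j) F = (\<Sum>i\<in>A - {j}. c i * pairing (a i) F))"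
      using represents_reduce_left[OF rep j] min smaller[OF j] by (meson not_less)
    obtain F where F: "F \<in> dual_U G" "pairing (a j) F = 1" "\<And>i. i \<in> A - {j} \<Longrightarrow> pairing (a i) F = 0"
      by (rule G.dual_basis_functional[OF A(1,2) j indep]) blast+
    have ev: "pairing p (unshuffle (\<lambda>a b. F a * \<gamma> b)) = pairing (b j) \<gamma>" if "\<gamma> \<in> dual_U H" for \<gamma>
      using eval[OF bidual_tensor[OF F(1) that]] j A(1) F(2,3)
      by (simp add: pairing2_tensor sum.remove)
    show "pairing (b j) (\<lambda>w. \<alpha> (map (AdCx H h) w)) = pairing (b j) \<alpha>"
      using pairing_unshuffle_Ad[OF p pZ one_carrier(1) h bidual_tensor[OF F(1) \<alpha>]]
        ev[OF \<alpha>] ev[OF dual_U_comp_hom[OF H.Ad_hom[OF h] \<alpha>]]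
      by (simp only: AdCx_one)
  qed
  have c: "free_mult (push emb1 (a i)) (push emb2 (b i)) \<in> carrier P.FA" if "i \<in> A" for i
    using that A(2,3) by (intro carrier_mult push_in_carrier[OF A(2)] push_in_carrier[OF A(3)] emb_in)
  have "(\<lambda>w. \<Sum>i\<in>A. free_mult (push emb1 (a i)) (push emb2 (b i)) w) \<in> carrier P.FA"
    using c A(1) by (induction rule: finite_induct[OF A(1)]) (auto simp: carrier_zero carrier_add)
  moreover have "pairing p F = pairing (\<lambda>w. \<Sum>i\<in>A. free_mult (push emb1 (a i)) (push emb2 (b i)) w) F"
    if F: "F \<in> dual_U P" for F
  proof -
    have "pairing p F = pairing p (unshuffle (\<lambda>a b. F (map emb1 a @ map emb2 b)))"
      using p dual_U_eq_unshuffle[OF F] by (intro pairing_cong) (auto simp: free_algebra_carrier_iff)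
    also have "\<dots> = (\<Sum>i\<in>A. pairing (free_mult (push emb1 (a i)) (push emb2 (b i))) F)"
      unfolding eval[OF bidual_of_dual[OF F]]
      by (intro sum.cong refl pairing_emb_mult[symmetric] fin_supp_carrier[OF A(2)] fin_supp_carrier[OF A(3)])
    also have "\<dots> = pairing (\<lambda>w. \<Sum>i\<in>A. free_mult (push emb1 (a i)) (push emb2 (b i)) w) F"
      by (intro conjunct2[OF pairing_sum_left, symmetric] A(1) fin_supp_carrier[OF c])
    finally show ?thesis .
  qed
  ultimately have dec: "u = U_class P (\<lambda>w. \<Sum>i\<in>A. free_mult (push emb1 (a i)) (push emb2 (b i)) w)"
    using p by (simp add: up P.U_class_eq_iff)
  show ?thesis by (rule that[OF A aZ bZ dec])
qed

end

section \<open>The character of the product determined by a pair of characters\<close>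

context lie_product
begin

lemma push_emb_in:
  "a \<in> carrier G.FA \<Longrightarrow> push emb1 a \<in> carrier P.FA"
  "b \<in> carrier H.FA \<Longrightarrow> push emb2 b \<in> carrier P.FA"
  by (erule push_in_carrier, erule emb_in)+

lemma U_map_emb:
  "a \<in> carrier G.FA \<Longrightarrow> U_map P emb1 (U_class G a) = U_class P (push emb1 a)"
  "b \<in> carrier H.FA \<Longrightarrow> U_map P emb2 (U_class H b) = U_class P (push emb2 b)"
  by (rule U_map_class[OF G.lie_closed_axioms P.lie_closed_axioms emb1_hom], assumption)
    (rule U_map_class[OF H.lie_closed_axioms P.lie_closed_axioms emb2_hom])

lemma U_map_emb_mult:
  assumes "a \<in> carrier G.FA" "b \<in> carrier H.FA"
  shows "U_map P emb1 (U_class G a) \<otimes>\<^bsub>U_alg P\<^esub> U_map P emb2 (U_class H b) =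
    U_class P (free_mult (push emb1 a) (push emb2 b))"
  using assms by (simp add: U_map_emb P.U_alg_mult push_emb_in)

lemma ZG_emb1:
  assumes a: "a \<in> carrier G.FA" "U_class G a \<in> ZG G"
  shows "U_class P (push emb1 a) \<in> ZG P"
  unfolding P.ZG_class_iff[OF push_emb_in(1)[OF a(1)]]
proof (intro ballI)
  fix x F assume x: "x \<in> carrier P" and F: "F \<in> dual_U P"
  obtain g h where gh: "x = (g, h)" "g \<in> carrier G" "h \<in> carrier H" using x by auto
  have "map (AdCx P x) (map emb1 u) = map emb1 (map (AdCx G g) u)" for u
    using gh by (auto simp: Ad_P Ad_0)
  then have "pairing (push emb1 a) (\<lambda>w. F (map (AdCx P x) w)) =
      pairing a (\<lambda>u. F (map emb1 (map (AdCx G g) u)))"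
    by (simp only: pairing_push[OF fin_supp_carrier[OF a(1)]])
  also have "\<dots> = pairing a (\<lambda>u. F (map emb1 u))"
    using bspec[OF bspec[OF a(2)[unfolded G.ZG_class_iff[OF a(1)]] gh(2)] dual_U_comp_hom[OF emb1_hom F]] .
  also have "\<dots> = pairing (push emb1 a) F"
    by (simp only: pairing_push[OF fin_supp_carrier[OF a(1)]])
  finally show "pairing (push emb1 a) (\<lambda>w. F (map (AdCx P x) w)) = pairing (push emb1 a) F" .
qed

lemma ZG_emb2:
  assumes b: "b \<in> carrier H.FA" "U_class H b \<in> ZG H"
  shows "U_class P (push emb2 b) \<in> ZG P"
  unfolding P.ZG_class_iff[OF push_emb_in(2)[OF b(1)]]
proof (intro ballI)
  fix x F assume x: "x \<in> carrier P" and F: "F \<in> dual_U P"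
  obtain g h where gh: "x = (g, h)" "g \<in> carrier G" "h \<in> carrier H" using x by auto
  have "map (AdCx P x) (map emb2 u) = map emb2 (map (AdCx H h) u)" for u
    using gh by (auto simp: Ad_P Ad_0)
  then have "pairing (push emb2 b) (\<lambda>w. F (map (AdCx P x) w)) =
      pairing b (\<lambda>u. F (map emb2 (map (AdCx H h) u)))"
    by (simp only: pairing_push[OF fin_supp_carrier[OF b(1)]])
  also have "\<dots> = pairing b (\<lambda>u. F (map emb2 u))"
    using bspec[OF bspec[OF b(2)[unfolded H.ZG_class_iff[OF b(1)]] gh(3)] dual_U_comp_hom[OF emb2_hom F]] .
  also have "\<dots> = pairing (push emb2 b) F"
    by (simp only: pairing_push[OF fin_supp_carrier[OF b(1)]])
  finally show "pairing (push emb2 b) (\<lambda>w. F (map (AdCx P x) w)) = pairing (push emb2 b) F" .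
qed

lemma emb_mult_in:
  assumes "a \<in> carrier G.FA" "b \<in> carrier H.FA"
  shows "free_mult (push emb1 a) (push emb2 b) \<in> carrier P.FA"
  using assms by (intro carrier_mult push_emb_in)

lemma ZG_emb_mult:
  assumes "a \<in> carrier G.FA" "b \<in> carrier H.FA" "U_class G a \<in> ZG G" "U_class H b \<in> ZG H"
  shows "U_class P (free_mult (push emb1 a) (push emb2 b)) \<in> ZG P"
  using assms by (intro P.ZG_mult push_emb_in ZG_emb1 ZG_emb2)

context
  fixes chi chi'
  assumes chi: "chi \<in> ZG_characters G" and chi': "chi' \<in> ZG_characters H"
begin

definition extends_pair :: "(((('a \<times> 'b) \<times> ('a \<times> 'b)) list \<Rightarrow> complex) set \<Rightarrow> complex) \<Rightarrow> bool"
  where "extends_pair \<xi> \<longleftrightarrow> \<xi> \<in> ZG_characters P \<and>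
    (\<forall>u\<in>ZG G. \<forall>v\<in>ZG H. \<xi> (U_map P emb1 u \<otimes>\<^bsub>U_alg P\<^esub> U_map P emb2 v) = chi u * chi' v)"

lemma extends_pair_sum:
  assumes \<xi>: "extends_pair \<xi>" and A: "finite A"
    "\<And>i. i \<in> A \<Longrightarrow> a i \<in> carrier G.FA" "\<And>i. i \<in> A \<Longrightarrow> b i \<in> carrier H.FA"
    "\<And>i. i \<in> A \<Longrightarrow> U_class G (a i) \<in> ZG G" "\<And>i. i \<in> A \<Longrightarrow> U_class H (b i) \<in> ZG H"
  shows "\<xi> (U_class P (\<lambda>w. \<Sum>i\<in>A. free_mult (push emb1 (a i)) (push emb2 (b i)) w)) =
    (\<Sum>i\<in>A. chi (U_class G (a i)) * chi' (U_class H (b i)))"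
proof -
  have \<xi>': "\<xi> \<in> ZG_characters P" using \<xi> by (simp add: extends_pair_def)
  have "\<xi> (U_class P (\<lambda>w. \<Sum>i\<in>A. free_mult (push emb1 (a i)) (push emb2 (b i)) w)) =
      (\<Sum>i\<in>A. \<xi> (U_class P (free_mult (push emb1 (a i)) (push emb2 (b i)))))"
    by (rule conjunct2[OF conjunct2[OF P.character_sum[OF \<xi>' A(1)]]])
      (intro emb_mult_in ZG_emb_mult A; assumption)+
  also have "\<dots> = (\<Sum>i\<in>A. chi (U_class G (a i)) * chi' (U_class H (b i)))"
    using \<xi> A by (intro sum.cong refl) (simp add: extends_pair_def U_map_emb_mult[symmetric])
  finally show ?thesis .
qed

text \<open>By the decomposition, every invariant of the product is a sum of products of embedded
  invariants, and on these additivity and the prescribed values leave no choice.\<close>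

lemma extends_pair_unique:
  assumes "extends_pair \<xi>" "extends_pair \<xi>'"
  shows "\<xi> = \<xi>'"
proof (rule extensionalityI[where A = "ZG P"])
  show "\<xi> \<in> extensional (ZG P)" "\<xi>' \<in> extensional (ZG P)"
    using assms by (simp_all add: extends_pair_def ZG_characters_def)
  fix u assume "u \<in> ZG P"
  then show "\<xi> u = \<xi>' u"
  proof (rule ZG_product_decomposition)
    fix A :: "((('a \<times> 'b) \<times> ('a \<times> 'b)) list \<times> nat) set" and a b
    assume A: "finite A"
      "\<And>i. i \<in> A \<Longrightarrow> a i \<in> carrier G.FA" "\<And>i. i \<in> A \<Longrightarrow> b i \<in> carrier H.FA"
      "\<And>i. i \<in> A \<Longrightarrow> U_class G (a i) \<in> ZG G" "\<And>i. i \<in> A \<Longrightarrow> U_class H (b i) \<in> ZG H"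
      and u: "u = U_class P (\<lambda>w. \<Sum>i\<in>A. free_mult (push emb1 (a i)) (push emb2 (b i)) w)"
    show "\<xi> u = \<xi>' u"
      unfolding u using extends_pair_sum[OF assms(1) A] extends_pair_sum[OF assms(2) A] by simp
  qed
qed

text \<open>Both characters are extended to linear forms \<alpha> and \<alpha>', and the tensor
  product of these is carried to a form \<Phi> on U of the product. Its restriction to invariants is
  the wanted character; the work lies in multiplicativity.\<close>

lemma extends_pair_exists: "\<exists>\<xi>. extends_pair \<xi>"
proof -
  obtain \<alpha> where \<alpha>: "\<alpha> \<in> dual_U G"
    "\<And>p. p \<in> carrier G.FA \<Longrightarrow> U_class G p \<in> ZG G \<Longrightarrow> pairing p \<alpha> = chi (U_class G p)"
    by (rule G.character_functional[OF chi]) blast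
  obtain \<alpha>' where \<alpha>': "\<alpha>' \<in> dual_U H"
    "\<And>p. p \<in> carrier H.FA \<Longrightarrow> U_class H p \<in> ZG H \<Longrightarrow> pairing p \<alpha>' = chi' (U_class H p)"
    by (rule H.character_functional[OF chi']) blast
  define \<Phi> where "\<Phi> = unshuffle (\<lambda>a b. \<alpha> a * \<alpha>' b)"
  have \<Phi>: "\<Phi> \<in> dual_U P"
    unfolding \<Phi>_def by (intro unshuffle_dual bidual_tensor \<alpha> \<alpha>')
  have \<Phi>_emb: "\<Phi> (map emb1 a @ map emb2 b) = \<alpha> a * \<alpha>' b"
    if "set a \<subseteq> LieCx G" "set b \<subseteq> LieCx H" for a b
    unfolding \<Phi>_def using unshuffle_emb[OF bidual_tensor[OF \<alpha>(1) \<alpha>'(1)] that] .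
  \<comment> \<open>The choice of representative is harmless, because \<Phi> lies in
    \<open>dual_U\<close> and so depends on the class only.\<close>
  define \<xi> where "\<xi> = (\<lambda>u\<in>ZG P. pairing (SOME p. p \<in> carrier P.FA \<and> u = U_class P p) \<Phi>)"
  have \<xi>: "\<xi> (U_class P p) = pairing p \<Phi>" if p: "p \<in> carrier P.FA" "U_class P p \<in> ZG P" for p
  proof -
    let ?q = "SOME q. q \<in> carrier P.FA \<and> U_class P p = U_class P q"
    have "?q \<in> carrier P.FA \<and> U_class P p = U_class P ?q"
      by (rule someI[where x = p]) (use p in simp)
    then have "pairing ?q \<Phi> = pairing p \<Phi>"
      using P.U_class_eq_iff[OF p(1), of ?q] \<Phi> by simp
    then show ?thesis using p by (simp add: \<xi>_def)
  qed
  have fin: "fin_supp p" if "p \<in> carrier G.FA" for p using that by (rule fin_supp_carrier)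
  have fin': "fin_supp p" if "p \<in> carrier H.FA" for p using that by (rule fin_supp_carrier)
  have emb: "pairing (free_mult (push emb1 a) (push emb2 b)) \<Phi> = chi (U_class G a) * chi' (U_class H b)"
    if "a \<in> carrier G.FA" "b \<in> carrier H.FA" "U_class G a \<in> ZG G" "U_class H b \<in> ZG H" for a b
  proof -
    have "pairing (free_mult (push emb1 a) (push emb2 b)) \<Phi> =
        pairing2 a b (\<lambda>u v. \<Phi> (map emb1 u @ map emb2 v))"
      by (rule pairing_emb_mult[OF fin[OF that(1)] fin'[OF that(2)]])
    also have "\<dots> = pairing2 a b (\<lambda>u v. \<alpha> u * \<alpha>' v)"
      using that(1,2) by (intro pairing_cong \<Phi>_emb) (auto simp: free_algebra_carrier_iff)
    finally show ?thesis using that by (simp only: pairing2_tensor \<alpha>(2) \<alpha>'(2))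
  qed
  \<comment> \<open>In the product of two decomposable elements the two middle factors commute,
    which gathers \<open>a\<close>, \<open>c\<close> on the left and \<open>b\<close>,
    \<open>d\<close> on the right. Now \<alpha> and \<alpha>' are evaluated on products of
    invariants, where they agree with the multiplicative \<open>chi\<close> and
    \<open>chi'\<close>.\<close>
  have prod: "pairing (free_mult (free_mult (push emb1 a) (push emb2 b)) (free_mult (push emb1 c) (push emb2 d))) \<Phi> =
      chi (U_class G a) * chi' (U_class H b) * (chi (U_class G c) * chi' (U_class H d))"
    if "a \<in> carrier G.FA" "b \<in> carrier H.FA" "U_class G a \<in> ZG G" "U_class H b \<in> ZG H"
      "c \<in> carrier G.FA" "d \<in> carrier H.FA" "U_class G c \<in> ZG G" "U_class H d \<in> ZG H" for a b c d
  proof -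
    note f = fin[OF that(1)] fin'[OF that(2)] fin[OF that(5)] fin'[OF that(6)]
    have "pairing (free_mult (free_mult (push emb1 a) (push emb2 b)) (free_mult (push emb1 c) (push emb2 d))) \<Phi> =
        pairing a (\<lambda>s. pairing b (\<lambda>t. pairing c (\<lambda>u. pairing d (\<lambda>v.
          \<Phi> (map emb1 s @ map emb2 t @ map emb1 u @ map emb2 v)))))"
      by (simp add: pairing_mult fin_supp_push fin_supp_mult pairing_push f)
    also have "\<dots> = pairing a (\<lambda>s. pairing b (\<lambda>t. pairing c (\<lambda>u. pairing d (\<lambda>v. \<alpha> (s @ u) * \<alpha>' (t @ v)))))"
    proof (intro pairing_cong)
      fix s t u v assume "a s \<noteq> 0" "b t \<noteq> 0" "c u \<noteq> 0" "d v \<noteq> 0"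
      then have V: "set s \<subseteq> LieCx G" "set t \<subseteq> LieCx H" "set u \<subseteq> LieCx G" "set v \<subseteq> LieCx H"
        using that by (auto simp: free_algebra_carrier_iff)
      have "\<Phi> (map emb1 s @ map emb2 t @ map emb1 u @ map emb2 v) =
          \<Phi> (map emb1 s @ map emb1 u @ map emb2 t @ map emb2 v)"
        by (rule dual_U_emb_commute_list[OF \<Phi>]) (use V map_emb_in in simp_all)
      then show "\<Phi> (map emb1 s @ map emb2 t @ map emb1 u @ map emb2 v) = \<alpha> (s @ u) * \<alpha>' (t @ v)"
        using \<Phi>_emb[of "s @ u" "t @ v"] V by simp
    qed
    also have "\<dots> = pairing a (\<lambda>s. pairing c (\<lambda>u. \<alpha> (s @ u))) * pairing b (\<lambda>t. pairing d (\<lambda>v. \<alpha>' (t @ v)))"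
      by (simp add: pairing_right_scale pairing_right_scale')
    also have "\<dots> = chi (U_class G (free_mult a c)) * chi' (U_class H (free_mult b d))"
      using that f by (simp add: pairing_mult[symmetric] \<alpha>(2) \<alpha>'(2) carrier_mult G.ZG_mult H.ZG_mult)
    finally show ?thesis
      using that by (simp add: G.character_mult[OF chi] H.character_mult[OF chi'])
  qed
  have "\<xi> \<in> ZG_characters P"
    unfolding ZG_characters_def mem_Collect_eq
  proof (intro conjI ballI allI)
    show "\<xi> \<in> extensional (ZG P)" by (simp add: \<xi>_def)
    show "\<xi> (U_scalar P c) = c" for c
    proof -
      have "\<xi> (U_scalar P c) = c * \<Phi> []"
        unfolding U_scalar_def by (simp add: \<xi> carrier_scale P.ZG_scalar pairing_scale)
      also have "\<Phi> [] = pairing (word []) \<alpha> * pairing (word []) \<alpha>'"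
        using \<Phi>_emb[of "[]" "[]"] by simp
      also have "\<dots> = 1"
        using \<alpha>(2)[OF _ G.ZG_one] \<alpha>'(2)[OF _ H.ZG_one] G.character_one[OF chi] H.character_one[OF chi']
        by simp
      finally show ?thesis by simp
    qed
    fix u v assume u: "u \<in> ZG P" and v: "v \<in> ZG P"
    obtain p where p: "p \<in> carrier P.FA" "u = U_class P p" using u by (rule P.ZG_cases)
    obtain q where q: "q \<in> carrier P.FA" "v = U_class P q" using v by (rule P.ZG_cases)
    note Z = u[unfolded p] v[unfolded q]
    show "\<xi> (u \<oplus>\<^bsub>U_alg P\<^esub> v) = \<xi> u + \<xi> v"
      unfolding p q P.U_alg_add[OF p(1) q(1)]
      using p(1) q(1) Z by (simp add: \<xi> carrier_add P.ZG_add pairing_add fin_supp_carrier)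
    \<comment> \<open>Both arguments have to be decomposed: \<Phi> is known to be multiplicative
      only on products of embedded invariants, and bilinearity extends this to their sums.\<close>
    from u show "\<xi> (u \<otimes>\<^bsub>U_alg P\<^esub> v) = \<xi> u * \<xi> v"
    proof (rule ZG_product_decomposition)
      fix A :: "((('a \<times> 'b) \<times> ('a \<times> 'b)) list \<times> nat) set" and a b
      assume A: "finite A"
        "\<And>i. i \<in> A \<Longrightarrow> a i \<in> carrier G.FA" "\<And>i. i \<in> A \<Longrightarrow> b i \<in> carrier H.FA"
        "\<And>i. i \<in> A \<Longrightarrow> U_class G (a i) \<in> ZG G" "\<And>i. i \<in> A \<Longrightarrow> U_class H (b i) \<in> ZG H"
        and ua: "u = U_class P (\<lambda>w. \<Sum>i\<in>A. free_mult (push emb1 (a i)) (push emb2 (b i)) w)"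
      from v show ?thesis
      proof (rule ZG_product_decomposition)
        fix B :: "((('a \<times> 'b) \<times> ('a \<times> 'b)) list \<times> nat) set" and c d
        assume B: "finite B"
          "\<And>i. i \<in> B \<Longrightarrow> c i \<in> carrier G.FA" "\<And>i. i \<in> B \<Longrightarrow> d i \<in> carrier H.FA"
          "\<And>i. i \<in> B \<Longrightarrow> U_class G (c i) \<in> ZG G" "\<And>i. i \<in> B \<Longrightarrow> U_class H (d i) \<in> ZG H"
          and vc: "v = U_class P (\<lambda>w. \<Sum>i\<in>B. free_mult (push emb1 (c i)) (push emb2 (d i)) w)"
        let ?x = "\<lambda>i. free_mult (push emb1 (a i)) (push emb2 (b i))"
        let ?y = "\<lambda>i. free_mult (push emb1 (c i)) (push emb2 (d i))"
        have x: "?x i \<in> carrier P.FA" if "i \<in> A" for i using that A by (intro emb_mult_in)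
        have y: "?y i \<in> carrier P.FA" if "i \<in> B" for i using that B by (intro emb_mult_in)
        have X: "(\<lambda>w. \<Sum>i\<in>A. ?x i w) \<in> carrier P.FA"
          using x by (induction rule: finite_induct[OF A(1)]) (auto simp: carrier_zero carrier_add)
        have Y: "(\<lambda>w. \<Sum>i\<in>B. ?y i w) \<in> carrier P.FA"
          using y by (induction rule: finite_induct[OF B(1)]) (auto simp: carrier_zero carrier_add)
        have sumX: "pairing (\<lambda>w. \<Sum>i\<in>A. ?x i w) F = (\<Sum>i\<in>A. pairing (?x i) F)" for F
          by (intro conjunct2[OF pairing_sum_left] A(1) fin_supp_carrier[OF x])
        have sumY: "pairing (\<lambda>w. \<Sum>i\<in>B. ?y i w) F = (\<Sum>i\<in>B. pairing (?y i) F)" for F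
          by (intro conjunct2[OF pairing_sum_left] B(1) fin_supp_carrier[OF y])
        have uv: "u \<otimes>\<^bsub>U_alg P\<^esub> v = U_class P (free_mult (\<lambda>w. \<Sum>i\<in>A. ?x i w) (\<lambda>w. \<Sum>i\<in>B. ?y i w))"
          unfolding ua vc by (rule P.U_alg_mult[OF X Y])
        have "\<xi> (u \<otimes>\<^bsub>U_alg P\<^esub> v) = pairing (free_mult (\<lambda>w. \<Sum>i\<in>A. ?x i w) (\<lambda>w. \<Sum>i\<in>B. ?y i w)) \<Phi>"
          unfolding uv using u v unfolding ua vc
          by (intro \<xi> carrier_mult X Y P.ZG_mult)
        also have "\<dots> = (\<Sum>i\<in>A. \<Sum>j\<in>B. pairing (free_mult (?x i) (?y j)) \<Phi>)"
          unfolding pairing_mult[OF fin_supp_carrier[OF X] fin_supp_carrier[OF Y]] sumX sumY pairing_sum_right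
          by (intro sum.cong refl pairing_mult[symmetric] fin_supp_carrier[OF x] fin_supp_carrier[OF y])
        also have "\<dots> = (\<Sum>i\<in>A. \<Sum>j\<in>B. pairing (?x i) \<Phi> * pairing (?y j) \<Phi>)"
          using A B by (intro sum.cong refl) (simp add: prod emb)
        also have "\<dots> = pairing (\<lambda>w. \<Sum>i\<in>A. ?x i w) \<Phi> * pairing (\<lambda>w. \<Sum>i\<in>B. ?y i w) \<Phi>"
          unfolding sumX sumY by (rule sum_product[symmetric])
        also have "\<dots> = \<xi> u * \<xi> v"
          using \<xi>[OF X] \<xi>[OF Y] u v unfolding ua vc by simp
        finally show ?thesis .
      qed
    qed
  qed
  moreover have "\<xi> (U_map P emb1 u \<otimes>\<^bsub>U_alg P\<^esub> U_map P emb2 v) = chi u * chi' v"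
    if u: "u \<in> ZG G" and v: "v \<in> ZG H" for u v
  proof -
    obtain p where p: "p \<in> carrier G.FA" "u = U_class G p" using u by (rule G.ZG_cases)
    obtain q where q: "q \<in> carrier H.FA" "v = U_class H q" using v by (rule H.ZG_cases)
    show ?thesis
      using p q u v by (simp add: U_map_emb_mult \<xi> emb_mult_in ZG_emb_mult emb)
  qed
  ultimately show ?thesis unfolding extends_pair_def by blast
qed

lemma product_character_extends: "extends_pair (product_character G H chi chi')"
proof -
  have "product_character G H chi chi' = (THE \<xi>. extends_pair \<xi>)"
    unfolding product_character_def extends_pair_def ..
  moreover have "extends_pair (THE \<xi>. extends_pair \<xi>)"
    using extends_pair_exists extends_pair_unique by (metis theI')
  ultimately show ?thesis by simp
qed

end

end


section \<open>Smooth functions\<close>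

lemma frechet_derivative_cong_open:
  assumes "open S" "x \<in> S" "\<And>y. y \<in> S \<Longrightarrow> f y = g y"
  shows "frechet_derivative f (at x) = frechet_derivative g (at x)"
proof -
  have "(f has_derivative D) (at x) \<longleftrightarrow> (g has_derivative D) (at x)" for D
    using has_derivative_transform_within_open[of f D x UNIV S g]
      has_derivative_transform_within_open[of g D x UNIV S f] assms by auto
  then show ?thesis by (simp add: frechet_derivative_def)
qed

lemma Ck_on_SucD1:
  assumes "Ck_on (Suc k) f S" "open S" "x \<in> S"
  shows "(f has_derivative frechet_derivative f (at x)) (at x)"
  using assms by (simp add: differentiable_on_eq_differentiable_at frechet_derivative_works[symmetric])

lemma Ck_on_cong:
  assumes "open S" "\<And>y. y \<in> S \<Longrightarrow> f y = g y"
  shows "Ck_on k f S \<longleftrightarrow> Ck_on k g S"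
  using assms(2)
proof (induction k arbitrary: f g)
  case 0
  then show ?case by (simp cong: continuous_on_cong)
next
  case (Suc k)
  have "f differentiable_on S \<longleftrightarrow> g differentiable_on S"
    unfolding differentiable_on_def differentiable_def
    using Suc.prems by (metis (no_types, lifting) has_derivative_transform)
  moreover have "Ck_on k (\<lambda>x. frechet_derivative f (at x) v) S \<longleftrightarrow>
      Ck_on k (\<lambda>x. frechet_derivative g (at x) v) S" for v
    by (rule Suc.IH) (simp add: frechet_derivative_cong_open[OF assms(1) _ Suc.prems])
  ultimately show ?case by simp
qed

text \<open>\<open>frechet_derivative\<close> is a choice, and only meaningful where a derivative
  exists. On open sets uniqueness of derivatives allows any explicit derivative to be used instead,
  also inside the recursion of \<open>Ck_on\<close>.\<close>

lemma Ck_on_SucI: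
  assumes "open S" "\<And>x. x \<in> S \<Longrightarrow> (f has_derivative f' x) (at x)" "\<And>v. Ck_on k (\<lambda>x. f' x v) S"
  shows "Ck_on (Suc k) f S"
proof -
  have "f differentiable_on S"
    unfolding differentiable_on_eq_differentiable_at[OF assms(1)] differentiable_def using assms(2) by blast
  moreover have "Ck_on k (\<lambda>x. frechet_derivative f (at x) v) S" for v
  proof -
    have "frechet_derivative f (at x) v = f' x v" if "x \<in> S" for x
      using frechet_derivative_at[OF assms(2)[OF that]] by simp
    then show ?thesis
      using Ck_on_cong[OF assms(1), of "\<lambda>x. frechet_derivative f (at x) v" "\<lambda>x. f' x v" k] assms(3)[of v]
      by simp
  qed
  ultimately show ?thesis by simp
qed

lemma Ck_on_SucD: "Ck_on (Suc k) f S \<Longrightarrow> Ck_on k f S"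
proof (induction k arbitrary: f)
  case 0
  then show ?case by (simp add: differentiable_imp_continuous_on)
next
  case (Suc k)
  then have "f differentiable_on S" "\<And>v. Ck_on (Suc k) (\<lambda>x. frechet_derivative f (at x) v) S"
    by simp_all
  then show ?case using Suc.IH by simp
qed

lemma Ck_on_subset:
  assumes "Ck_on k f S" "T \<subseteq> S"
  shows "Ck_on k f T"
  using assms(1)
  by (induction k arbitrary: f) (auto intro: continuous_on_subset[OF _ assms(2)] differentiable_on_subset[OF _ assms(2)])

lemma Ck_on_const: "open S \<Longrightarrow> Ck_on k (\<lambda>x. c) S"
proof (induction k arbitrary: c)
  case (Suc k)
  then show ?case by (intro Ck_on_SucI[where f' = "\<lambda>x v. 0"]) auto
qed simp

lemma Ck_on_linear: "open S \<Longrightarrow> bounded_linear L \<Longrightarrow> Ck_on k L S"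
proof (cases k)
  case (Suc m)
  assume "open S" "bounded_linear L"
  then show ?thesis
    unfolding Suc by (intro Ck_on_SucI[where f' = "\<lambda>x. L"] Ck_on_const bounded_linear_imp_has_derivative)
qed (simp add: linear_continuous_on)

lemma Ck_on_add:
  assumes "open S"
  shows "Ck_on k f S \<Longrightarrow> Ck_on k g S \<Longrightarrow> Ck_on k (\<lambda>x. f x + g x) S"
proof (induction k arbitrary: f g)
  case (Suc k)
  show ?case
  proof (rule Ck_on_SucI[OF assms])
    fix x assume "x \<in> S"
    then show "((\<lambda>x. f x + g x) has_derivative
        (\<lambda>v. frechet_derivative f (at x) v + frechet_derivative g (at x) v)) (at x)"
      using Suc.prems assms by (intro has_derivative_add Ck_on_SucD1)
  next
    show "Ck_on k (\<lambda>x. frechet_derivative f (at x) v + frechet_derivative g (at x) v) S" for v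
      using Suc by simp
  qed
qed (simp add: continuous_on_add)

lemma Ck_on_mult:
  assumes "open S"
  shows "Ck_on k f S \<Longrightarrow> Ck_on k g S \<Longrightarrow> Ck_on k (\<lambda>x. f x * g x) S"
proof (induction k arbitrary: f g)
  case (Suc k)
  show ?case
  proof (rule Ck_on_SucI[OF assms])
    fix x assume "x \<in> S"
    then show "((\<lambda>x. f x * g x) has_derivative
        (\<lambda>v. f x * frechet_derivative g (at x) v + frechet_derivative f (at x) v * g x)) (at x)"
      using Suc.prems assms by (intro has_derivative_mult Ck_on_SucD1)
  next
    show "Ck_on k (\<lambda>x. f x * frechet_derivative g (at x) v + frechet_derivative f (at x) v * g x) S" for v
      using Suc Ck_on_SucD[OF Suc.prems(1)] Ck_on_SucD[OF Suc.prems(2)]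
      by (intro Ck_on_add[OF assms] Suc.IH) auto
  qed
qed (simp add: continuous_on_mult)

lemma Ck_on_sum:
  assumes "open S" "\<And>i. i \<in> A \<Longrightarrow> Ck_on k (f i) S"
  shows "Ck_on k (\<lambda>x. \<Sum>i\<in>A. f i x) S"
  using assms(2)
  by (induction A rule: infinite_finite_induct) (simp_all add: Ck_on_const Ck_on_add assms(1))

lemma Ck_on_prod:
  assumes "open S" "\<And>i. i \<in> A \<Longrightarrow> Ck_on k (f i) S"
  shows "Ck_on k (\<lambda>x. \<Prod>i\<in>A. f i x) S"
  using assms(2)
  by (induction A rule: infinite_finite_induct) (simp_all add: Ck_on_const Ck_on_mult assms(1))

lemma Ck_on_inverse:
  assumes "open S" "\<And>x. x \<in> S \<Longrightarrow> f x \<noteq> 0"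
  shows "Ck_on k f S \<Longrightarrow> Ck_on k (\<lambda>x. inverse (f x)) S"
proof (induction k)
  case 0
  then show ?case using assms(2) by (simp add: continuous_on_inverse)
next
  case (Suc k)
  have inv: "Ck_on k (\<lambda>x. inverse (f x)) S" by (rule Suc.IH[OF Ck_on_SucD[OF Suc.prems]])
  show ?case
  proof (rule Ck_on_SucI[OF assms(1)])
    fix x assume "x \<in> S"
    then show "((\<lambda>x. inverse (f x)) has_derivative
        (\<lambda>v. - 1 * (inverse (f x) * frechet_derivative f (at x) v * inverse (f x)))) (at x)"
      using Deriv.has_derivative_inverse[OF assms(2) Ck_on_SucD1[OF Suc.prems assms(1)]] by simp
  next
    show "Ck_on k (\<lambda>x. - 1 * (inverse (f x) * frechet_derivative f (at x) v * inverse (f x))) S" for v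
      using Suc.prems inv by (intro Ck_on_mult Ck_on_const assms(1)) auto
  qed
qed

definition smooth_on :: "'a::euclidean_space set \<Rightarrow> ('a \<Rightarrow> complex) \<Rightarrow> bool"
  where "smooth_on S f \<longleftrightarrow> (\<forall>k. Ck_on k f S)"

lemma smooth_on_has_derivative:
  "smooth_on S f \<Longrightarrow> open S \<Longrightarrow> x \<in> S \<Longrightarrow> (f has_derivative frechet_derivative f (at x)) (at x)"
  unfolding smooth_on_def by (blast intro: Ck_on_SucD1)

lemma smooth_on_frechet: "smooth_on S f \<Longrightarrow> smooth_on S (\<lambda>x. frechet_derivative f (at x) v)"
  unfolding smooth_on_def by (metis Ck_on.simps(2))

lemma smooth_on_continuous: "smooth_on S f \<Longrightarrow> continuous_on S f"
  unfolding smooth_on_def by (metis Ck_on.simps(1))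

text \<open>By the chain rule a directional derivative of the composite is a sum over coordinates of
  smooth factors times partial derivatives of \<open>h\<close> composed with \<phi>. These are
  composites of the same kind, so the induction runs over all \<open>h\<close> at once. Coordinates
  are viewed as complex functions because \<open>Ck_on\<close> speaks of those only.\<close>

lemma smooth_on_compose:
  fixes \<phi> :: "'b::euclidean_space \<Rightarrow> 'a::euclidean_space"
  assumes S: "open S" and T: "open T" and sub: "\<phi> ` S \<subseteq> T"
    and \<phi>: "\<And>b. b \<in> Basis \<Longrightarrow> smooth_on S (\<lambda>x. of_real (\<phi> x \<bullet> b))"
    and h: "smooth_on T h"
  shows "smooth_on S (\<lambda>x. h (\<phi> x))"
proof -
  define d where "d b x v = frechet_derivative (\<lambda>x. of_real (\<phi> x \<bullet> b) :: complex) (at x) v" for b x v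
  have d: "((\<lambda>x. of_real (\<phi> x \<bullet> b) :: complex) has_derivative d b x) (at x)" if "b \<in> Basis" "x \<in> S" for b x
    unfolding d_def using smooth_on_has_derivative[OF \<phi>[OF that(1)] S that(2)] by simp
  have Re_d: "((\<lambda>x. \<phi> x \<bullet> b) has_derivative (\<lambda>v. Re (d b x v))) (at x)" if "b \<in> Basis" "x \<in> S" for b x
    using has_derivative_Re[OF d[OF that]] by simp
  \<comment> \<open>The derivative of a real-valued function takes real values, so nothing is lost
    in passing to real parts to obtain the derivative of \<phi> itself.\<close>
  have of_real_Re_d: "of_real (Re (d b x v)) = d b x v" if "b \<in> Basis" "x \<in> S" for b x v
    using has_derivative_unique[OF d[OF that] has_derivative_of_real[OF Re_d[OF that]]] by metis
  define \<phi>' where "\<phi>' x v = (\<Sum>b\<in>Basis. Re (d b x v) *\<^sub>R b)" for x v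
  have \<phi>': "(\<phi> has_derivative \<phi>' x) (at x)" if "x \<in> S" for x
    unfolding has_derivative_componentwise_within[of \<phi> _ x UNIV]
    using Re_d[OF _ that] by (simp add: \<phi>'_def inner_sum_left inner_Basis if_distrib cong: if_cong)
  have cont: "continuous_on S \<phi>"
    by (intro differentiable_imp_continuous_on)
      (auto simp: differentiable_on_eq_differentiable_at[OF S] differentiable_def intro: \<phi>')
  have "Ck_on k (\<lambda>x. h (\<phi> x)) S" if "smooth_on T h" for k h
    using that
  proof (induction k arbitrary: h)
    case 0
    show ?case
      using continuous_on_compose2[OF smooth_on_continuous[OF 0] cont sub] by simp
  next
    case (Suc k)
    show ?case
    proof (rule Ck_on_SucI[OF S])
      fix x assume x: "x \<in> S"
      let ?D = "frechet_derivative h (at (\<phi> x))"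
      have D: "(h has_derivative ?D) (at (\<phi> x))"
        using smooth_on_has_derivative[OF Suc.prems T] x sub by blast
      have "((\<lambda>x. h (\<phi> x)) has_derivative (\<lambda>v. ?D (\<phi>' x v))) (at x)"
        using has_derivative_compose[OF \<phi>'[OF x] D] .
      moreover have "?D (\<phi>' x v) = (\<Sum>b\<in>Basis. d b x v * ?D b)" for v
      proof -
        interpret D: bounded_linear ?D by (rule has_derivative_bounded_linear[OF D])
        show ?thesis
          unfolding \<phi>'_def D.sum D.scaleR using of_real_Re_d[OF _ x]
          by (intro sum.cong) (simp_all add: scaleR_conv_of_real)
      qed
      ultimately show "((\<lambda>x. h (\<phi> x)) has_derivative (\<lambda>v. \<Sum>b\<in>Basis. d b x v * ?D b)) (at x)"
        by simp
    next
      fix v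
      have "Ck_on k (\<lambda>x. d b x v) S" if "b \<in> Basis" for b
        using smooth_on_frechet[OF \<phi>[OF that], of v] by (simp add: smooth_on_def d_def)
      then show "Ck_on k (\<lambda>x. \<Sum>b\<in>Basis. d b x v * frechet_derivative h (at (\<phi> x)) b) S"
        by (intro Ck_on_sum[OF S] Ck_on_mult[OF S] Suc.IH[OF smooth_on_frechet[OF Suc.prems]]) auto
    qed
  qed
  then show ?thesis using h by (simp add: smooth_on_def)
qed

section \<open>Symmetry of second derivatives\<close>

lemma mixed_difference_mean_value:
  fixes f :: "'a::real_normed_vector \<Rightarrow> real"
  assumes ball: "ball x r \<subseteq> S" and h: "0 < h" "h * (norm u + norm v) < r"
    and f: "\<And>y. y \<in> S \<Longrightarrow> (f has_derivative f' y) (at y)"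
    and fu: "\<And>y. y \<in> S \<Longrightarrow> ((\<lambda>y. f' y u) has_derivative fu y) (at y)"
  obtains y where "dist y x \<le> h * (norm u + norm v)"
    "f (x + h *\<^sub>R u + h *\<^sub>R v) - f (x + h *\<^sub>R u) - f (x + h *\<^sub>R v) + f x = h * h * fu y v"
proof -
  have near: "dist (x + s *\<^sub>R u + t *\<^sub>R v) x \<le> h * (norm u + norm v)"
    if "0 \<le> s" "s \<le> h" "0 \<le> t" "t \<le> h" for s t
  proof -
    have "dist (x + s *\<^sub>R u + t *\<^sub>R v) x = norm (s *\<^sub>R u + t *\<^sub>R v)"
      by (simp add: dist_norm)
    also have "\<dots> \<le> s * norm u + t * norm v"
      using that norm_triangle_ineq[of "s *\<^sub>R u" "t *\<^sub>R v"] by simp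
    also have "\<dots> \<le> h * norm u + h * norm v"
      using that by (intro add_mono mult_right_mono) auto
    finally show ?thesis by (simp add: distrib_left)
  qed
  have in_S: "x + s *\<^sub>R u + t *\<^sub>R v \<in> S" if "0 \<le> s" "s \<le> h" "0 \<le> t" "t \<le> h" for s t
    using near[OF that] h ball by (auto simp: dist_commute)
  have lin: "bounded_linear (f' y)" "bounded_linear (fu y)" if "y \<in> S" for y
    using f[OF that] fu[OF that] by (auto intro: has_derivative_bounded_linear)
  \<comment> \<open>The mixed second difference is the increment over \<open>[0, h]\<close> of this
    first difference in the direction \<open>v\<close>. The mean value theorem is applied to it
    along \<open>u\<close>, and then to the resulting difference of first derivatives along
    \<open>v\<close>.\<close>
  let ?p = "\<lambda>s. f (x + s *\<^sub>R u + h *\<^sub>R v) - f (x + s *\<^sub>R u + 0 *\<^sub>R v)"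
  have p: "(?p has_real_derivative f' (x + s *\<^sub>R u + h *\<^sub>R v) u - f' (x + s *\<^sub>R u + 0 *\<^sub>R v) u) (at s)"
    if "0 \<le> s" "s \<le> h" for s
  proof -
    have "((\<lambda>s. f (x + s *\<^sub>R u + t *\<^sub>R v)) has_real_derivative f' (x + s *\<^sub>R u + t *\<^sub>R v) u) (at s)"
      if t: "0 \<le> t" "t \<le> h" for t
    proof -
      have y: "x + s *\<^sub>R u + t *\<^sub>R v \<in> S" using in_S t \<open>0 \<le> s\<close> \<open>s \<le> h\<close> by simp
      have "((\<lambda>s. x + s *\<^sub>R u + t *\<^sub>R v) has_derivative (\<lambda>s. s *\<^sub>R u)) (at s)"
        by (auto intro!: derivative_eq_intros)
      from has_derivative_compose[OF this f[OF y]]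
      have "((\<lambda>s. f (x + s *\<^sub>R u + t *\<^sub>R v)) has_derivative (\<lambda>r. f' (x + s *\<^sub>R u + t *\<^sub>R v) (r *\<^sub>R u))) (at s)" .
      then show ?thesis
        using linear_scale[OF bounded_linear.linear[OF lin(1)[OF y]]]
        by (simp add: has_field_derivative_def mult_commute_abs)
    qed
    from DERIV_diff[OF this[of h] this[of 0]] show ?thesis using h by simp
  qed
  obtain s where s: "0 < s" "s < h"
    "?p h - ?p 0 = (h - 0) * (f' (x + s *\<^sub>R u + h *\<^sub>R v) u - f' (x + s *\<^sub>R u + 0 *\<^sub>R v) u)"
    using MVT2[OF h(1) p] by blast
  let ?q = "\<lambda>t. f' (x + s *\<^sub>R u + t *\<^sub>R v) u"
  have q: "(?q has_real_derivative fu (x + s *\<^sub>R u + t *\<^sub>R v) v) (at t)" if t: "0 \<le> t" "t \<le> h" for t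
  proof -
    have y: "x + s *\<^sub>R u + t *\<^sub>R v \<in> S" using in_S t s by simp
    have "((\<lambda>t. x + s *\<^sub>R u + t *\<^sub>R v) has_derivative (\<lambda>t. t *\<^sub>R v)) (at t)"
      by (auto intro!: derivative_eq_intros)
    from has_derivative_compose[OF this fu[OF y]]
    have "(?q has_derivative (\<lambda>r. fu (x + s *\<^sub>R u + t *\<^sub>R v) (r *\<^sub>R v))) (at t)" .
    then show ?thesis
      using linear_scale[OF bounded_linear.linear[OF lin(2)[OF y]]]
      by (simp add: has_field_derivative_def mult_commute_abs)
  qed
  obtain t where t: "0 < t" "t < h" "?q h - ?q 0 = (h - 0) * fu (x + s *\<^sub>R u + t *\<^sub>R v) v"
    using MVT2[OF h(1) q] by blast
  show thesis
  proof (rule that)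
    show "dist (x + s *\<^sub>R u + t *\<^sub>R v) x \<le> h * (norm u + norm v)"
      using near s t by simp
    show "f (x + h *\<^sub>R u + h *\<^sub>R v) - f (x + h *\<^sub>R u) - f (x + h *\<^sub>R v) + f x =
        h * h * fu (x + s *\<^sub>R u + t *\<^sub>R v) v"
      using s(3) t(3) by simp
  qed
qed

text \<open>The mixed second difference does not change when \<open>u\<close> and \<open>v\<close>
  are exchanged. By the mean value lemma it equals \<open>h * h\<close> times either mixed
  derivative at points near \<open>x\<close>, so by continuity the two derivatives at
  \<open>x\<close> cannot be a fixed distance apart.\<close>

lemma second_derivative_symmetric_real:
  fixes f :: "'a::real_normed_vector \<Rightarrow> real"
  assumes S: "open S" "x \<in> S"
    and f: "\<And>y. y \<in> S \<Longrightarrow> (f has_derivative f' y) (at y)"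
    and fu: "\<And>y. y \<in> S \<Longrightarrow> ((\<lambda>y. f' y u) has_derivative fu y) (at y)"
    and fv: "\<And>y. y \<in> S \<Longrightarrow> ((\<lambda>y. f' y v) has_derivative fv y) (at y)"
    and cont: "isCont (\<lambda>y. fu y v) x" "isCont (\<lambda>y. fv y u) x"
  shows "fu x v = fv x u"
proof (rule ccontr)
  assume "fu x v \<noteq> fv x u"
  define e where "e = \<bar>fu x v - fv x u\<bar> / 2"
  have e: "e > 0" using \<open>fu x v \<noteq> fv x u\<close> by (simp add: e_def)
  obtain r where r: "r > 0" "ball x r \<subseteq> S" using S by (meson openE)
  obtain d1 where d1: "d1 > 0" "\<And>y. dist y x < d1 \<Longrightarrow> dist (fu y v) (fu x v) < e"
    using cont(1) e unfolding continuous_at_eps_delta by blast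
  obtain d2 where d2: "d2 > 0" "\<And>y. dist y x < d2 \<Longrightarrow> dist (fv y u) (fv x u) < e"
    using cont(2) e unfolding continuous_at_eps_delta by blast
  define N where "N = norm u + norm v + 1"
  \<comment> \<open>The summand 1 in \<open>N\<close> avoids dividing by zero when both directions
    vanish; the factor 2 keeps the estimated distance strictly below all three radii.\<close>
  define h where "h = min r (min d1 d2) / (2 * N)"
  have N: "N > 0" "norm u + norm v < N" by (simp_all add: N_def add_nonneg_pos)
  have h: "h > 0" using r d1 d2 N by (simp add: h_def)
  have "h * (norm u + norm v) \<le> h * N" using N h by (intro mult_left_mono) auto
  also have "h * N = min r (min d1 d2) / 2" using N by (simp add: h_def)
  also have "\<dots> < min r (min d1 d2)"
  proof -
    have "min r (min d1 d2) > 0" using r d1 d2 by simp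
    then show ?thesis by linarith
  qed
  finally have hN: "h * (norm u + norm v) < min r (min d1 d2)" .
  then have hNr: "h * (norm u + norm v) < r" by simp
  obtain y where y: "dist y x \<le> h * (norm u + norm v)"
    "f (x + h *\<^sub>R u + h *\<^sub>R v) - f (x + h *\<^sub>R u) - f (x + h *\<^sub>R v) + f x = h * h * fu y v"
    by (rule mixed_difference_mean_value[where u = u and v = v, OF r(2) h hNr f fu])
  obtain z where z: "dist z x \<le> h * (norm v + norm u)"
    "f (x + h *\<^sub>R v + h *\<^sub>R u) - f (x + h *\<^sub>R v) - f (x + h *\<^sub>R u) + f x = h * h * fv z u"
    by (rule mixed_difference_mean_value[where u = v and v = u, OF r(2) h hNr[unfolded add.commute[of "norm u"]] f fv])
  have "h * h * fu y v = h * h * fv z u"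
    using y(2) z(2) by (simp add: add.commute add.left_commute algebra_simps)
  then have "fu y v = fv z u" using h by simp
  moreover have "dist (fu y v) (fu x v) < e" using d1(2) y(1) hN by simp
  moreover have "dist (fv z u) (fv x u) < e" using d2(2) z(1) hN by (simp add: add.commute)
  ultimately show False
    unfolding e_def dist_real_def by (simp add: abs_if split: if_splits)
qed

lemma smooth_on_second_derivative_symmetric:
  assumes S: "open S" "x \<in> S" and f: "smooth_on S f"
  shows "frechet_derivative (\<lambda>y. frechet_derivative f (at y) u) (at x) v =
    frechet_derivative (\<lambda>y. frechet_derivative f (at y) v) (at x) u"
proof -
  let ?D = "\<lambda>y. frechet_derivative f (at y)"
  let ?D2 = "\<lambda>u y. frechet_derivative (\<lambda>y. ?D y u) (at y)"
  have D: "(f has_derivative ?D y) (at y)" if "y \<in> S" for y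
    by (rule smooth_on_has_derivative[OF f S(1) that])
  have D2: "((\<lambda>y. ?D y u) has_derivative ?D2 u y) (at y)" if "y \<in> S" for y u
    by (rule smooth_on_has_derivative[OF smooth_on_frechet[OF f] S(1) that])
  have cont: "isCont (\<lambda>y. ?D2 u y v) x" for u v
    using smooth_on_continuous[OF smooth_on_frechet[OF smooth_on_frechet[OF f]]] S
    by (simp add: continuous_on_eq_continuous_at)
  have "Re (?D2 u x v) = Re (?D2 v x u)"
    by (rule second_derivative_symmetric_real[OF S has_derivative_Re[OF D]
          has_derivative_Re[OF D2] has_derivative_Re[OF D2]]) (assumption | intro continuous_Re cont)+
  moreover have "Im (?D2 u x v) = Im (?D2 v x u)"
    by (rule second_derivative_symmetric_real[OF S has_derivative_Im[OF D]
          has_derivative_Im[OF D2] has_derivative_Im[OF D2]]) (assumption | intro continuous_Im cont)+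
  ultimately show ?thesis by (rule complex_eqI)
qed


section \<open>Exponential and Lie algebra of a closed linear group\<close>

lemma norm_power_diff_le:
  fixes a b :: "'a::real_normed_algebra_1"
  assumes "norm a \<le> M" "norm b \<le> M"
  shows "norm (a ^ Suc n - b ^ Suc n) \<le> real (Suc n) * M ^ n * norm (a - b)"
proof (induction n)
  case (Suc n)
  have M: "0 \<le> M" using norm_ge_zero assms(1) by (rule order_trans)
  have "norm (a ^ Suc n) \<le> M ^ Suc n"
    using norm_power_ineq[of a "Suc n"] power_mono[OF assms(1), of "Suc n"] by simp
  then have 1: "norm (a ^ Suc n * (a - b)) \<le> M ^ Suc n * norm (a - b)"
    by (intro order_trans[OF norm_mult_ineq] mult_right_mono) auto
  have 2: "norm ((a ^ Suc n - b ^ Suc n) * b) \<le> real (Suc n) * M ^ n * norm (a - b) * M"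
    using Suc.IH assms(2) M by (intro order_trans[OF norm_mult_ineq] mult_mono) auto
  have "a ^ Suc (Suc n) - b ^ Suc (Suc n) = a ^ Suc n * (a - b) + (a ^ Suc n - b ^ Suc n) * b"
    by (simp add: algebra_simps power_Suc2 del: power_Suc)
  then have "norm (a ^ Suc (Suc n) - b ^ Suc (Suc n)) \<le>
      M ^ Suc n * norm (a - b) + real (Suc n) * M ^ n * norm (a - b) * M"
    using norm_triangle_mono[OF 1 2] by simp
  then show ?case by (simp add: algebra_simps)
qed simp

lemma exp_scaled_power:
  fixes X :: "'a::{real_normed_algebra_1,banach}"
  shows "exp (r *\<^sub>R X) ^ n = exp ((real n * r) *\<^sub>R X)"
proof (induction n)
  case (Suc n)
  have "exp (r *\<^sub>R X) * exp ((real n * r) *\<^sub>R X) = exp (r *\<^sub>R X + (real n * r) *\<^sub>R X)"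
    by (rule exp_add_commuting[symmetric]) simp
  then show ?case by (simp add: Suc algebra_simps)
qed simp

text \<open>The curves \<open>?A\<close> and \<open>?B\<close> agree to first order at 0, so at
  \<open>?r n\<close> they differ by o(1/n). Telescoping the powers costs a factor
  \<open>Suc n\<close> times norms that stay bounded by \<open>exp ?N\<close>, and the total error
  still tends to 0.\<close>

lemma lie_trotter:
  fixes X Y :: "'a::{real_normed_algebra_1,banach}"
  shows "(\<lambda>n. (exp (inverse (real (Suc n)) *\<^sub>R X) * exp (inverse (real (Suc n)) *\<^sub>R Y)) ^ Suc n)
    \<longlonglongrightarrow> exp (X + Y)"
proof -
  let ?r = "\<lambda>n. inverse (real (Suc n))"
  let ?A = "\<lambda>t. exp (t *\<^sub>R X) * exp (t *\<^sub>R Y)" and ?B = "\<lambda>t. exp (t *\<^sub>R (X + Y))"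
  let ?N = "norm X + norm Y"
  have "((\<lambda>t. ?A t - ?B t) has_vector_derivative
      exp (0 *\<^sub>R X) * (exp (0 *\<^sub>R Y) * Y) + (exp (0 *\<^sub>R X) * X) * exp (0 *\<^sub>R Y) -
        exp (0 *\<^sub>R (X + Y)) * (X + Y)) (at 0)"
    by (intro has_vector_derivative_diff has_vector_derivative_mult exp_scaleR_has_vector_derivative_right)
  then have "((\<lambda>t. ?A t - ?B t) has_vector_derivative 0) (at 0)" by (simp add: add.commute)
  then have "((\<lambda>t. norm (?A t - ?B t) / norm t) \<longlongrightarrow> 0) (at 0)"
    by (simp add: has_vector_derivative_def has_derivative_at)
  \<comment> \<open>Using \<open>Suc n\<close> keeps the parameter nonzero, as a limit along the
    punctured filter \<open>at 0\<close> requires.\<close>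
  moreover have "filterlim ?r (at 0) sequentially"
    unfolding filterlim_at using LIMSEQ_inverse_real_of_nat by simp
  ultimately have "(\<lambda>n. norm (?A (?r n) - ?B (?r n)) / norm (?r n)) \<longlonglongrightarrow> 0"
    by (rule filterlim_compose)
  then have lim: "(\<lambda>n. exp ?N * (norm (?A (?r n) - ?B (?r n)) / norm (?r n))) \<longlonglongrightarrow> 0"
    using tendsto_mult_right_zero by blast
  have bound: "norm (?A (?r n) ^ Suc n - exp (X + Y)) \<le>
      exp ?N * (norm (?A (?r n) - ?B (?r n)) / norm (?r n))" for n
  proof -
    let ?M = "exp (?r n * ?N)"
    have "norm (?A (?r n)) \<le> norm (exp (?r n *\<^sub>R X)) * norm (exp (?r n *\<^sub>R Y))"
      by (rule norm_mult_ineq)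
    also have "\<dots> \<le> exp (?r n * norm X) * exp (?r n * norm Y)"
      using norm_exp[of "?r n *\<^sub>R X"] norm_exp[of "?r n *\<^sub>R Y"] by (intro mult_mono) auto
    also have "\<dots> = ?M" by (simp add: exp_add[symmetric] distrib_left)
    finally have A: "norm (?A (?r n)) \<le> ?M" .
    have "norm (?B (?r n)) \<le> exp (norm (?r n *\<^sub>R (X + Y)))" by (rule norm_exp)
    also have "norm (?r n *\<^sub>R (X + Y)) \<le> ?r n * ?N"
      using norm_triangle_ineq[of X Y] by (simp add: mult_left_mono)
    finally have B: "norm (?B (?r n)) \<le> ?M" by simp
    have "?M ^ n = exp (real n * (?r n * ?N))" by (rule exp_of_nat_mult[symmetric])
    also have "real n * (?r n * ?N) \<le> ?N"
    proof -
      have "real n * ?r n \<le> 1" by (simp add: field_simps)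
      then have "real n * ?r n * ?N \<le> 1 * ?N" by (intro mult_right_mono) auto
      then show ?thesis by (simp add: mult.assoc)
    qed
    finally have M: "?M ^ n \<le> exp ?N" by simp
    have "norm (?A (?r n) ^ Suc n - ?B (?r n) ^ Suc n) \<le> real (Suc n) * ?M ^ n * norm (?A (?r n) - ?B (?r n))"
      by (rule norm_power_diff_le[OF A B])
    also have "\<dots> \<le> real (Suc n) * exp ?N * norm (?A (?r n) - ?B (?r n))"
      using M by (intro mult_right_mono mult_left_mono) auto
    also have "\<dots> = exp ?N * (norm (?A (?r n) - ?B (?r n)) / norm (?r n))"
      by (simp add: field_simps)
    also have "?B (?r n) ^ Suc n = exp (X + Y)"
      using exp_scaled_power[of "?r n" "X + Y" "Suc n"] by simp
    finally show ?thesis .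
  qed
  have "(\<lambda>n. ?A (?r n) ^ Suc n - exp (X + Y)) \<longlonglongrightarrow> 0"
    by (rule Lim_null_comparison[OF always_eventually lim]) (use bound in blast)
  then show ?thesis by (rule LIM_zero_cancel)
qed

text \<open>The exponential series is available for normed algebras; the left regular representation
  embeds the ambient algebra of a group record into the following one.\<close>

typedef (overloaded) 'a endo = "UNIV :: ('a::euclidean_space \<Rightarrow>\<^sub>L 'a) set"
  morphisms blinfun_of_endo Endo ..

lemma Endo_simps [simp]: "blinfun_of_endo (Endo f) = f" "Endo (blinfun_of_endo a) = a"
  by (simp_all add: Endo_inverse blinfun_of_endo_inverse)

lemma endo_eq_iff: "a = b \<longleftrightarrow> blinfun_of_endo a = blinfun_of_endo b"
  by (simp add: blinfun_of_endo_inject)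

instantiation endo :: (euclidean_space) real_normed_algebra_1
begin

definition "0 = Endo 0"
definition "1 = Endo id_blinfun"
definition "a + b = Endo (blinfun_of_endo a + blinfun_of_endo b)"
definition "a - b = Endo (blinfun_of_endo a - blinfun_of_endo b)"
definition "- a = Endo (- blinfun_of_endo a)"
definition "a * b = Endo (blinfun_of_endo a o\<^sub>L blinfun_of_endo b)"
definition "r *\<^sub>R a = Endo (r *\<^sub>R blinfun_of_endo a)"
definition "norm a = norm (blinfun_of_endo a)"
definition "dist a b = norm (a - b)" for a b :: "'a endo"
definition "sgn a = inverse (norm a) *\<^sub>R a" for a :: "'a endo"
definition [code del]:
  "(uniformity :: ('a endo \<times> 'a endo) filter) = (INF e\<in>{0 <..}. principal {(x, y). dist x y < e})"
definition [code del]: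
  "open (S :: 'a endo set) \<longleftrightarrow> (\<forall>x\<in>S. \<forall>\<^sub>F (x', y) in uniformity. x' = x \<longrightarrow> y \<in> S)"

lemmas endo_defs = zero_endo_def one_endo_def plus_endo_def minus_endo_def uminus_endo_def
  times_endo_def scaleR_endo_def norm_endo_def

instance
proof
  show "(0::'a endo) \<noteq> 1"
  proof
    assume "(0::'a endo) = 1"
    then have "norm (id_blinfun :: 'a \<Rightarrow>\<^sub>L 'a) = norm (0 :: 'a \<Rightarrow>\<^sub>L 'a)"
      by (simp only: endo_eq_iff endo_defs Endo_simps)
    then show False using norm_blinfun_id[where 'a = 'a] by simp
  qed
qed (auto simp: endo_eq_iff endo_defs dist_endo_def sgn_endo_def uniformity_endo_def open_endo_def
    algebra_simps norm_triangle_ineq norm_blinfun_compose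
    blinfun.bilinear_simps intro!: blinfun_eqI)

end

lemma bounded_linear_blinfun_of_endo: "bounded_linear blinfun_of_endo"
  by (rule bounded_linear_intro[where K = 1]) (auto simp: endo_defs)

lemma bounded_linear_Endo: "bounded_linear Endo"
  by (rule bounded_linear_intro[where K = 1]) (auto simp: endo_defs)

instance endo :: (euclidean_space) banach
proof
  fix X :: "nat \<Rightarrow> 'a endo" assume "Cauchy X"
  then have "Cauchy (\<lambda>n. blinfun_of_endo (X n))"
    by (rule bounded_linear.Cauchy[OF bounded_linear_blinfun_of_endo])
  then obtain l where "(\<lambda>n. blinfun_of_endo (X n)) \<longlonglongrightarrow> l"
    using Cauchy_convergent_iff convergent_def by blast
  from bounded_linear.tendsto[OF bounded_linear_Endo this] show "convergent X"
    by (auto simp: convergent_def)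
qed

lemma has_vector_derivative_quotient:
  assumes "(f has_vector_derivative D) (at 0)"
  shows "((\<lambda>s. (f s - f 0) /\<^sub>R s) \<longlongrightarrow> D) (at 0)"
proof -
  have lim: "((\<lambda>s. norm (f s - f 0 - s *\<^sub>R D) / norm s) \<longlongrightarrow> 0) (at 0)"
    using assms by (simp add: has_vector_derivative_def has_derivative_at)
  have "((\<lambda>s. norm ((f s - f 0) /\<^sub>R s - D)) \<longlongrightarrow> 0) (at 0)"
  proof (rule Lim_transform_eventually[OF lim])
    show "\<forall>\<^sub>F s in at 0. norm (f s - f 0 - s *\<^sub>R D) / norm s = norm ((f s - f 0) /\<^sub>R s - D)"
      unfolding eventually_at_filter
    proof (intro always_eventually allI impI)
      fix s :: real assume "s \<noteq> 0"
      then have "(f s - f 0) /\<^sub>R s - D = (f s - f 0 - s *\<^sub>R D) /\<^sub>R s"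
        by (simp add: scaleR_diff_right)
      then show "norm (f s - f 0 - s *\<^sub>R D) / norm s = norm ((f s - f 0) /\<^sub>R s - D)"
        by (simp add: divide_inverse mult.commute)
    qed
  qed
  then show ?thesis by (rule LIM_zero_cancel[OF tendsto_norm_zero_cancel])
qed

text \<open>The carrier is required to be closed only among the units of the ambient algebra, since
  a group such as GL(n) is not closed in the space of all matrices. The multiplication laws hold on
  the whole algebra, because Lie algebra elements are multiplied as well.\<close>

locale closed_linear_group =
  fixes G :: "'a::euclidean_space monoid" (structure)
  assumes bilinear: "bounded_bilinear (\<lambda>x y. x \<otimes> y)"
    and ambient_assoc: "(x \<otimes> y) \<otimes> z = x \<otimes> (y \<otimes> z)"
    and ambient_unit: "\<one> \<otimes> x = x" "x \<otimes> \<one> = x"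
    and group_G: "group G"
    and closed_in_units: "x \<in> closure (carrier G) \<Longrightarrow> x \<otimes> y = \<one> \<Longrightarrow> y \<otimes> x = \<one> \<Longrightarrow> x \<in> carrier G"
begin

sublocale group G by (rule group_G)

sublocale prod: bounded_bilinear "\<lambda>x y. x \<otimes> y" by (rule bilinear)

definition left_mult :: "'a \<Rightarrow> 'a endo"
  where "left_mult x = Endo (Blinfun (\<lambda>y. x \<otimes> y))"

text \<open>A left inverse of \<open>left_mult\<close>: evaluating the regular representation at the
  unit brings exponentials and limits back to the ambient algebra.\<close>

definition eval_one :: "'a endo \<Rightarrow> 'a"
  where "eval_one a = blinfun_apply (blinfun_of_endo a) \<one>"

lemma blinfun_left_mult: "blinfun_apply (blinfun_of_endo (left_mult x)) y = x \<otimes> y"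
  by (simp add: left_mult_def bounded_linear_Blinfun_apply prod.bounded_linear_right)

lemma eval_left_mult [simp]: "eval_one (left_mult x) = x"
  by (simp add: eval_one_def blinfun_left_mult ambient_unit)

lemma left_mult_one: "left_mult \<one> = 1"
  by (simp add: endo_eq_iff one_endo_def) (rule blinfun_eqI, simp add: blinfun_left_mult ambient_unit)

lemma left_mult_mult: "left_mult (x \<otimes> y) = left_mult x * left_mult y"
  by (simp add: endo_eq_iff times_endo_def) (rule blinfun_eqI, simp add: blinfun_left_mult ambient_assoc)

lemma bounded_linear_eval_one: "bounded_linear eval_one"
  unfolding eval_one_def
  by (rule bounded_linear_compose[OF blinfun.bounded_linear_left bounded_linear_blinfun_of_endo])

lemma bounded_linear_left_mult: "bounded_linear left_mult"
proof -
  have "linear left_mult"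
    by (rule linearI; simp add: endo_eq_iff plus_endo_def scaleR_endo_def;
        rule blinfun_eqI; simp add: blinfun_left_mult blinfun.bilinear_simps prod.add_left prod.scaleR_left)
  then show ?thesis by (simp add: linear_conv_bounded_linear)
qed

lemma left_mult_pow: "left_mult (X [^] (k::nat)) = left_mult X ^ k"
  by (induction k) (simp_all add: nat_pow_def left_mult_one left_mult_mult power_commutes)

lemma Exp_sums: "(\<lambda>k. (1 / fact k) *\<^sub>R (X [^] (k::nat))) sums eval_one (exp (left_mult X))"
proof -
  have "(\<lambda>k. left_mult X ^ k /\<^sub>R fact k) sums exp (left_mult X)"
    by (rule exp_converges)
  from bounded_linear.sums[OF bounded_linear_eval_one this]
  have "(\<lambda>k. eval_one (left_mult (X [^] (k::nat)) /\<^sub>R fact k)) sums eval_one (exp (left_mult X))"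
    by (simp only: left_mult_pow)
  then show ?thesis
    by (simp add: linear_scale[OF bounded_linear.linear[OF bounded_linear_eval_one]] divide_inverse)
qed

lemma Exp_eq: "Exp G X = eval_one (exp (left_mult X))"
  unfolding Exp_def by (rule sums_unique[OF Exp_sums, symmetric])

lemma Exp_sums': "(\<lambda>k. (1 / fact k) *\<^sub>R (X [^] (k::nat))) sums Exp G X"
  unfolding Exp_eq by (rule Exp_sums)

lemma left_mult_Exp: "left_mult (Exp G X) = exp (left_mult X)"
proof -
  have "(\<lambda>k. left_mult ((1 / fact k) *\<^sub>R (X [^] (k::nat)))) sums left_mult (Exp G X)"
    by (rule bounded_linear.sums[OF bounded_linear_left_mult Exp_sums'])
  then have "(\<lambda>k. left_mult X ^ k /\<^sub>R fact k) sums left_mult (Exp G X)"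
    by (simp add: linear_scale[OF bounded_linear.linear[OF bounded_linear_left_mult]]
        left_mult_pow divide_inverse)
  then show ?thesis using exp_converges sums_unique2 by blast
qed

lemma left_mult_scale: "left_mult (r *\<^sub>R X) = r *\<^sub>R left_mult X"
  by (rule linear_scale[OF bounded_linear.linear[OF bounded_linear_left_mult]])

lemma left_mult_add: "left_mult (X + Y) = left_mult X + left_mult Y"
  by (rule linear_add[OF bounded_linear.linear[OF bounded_linear_left_mult]])

lemma Exp_add_scaled: "Exp G ((s + t) *\<^sub>R X) = Exp G (s *\<^sub>R X) \<otimes> Exp G (t *\<^sub>R X)"
proof -
  have "left_mult (Exp G ((s + t) *\<^sub>R X)) = exp (s *\<^sub>R left_mult X + t *\<^sub>R left_mult X)"
    by (simp add: left_mult_Exp left_mult_scale left_mult_add scaleR_left_distrib)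
  also have "\<dots> = exp (s *\<^sub>R left_mult X) * exp (t *\<^sub>R left_mult X)"
    by (rule exp_add_commuting) simp
  also have "\<dots> = left_mult (Exp G (s *\<^sub>R X) \<otimes> Exp G (t *\<^sub>R X))"
    by (simp add: left_mult_mult left_mult_Exp left_mult_scale)
  finally show ?thesis using eval_left_mult by metis
qed

lemma Exp_zero [simp]: "Exp G 0 = \<one>"
proof -
  have "left_mult 0 = 0" using left_mult_scale[of 0 0] by simp
  then show ?thesis using left_mult_one eval_left_mult[of \<one>] by (simp add: Exp_eq)
qed

lemma Exp_uminus: "Exp G (t *\<^sub>R X) \<otimes> Exp G ((- t) *\<^sub>R X) = \<one>" "Exp G ((- t) *\<^sub>R X) \<otimes> Exp G (t *\<^sub>R X) = \<one>"
  using Exp_add_scaled[of t "- t" X] Exp_add_scaled[of "- t" t X] by simp_all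

lemma Exp_has_vector_derivative: "((\<lambda>t. Exp G (t *\<^sub>R X)) has_vector_derivative X) (at 0)"
proof -
  have "((\<lambda>t. eval_one (exp (t *\<^sub>R left_mult X))) has_vector_derivative
      eval_one (exp (0 *\<^sub>R left_mult X) * left_mult X)) (at 0)"
    by (rule bounded_linear.has_vector_derivative[OF bounded_linear_eval_one
          exp_scaleR_has_vector_derivative_right])
  then show ?thesis by (simp add: Exp_eq left_mult_scale)
qed

lemma Lie_D: "X \<in> Lie G \<Longrightarrow> Exp G (t *\<^sub>R X) \<in> carrier G"
  by (simp add: Lie_def)

lemma inv_Exp: "X \<in> Lie G \<Longrightarrow> inv (Exp G (t *\<^sub>R X)) = Exp G ((- t) *\<^sub>R X)"
  using Exp_uminus by (intro inv_equality Lie_D)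

text \<open>The product formula exhibits the exponential of the sum as a limit of group elements.
  The limit is again invertible, with the exponential of the negative as inverse, so closedness
  among units applies.\<close>

lemma Lie_add:
  assumes X: "X \<in> Lie G" and Y: "Y \<in> Lie G"
  shows "X + Y \<in> Lie G"
  unfolding Lie_def
proof (intro CollectI allI)
  fix t :: real
  let ?r = "\<lambda>n. inverse (real (Suc n))"
  let ?a = "\<lambda>n. (Exp G (?r n *\<^sub>R (t *\<^sub>R X)) \<otimes> Exp G (?r n *\<^sub>R (t *\<^sub>R Y))) [^] Suc n"
  have a: "?a n \<in> carrier G" for n
    using X Y by (intro nat_pow_closed m_closed) (simp_all add: Lie_D)
  have "(\<lambda>n. eval_one (left_mult (?a n))) \<longlonglongrightarrow> eval_one (exp (left_mult (t *\<^sub>R X) + left_mult (t *\<^sub>R Y)))"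
    unfolding left_mult_pow left_mult_mult left_mult_Exp left_mult_scale[of "inverse _"]
    by (rule bounded_linear.tendsto[OF bounded_linear_eval_one lie_trotter])
  then have "?a \<longlonglongrightarrow> Exp G (t *\<^sub>R (X + Y))"
    by (simp add: Exp_eq left_mult_add[symmetric] scaleR_right_distrib)
  then have "Exp G (t *\<^sub>R (X + Y)) \<in> closure (carrier G)"
    unfolding closure_sequential using a by (intro exI[of _ ?a]) simp
  then show "Exp G (t *\<^sub>R (X + Y)) \<in> carrier G"
    using Exp_uminus by (rule closed_in_units)
qed

lemma subspace_Lie: "subspace (Lie G)"
proof (rule subspaceI)
  show "0 \<in> Lie G" by (simp add: Lie_def)
  show "c *\<^sub>R X \<in> Lie G" if "X \<in> Lie G" for c X
    unfolding Lie_def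
  proof (intro CollectI allI)
    show "Exp G (t *\<^sub>R c *\<^sub>R X) \<in> carrier G" for t
      using Lie_D[OF that, of "t * c"] by simp
  qed
qed (rule Lie_add)

lemma inv_cancel: "g \<in> carrier G \<Longrightarrow> inv g \<otimes> (g \<otimes> x) = x" "g \<in> carrier G \<Longrightarrow> g \<otimes> (inv g \<otimes> x) = x"
  by (simp_all add: ambient_assoc[symmetric] ambient_unit)

lemma bounded_linear_Ad: "bounded_linear (Ad G g)"
  unfolding Ad_def by (rule bounded_linear_compose[OF prod.bounded_linear_left prod.bounded_linear_right])

lemma Ad_mult: "g \<in> carrier G \<Longrightarrow> Ad G g (x \<otimes> y) = Ad G g x \<otimes> Ad G g y"
  by (simp add: Ad_def ambient_assoc inv_cancel)

lemma Ad_pow: "g \<in> carrier G \<Longrightarrow> Ad G g (X [^] (k::nat)) = Ad G g X [^] k"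
proof (induction k)
  case 0
  then show ?case by (simp add: nat_pow_def Ad_def ambient_unit)
next
  case (Suc k)
  then show ?case by (simp add: nat_pow_def Ad_mult)
qed

lemma Exp_Ad: "g \<in> carrier G \<Longrightarrow> Exp G (Ad G g X) = Ad G g (Exp G X)"
proof -
  assume g: "g \<in> carrier G"
  have "(\<lambda>k. Ad G g ((1 / fact k) *\<^sub>R (X [^] (k::nat)))) sums Ad G g (Exp G X)"
    by (rule bounded_linear.sums[OF bounded_linear_Ad Exp_sums'])
  then have "(\<lambda>k. (1 / fact k) *\<^sub>R (Ad G g X [^] (k::nat))) sums Ad G g (Exp G X)"
    by (simp add: linear_scale[OF bounded_linear.linear[OF bounded_linear_Ad]] Ad_pow[OF g])
  then show ?thesis using Exp_sums' sums_unique2 by blast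
qed

lemma Ad_Lie:
  assumes g: "g \<in> carrier G" and X: "X \<in> Lie G"
  shows "Ad G g X \<in> Lie G"
  unfolding Lie_def
proof (intro CollectI allI)
  fix t :: real
  have "Exp G (t *\<^sub>R Ad G g X) = Ad G g (Exp G (t *\<^sub>R X))"
    by (simp add: Exp_Ad[OF g, symmetric] linear_scale[OF bounded_linear.linear[OF bounded_linear_Ad]])
  then show "Exp G (t *\<^sub>R Ad G g X) \<in> carrier G"
    using g Lie_D[OF X, of t] by (simp add: Ad_def)
qed

text \<open>The bracket is the derivative at 0 of the curve Ad(exp sX)Y, which runs inside
  \<open>Lie G\<close>. Its difference quotients stay in this subspace, which is closed by finite
  dimension.\<close>

lemma bracket_Lie:
  assumes X: "X \<in> Lie G" and Y: "Y \<in> Lie G"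
  shows "bracket G X Y \<in> Lie G"
proof -
  let ?c = "\<lambda>s. Exp G (s *\<^sub>R X) \<otimes> Y \<otimes> Exp G ((- s) *\<^sub>R X)"
  have c: "?c s \<in> Lie G" for s
    using Ad_Lie[OF Lie_D[OF X, of s] Y] by (simp add: Ad_def inv_Exp[OF X])
  have "((\<lambda>s. Exp G (s *\<^sub>R - X)) has_vector_derivative - X) (at 0)"
    by (rule Exp_has_vector_derivative)
  then have "(?c has_vector_derivative (Exp G (0 *\<^sub>R X) \<otimes> Y) \<otimes> - X + (X \<otimes> Y) \<otimes> Exp G ((- 0) *\<^sub>R X)) (at 0)"
    using bounded_linear.has_vector_derivative[OF prod.bounded_linear_left Exp_has_vector_derivative, of X Y]
    by (intro prod.has_vector_derivative) simp_all
  then have "(?c has_vector_derivative bracket G X Y) (at 0)"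
    by (simp add: ambient_unit bracket_def prod.minus_right)
  then have "((\<lambda>s. (?c s - ?c 0) /\<^sub>R s) \<longlongrightarrow> bracket G X Y) (at 0)"
    by (rule has_vector_derivative_quotient)
  moreover have "(?c s - ?c 0) /\<^sub>R s \<in> Lie G" for s
    using subspace_Lie c by (intro subspace_scale subspace_diff)
  ultimately show ?thesis
    using closed_subspace[OF subspace_Lie] by (intro Lim_in_closed_set[of "Lie G" _ "at (0::real)"]) auto
qed

lemma Ad_bracket: "g \<in> carrier G \<Longrightarrow> Ad G g (bracket G X Y) = bracket G (Ad G g X) (Ad G g Y)"
  by (simp add: bracket_def linear_diff[OF bounded_linear.linear[OF bounded_linear_Ad]] Ad_mult)

lemma bracket_zero: "bracket G X 0 = 0" "bracket G 0 X = 0"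
  by (simp_all add: bracket_def prod.zero_left prod.zero_right)

lemma Ad_unit: "Ad G \<one> X = X"
  by (simp add: Ad_def ambient_unit)

lemma Ad_zero: "Ad G g 0 = 0"
  by (rule linear_0[OF bounded_linear.linear[OF bounded_linear_Ad]])

end

section \<open>Exponential, Lie algebra and adjoint action of a product group\<close>

lemma closed_linear_group_DirProd:
  assumes "closed_linear_group G" "closed_linear_group H"
  shows "closed_linear_group (G \<times>\<times> H)"
proof -
  interpret G: closed_linear_group G by fact
  interpret H: closed_linear_group H by fact
  show ?thesis
  proof (rule closed_linear_group.intro)
    fix x y z :: "'a \<times> 'b"
    show "(x \<otimes>\<^bsub>G \<times>\<times> H\<^esub> y) \<otimes>\<^bsub>G \<times>\<times> H\<^esub> z = x \<otimes>\<^bsub>G \<times>\<times> H\<^esub> (y \<otimes>\<^bsub>G \<times>\<times> H\<^esub> z)"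
      by (cases x; cases y; cases z) (simp add: G.ambient_assoc H.ambient_assoc)
    show "\<one>\<^bsub>G \<times>\<times> H\<^esub> \<otimes>\<^bsub>G \<times>\<times> H\<^esub> x = x" "x \<otimes>\<^bsub>G \<times>\<times> H\<^esub> \<one>\<^bsub>G \<times>\<times> H\<^esub> = x"
      by (cases x; simp add: G.ambient_unit H.ambient_unit)+
    show "Group.group (G \<times>\<times> H)" by (rule DirProd_group[OF G.group_G H.group_G])
    show "x \<in> carrier (G \<times>\<times> H)"
      if "x \<in> closure (carrier (G \<times>\<times> H))" "x \<otimes>\<^bsub>G \<times>\<times> H\<^esub> y = \<one>\<^bsub>G \<times>\<times> H\<^esub>" "y \<otimes>\<^bsub>G \<times>\<times> H\<^esub> x = \<one>\<^bsub>G \<times>\<times> H\<^esub>"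
      using that by (cases x; cases y)
        (auto simp: closure_Times intro: G.closed_in_units H.closed_in_units)
    have "bounded_bilinear (\<lambda>x y :: 'a \<times> 'b. (fst x \<otimes>\<^bsub>G\<^esub> fst y, snd x \<otimes>\<^bsub>H\<^esub> snd y))"
      unfolding bilinear_conv_bounded_bilinear[symmetric] bilinear_def
      by (simp add: linear_iff G.prod.add_left G.prod.add_right G.prod.scaleR_left G.prod.scaleR_right
          H.prod.add_left H.prod.add_right H.prod.scaleR_left H.prod.scaleR_right)
    moreover have "(\<lambda>x y. x \<otimes>\<^bsub>G \<times>\<times> H\<^esub> y) = (\<lambda>x y. (fst x \<otimes>\<^bsub>G\<^esub> fst y, snd x \<otimes>\<^bsub>H\<^esub> snd y))"
      by (auto simp: fun_eq_iff)
    ultimately show "bounded_bilinear (\<lambda>x y. x \<otimes>\<^bsub>G \<times>\<times> H\<^esub> y)" by simp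
  qed
qed

lemma Exp_DirProd:
  assumes "closed_linear_group G" "closed_linear_group H"
  shows "Exp (G \<times>\<times> H) (X, Y) = (Exp G X, Exp H Y)"
proof -
  interpret G: closed_linear_group G by fact
  interpret H: closed_linear_group H by fact
  have pow: "(X, Y) [^]\<^bsub>G \<times>\<times> H\<^esub> (k::nat) = (X [^]\<^bsub>G\<^esub> k, Y [^]\<^bsub>H\<^esub> k)" for k
    by (induction k) (simp_all add: nat_pow_def)
  have "(\<lambda>k. (1 / fact k) *\<^sub>R ((X, Y) [^]\<^bsub>G \<times>\<times> H\<^esub> (k::nat))) sums (Exp G X, Exp H Y)"
  proof -
    have "(\<lambda>n. (\<Sum>k<n. (1 / fact k) *\<^sub>R (X [^]\<^bsub>G\<^esub> (k::nat)), \<Sum>k<n. (1 / fact k) *\<^sub>R (Y [^]\<^bsub>H\<^esub> (k::nat))))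
        \<longlonglongrightarrow> (Exp G X, Exp H Y)"
      using G.Exp_sums' H.Exp_sums' unfolding sums_def by (rule tendsto_Pair)
    then show ?thesis by (simp add: sums_def pow sum_prod)
  qed
  then show ?thesis unfolding Exp_def by (rule sums_unique[symmetric])
qed

lemma Lie_DirProd:
  assumes "closed_linear_group G" "closed_linear_group H"
  shows "Lie (G \<times>\<times> H) = Lie G \<times> Lie H"
  by (auto simp: Lie_def Exp_DirProd[OF assms])

lemma Ad_DirProd:
  assumes "closed_linear_group G" "closed_linear_group H" "g \<in> carrier G" "h \<in> carrier H"
  shows "Ad (G \<times>\<times> H) (g, h) (X, Y) = (Ad G g X, Ad H h Y)"
proof -
  interpret G: closed_linear_group G by fact
  interpret H: closed_linear_group H by fact
  show ?thesis
    using assms(3,4) by (simp add: Ad_def inv_DirProd[OF G.group_G H.group_G])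
qed


section \<open>Invariant differential operators\<close>

text \<open>The acting group \<open>H\<close> is kept apart from the domain \<open>C\<close> of the
  functions. This covers right translations on \<open>G\<close> and on the product as well as left
  translations by the subgroup on functions on \<open>G\<close>. Linear combinations are restricted
  to \<open>C\<close> because functions are extensional.\<close>

locale lie_action = lie_closed H for H :: "'a::euclidean_space monoid" +
  fixes C :: "'a set" and M :: "('a \<Rightarrow> complex) set" and D :: "'a \<Rightarrow> ('a \<Rightarrow> complex) \<Rightarrow> 'a \<Rightarrow> complex"
  assumes M_ext: "M \<subseteq> extensional C"
    and M_lin: "f \<in> M \<Longrightarrow> k \<in> M \<Longrightarrow> (\<lambda>g\<in>C. a * f g + b * k g) \<in> M"
    and D_M: "X \<in> Lie H \<Longrightarrow> f \<in> M \<Longrightarrow> D X f \<in> M"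
    and D_lin: "X \<in> Lie H \<Longrightarrow> f \<in> M \<Longrightarrow> k \<in> M \<Longrightarrow> g \<in> C \<Longrightarrow>
      D X (\<lambda>g\<in>C. a * f g + b * k g) g = a * D X f g + b * D X k g"
    and D_add: "X \<in> Lie H \<Longrightarrow> Y \<in> Lie H \<Longrightarrow> f \<in> M \<Longrightarrow> g \<in> C \<Longrightarrow> D (X + Y) f g = D X f g + D Y f g"
    and D_scale: "X \<in> Lie H \<Longrightarrow> f \<in> M \<Longrightarrow> g \<in> C \<Longrightarrow> D (r *\<^sub>R X) f g = of_real r * D X f g"
    and D_bracket: "X \<in> Lie H \<Longrightarrow> Y \<in> Lie H \<Longrightarrow> f \<in> M \<Longrightarrow> g \<in> C \<Longrightarrow>
      D (bracket H X Y) f g = D X (D Y f) g - D Y (D X f) g"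
begin

lemma D_diff:
  assumes "X \<in> Lie H" "Y \<in> Lie H" "f \<in> M" "g \<in> C"
  shows "D (X - Y) f g = D X f g - D Y f g"
  using D_add[of X "(-1) *\<^sub>R Y" f g] D_scale[of Y f g "-1"] assms subspace_scale[OF Lie_subspace, of Y "-1"]
  by simp

abbreviation act :: "'a \<times> 'a \<Rightarrow> ('a \<Rightarrow> complex) \<Rightarrow> 'a \<Rightarrow> complex"
  where "act \<equiv> act_Cx C D"

lemma act_eq: "act Z f = (\<lambda>g\<in>C. 1 * D (fst Z) f g + \<i> * D (snd Z) f g)"
  by (simp add: act_Cx_def)

lemma LieCx_parts: "Z \<in> LieCx H \<Longrightarrow> fst Z \<in> Lie H" "Z \<in> LieCx H \<Longrightarrow> snd Z \<in> Lie H"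
  by (auto simp: complexify_def)

lemma act_M: "Z \<in> LieCx H \<Longrightarrow> f \<in> M \<Longrightarrow> act Z f \<in> M"
  unfolding act_eq by (intro M_lin D_M LieCx_parts)

lemma act_lin:
  assumes "Z \<in> LieCx H" "f \<in> M" "k \<in> M"
  shows "act Z (\<lambda>g\<in>C. a * f g + b * k g) = (\<lambda>g\<in>C. a * act Z f g + b * act Z k g)"
  using D_lin[OF LieCx_parts(1)[OF assms(1)] assms(2,3)] D_lin[OF LieCx_parts(2)[OF assms(1)] assms(2,3)]
  by (auto simp: act_eq restrict_def fun_eq_iff algebra_simps)

lemma foldr_act_M: "set w \<subseteq> LieCx H \<Longrightarrow> f \<in> M \<Longrightarrow> foldr act w f \<in> M"
  by (induction w) (auto intro: act_M)

lemma foldr_act_lin: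
  assumes "set w \<subseteq> LieCx H" "f \<in> M" "k \<in> M"
  shows "foldr act w (\<lambda>g\<in>C. a * f g + b * k g) = (\<lambda>g\<in>C. a * foldr act w f g + b * foldr act w k g)"
  using assms(1)
proof (induction w)
  case (Cons Z w)
  then have w: "set w \<subseteq> LieCx H" and Z: "Z \<in> LieCx H" by simp_all
  show ?case
    unfolding foldr.simps o_apply Cons.IH[OF w]
    by (rule act_lin[OF Z foldr_act_M[OF w assms(2)] foldr_act_M[OF w assms(3)]])
qed simp

lemma act_add:
  assumes "Z \<in> LieCx H" "W \<in> LieCx H" "f \<in> M"
  shows "act (Z + W) f = (\<lambda>g\<in>C. 1 * act Z f g + 1 * act W f g)"
  using D_add[OF LieCx_parts(1)[OF assms(1)] LieCx_parts(1)[OF assms(2)] assms(3)]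
    D_add[OF LieCx_parts(2)[OF assms(1)] LieCx_parts(2)[OF assms(2)] assms(3)]
  by (auto simp: act_eq restrict_def fun_eq_iff algebra_simps)

lemma act_scale:
  assumes "Z \<in> LieCx H" "f \<in> M"
  shows "act (scaleCx c Z) f = (\<lambda>g\<in>C. c * act Z f g + 0 * act Z f g)"
proof -
  note Z = LieCx_parts[OF assms(1)]
  note sc = subspace_scale[OF Lie_subspace]
  have "D (fst (scaleCx c Z)) f g = of_real (Re c) * D (fst Z) f g - of_real (Im c) * D (snd Z) f g"
    "D (snd (scaleCx c Z)) f g = of_real (Re c) * D (snd Z) f g + of_real (Im c) * D (fst Z) f g"
    if "g \<in> C" for g
    using that Z assms(2) by (simp_all add: scaleCx_def D_diff D_add D_scale sc)
  moreover have "c * (x + \<i> * y) = (of_real (Re c) * x - of_real (Im c) * y) +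
      \<i> * (of_real (Re c) * y + of_real (Im c) * x)" for x y :: complex
    by (rule complex_eqI) (simp_all add: algebra_simps)
  ultimately show ?thesis
    by (auto simp: act_eq restrict_def fun_eq_iff)
qed

lemma act_bracket:
  assumes "Z \<in> LieCx H" "W \<in> LieCx H" "f \<in> M"
  shows "act (bracketCx H Z W) f = (\<lambda>g\<in>C. 1 * act Z (act W f) g + (- 1) * act W (act Z f) g)"
proof -
  note Z = LieCx_parts[OF assms(1)] and W = LieCx_parts[OF assms(2)]
  have br: "bracket H X Y \<in> Lie H" if "X \<in> Lie H" "Y \<in> Lie H" for X Y
    using that by (rule Lie_bracket)
  have aa: "act U (act V f) g =
      D (fst U) (D (fst V) f) g + \<i> * D (fst U) (D (snd V) f) g +
      \<i> * (D (snd U) (D (fst V) f) g + \<i> * D (snd U) (D (snd V) f) g)"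
    if U: "U \<in> LieCx H" and V: "V \<in> LieCx H" and g: "g \<in> C" for U V g
    using D_lin[OF LieCx_parts(1)[OF U] D_M[OF LieCx_parts(1)[OF V] assms(3)] D_M[OF LieCx_parts(2)[OF V] assms(3)] g, of 1 \<i>]
      D_lin[OF LieCx_parts(2)[OF U] D_M[OF LieCx_parts(1)[OF V] assms(3)] D_M[OF LieCx_parts(2)[OF V] assms(3)] g, of 1 \<i>]
      g by (simp add: act_Cx_def)
  show ?thesis
  proof (rule extensionalityI[where A = C])
    fix g assume g: "g \<in> C"
    have "act (bracketCx H Z W) f g =
        (D (fst Z) (D (fst W) f) g - D (fst W) (D (fst Z) f) g) - (D (snd Z) (D (snd W) f) g - D (snd W) (D (snd Z) f) g) +
        \<i> * ((D (fst Z) (D (snd W) f) g - D (snd W) (D (fst Z) f) g) + (D (snd Z) (D (fst W) f) g - D (fst W) (D (snd Z) f) g))"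
      using g Z W assms(3) by (simp add: act_Cx_def bracketCx_def D_diff D_add D_bracket br)
    also have "\<dots> = act Z (act W f) g - act W (act Z f) g"
      unfolding aa[OF assms(1,2) g] aa[OF assms(2,1) g] by (simp add: algebra_simps)
    finally show "act (bracketCx H Z W) f g = (\<lambda>g\<in>C. 1 * act Z (act W f) g + (- 1) * act W (act Z f) g) g"
      using g by simp
  qed (simp_all add: act_Cx_def)
qed

text \<open>For fixed \<open>f\<close> and \<open>g\<close>, the value of iterated derivatives as a
  function of the word respects all relations. By the duality criterion for equal classes, the
  operators of \<open>act_U\<close> are therefore independent of the representative.\<close>

lemma foldr_act_dual:
  assumes f: "f \<in> M" and g: "g \<in> C"
  shows "(\<lambda>w. foldr act w f g) \<in> dual_U H"
proof (rule dual_UI)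
  fix x y Z W c
  assume x: "set x \<subseteq> LieCx H" and y: "set y \<subseteq> LieCx H" and Z: "Z \<in> LieCx H"
  let ?k = "foldr act y f"
  have k: "?k \<in> M" by (rule foldr_act_M[OF y f])
  show "foldr act (x @ [scaleCx c Z] @ y) f g = c * foldr act (x @ [Z] @ y) f g"
    unfolding foldr_append foldr.simps o_apply id_apply act_scale[OF Z k]
      foldr_act_lin[OF x act_M[OF Z k] act_M[OF Z k]] using g by simp
  assume W: "W \<in> LieCx H"
  show "foldr act (x @ [Z + W] @ y) f g = foldr act (x @ [Z] @ y) f g + foldr act (x @ [W] @ y) f g"
    unfolding foldr_append foldr.simps o_apply id_apply act_add[OF Z W k]
      foldr_act_lin[OF x act_M[OF Z k] act_M[OF W k]] using g by simp
  show "foldr act (x @ [Z, W] @ y) f g - foldr act (x @ [W, Z] @ y) f g = foldr act (x @ [bracketCx H Z W] @ y) f g"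
    unfolding foldr_append foldr.simps o_apply id_apply act_bracket[OF Z W k]
      foldr_act_lin[OF x act_M[OF Z act_M[OF W k]] act_M[OF W act_M[OF Z k]]] using g by simp
qed

lemma act_U_class:
  assumes p: "p \<in> carrier FA" and f: "f \<in> M" and g: "g \<in> C"
  shows "act_U C D (U_class H p) f g = pairing p (\<lambda>w. foldr act w f g)"
proof -
  have "act_U C D (U_class H p) f = act_free C D p f"
    unfolding act_U_def
  proof (rule the_elem_U_class[OF p])
    fix q assume q: "q \<in> carrier FA" "U_class H q = U_class H p"
    have "pairing q (\<lambda>w. foldr act w f x) = pairing p (\<lambda>w. foldr act w f x)" if "x \<in> C" for x
      using q(2) foldr_act_dual[OF f that] unfolding U_class_eq_iff[OF q(1) p] by blast
    then show "act_free C D q f = act_free C D p f"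
      unfolding act_free_def pairing_def[symmetric] by (auto simp: restrict_def)
  qed
  then show ?thesis using g by (simp add: act_free_def pairing_def)
qed

end

section \<open>Smooth functions on a group and derivatives along linear flows\<close>

lemma C_infinity_local:
  assumes "f \<in> C_infinity G" "g \<in> carrier G"
  obtains S h where "open S" "g \<in> S" "smooth_on S h" "\<forall>x\<in>S \<inter> carrier G. f x = h x"
  using assms unfolding C_infinity_def smooth_on_def by blast

lemma C_infinityI:
  assumes "f \<in> extensional (carrier G)"
    and "\<And>g. g \<in> carrier G \<Longrightarrow> \<exists>S h. open S \<and> g \<in> S \<and> smooth_on S h \<and> (\<forall>x\<in>S \<inter> carrier G. f x = h x)"
  shows "f \<in> C_infinity G"
  using assms unfolding C_infinity_def smooth_on_def by blast

lemma smooth_on_subset: "smooth_on S f \<Longrightarrow> T \<subseteq> S \<Longrightarrow> smooth_on T f"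
  unfolding smooth_on_def using Ck_on_subset by blast

lemma smooth_on_linear_combination:
  "open S \<Longrightarrow> smooth_on S f \<Longrightarrow> smooth_on S k \<Longrightarrow> smooth_on S (\<lambda>x. a * f x + b * k x)"
  unfolding smooth_on_def by (intro allI Ck_on_add Ck_on_mult Ck_on_const) auto

lemma C_infinity_linear_combination:
  assumes f: "f \<in> C_infinity G" and k: "k \<in> C_infinity G"
  shows "(\<lambda>g\<in>carrier G. a * f g + b * k g) \<in> C_infinity G"
proof (rule C_infinityI)
  fix g assume g: "g \<in> carrier G"
  obtain S h where S: "open S" "g \<in> S" "smooth_on S h" "\<forall>x\<in>S \<inter> carrier G. f x = h x"
    using f g by (rule C_infinity_local)
  obtain T l where T: "open T" "g \<in> T" "smooth_on T l" "\<forall>x\<in>T \<inter> carrier G. k x = l x"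
    using k g by (rule C_infinity_local)
  have "open (S \<inter> T)" "g \<in> S \<inter> T" using S T by auto
  moreover have "smooth_on (S \<inter> T) (\<lambda>x. a * h x + b * l x)"
    using S T by (intro smooth_on_linear_combination smooth_on_subset[OF S(3)] smooth_on_subset[OF T(3)]) auto
  moreover have "\<forall>x\<in>(S \<inter> T) \<inter> carrier G. (\<lambda>g\<in>carrier G. a * f g + b * k g) x = a * h x + b * l x"
    using S(4) T(4) by simp
  ultimately show "\<exists>S h. open S \<and> g \<in> S \<and> smooth_on S h \<and>
      (\<forall>x\<in>S \<inter> carrier G. (\<lambda>g\<in>carrier G. a * f g + b * k g) x = h x)" by blast
qed simp

text \<open>Left and right translations by one-parameter groups are flows of linear vector fields
  \<open>A\<close>, and on smooth functions they differentiate to the directional derivative along \<open>A\<close>.\<close>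

definition linear_flow :: "'a::euclidean_space set \<Rightarrow> (real \<Rightarrow> 'a \<Rightarrow> 'a) \<Rightarrow> ('a \<Rightarrow> 'a) \<Rightarrow> bool"
  where "linear_flow C c A \<longleftrightarrow> bounded_linear A \<and>
    (\<forall>g\<in>C. (\<forall>t. c t g \<in> C) \<and> c 0 g = g \<and> ((\<lambda>t. c t g) has_vector_derivative A g) (at 0))"

definition flow_deriv :: "'a::euclidean_space set \<Rightarrow> (real \<Rightarrow> 'a \<Rightarrow> 'a) \<Rightarrow> ('a \<Rightarrow> complex) \<Rightarrow> 'a \<Rightarrow> complex"
  where "flow_deriv C c f = (\<lambda>g\<in>C. vector_derivative (\<lambda>t. f (c t g)) (at 0))"

text \<open>The flow line starting at \<open>g\<close> stays in \<open>C\<close> and, for small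
  times, in \<open>S\<close>. There \<open>f\<close> coincides with the extension \<open>h\<close>,
  to which the chain rule applies.\<close>

lemma flow_deriv_eq:
  assumes c: "linear_flow C c A" and S: "open S" and h: "smooth_on S h"
    and eq: "\<forall>x\<in>S \<inter> C. f x = h x" and g: "g \<in> S" "g \<in> C"
  shows "flow_deriv C c f g = frechet_derivative h (at g) (A g)"
proof -
  have cg: "\<And>t. c t g \<in> C" "c 0 g = g" "((\<lambda>t. c t g) has_vector_derivative A g) (at 0)"
    using c g unfolding linear_flow_def by auto
  have "(h has_derivative frechet_derivative h (at g)) (at (c 0 g))"
    using smooth_on_has_derivative[OF h S g(1)] cg(2) by simp
  from has_derivative_compose[OF cg(3)[unfolded has_vector_derivative_def] this]
  have "((\<lambda>t. h (c t g)) has_derivative (\<lambda>r. frechet_derivative h (at g) (r *\<^sub>R A g))) (at 0)" .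
  moreover have "linear (frechet_derivative h (at g))"
    using smooth_on_has_derivative[OF h S g(1)] has_derivative_linear by blast
  ultimately have h': "((\<lambda>t. h (c t g)) has_vector_derivative frechet_derivative h (at g) (A g)) (at 0)"
    by (simp add: has_vector_derivative_def linear_scale)
  have "isCont (\<lambda>t. c t g) 0"
    by (rule has_vector_derivative_continuous[OF cg(3)])
  then obtain T where T: "open T" "0 \<in> T" "\<forall>t\<in>T. c t g \<in> S"
    using S g(1) cg(2) unfolding continuous_at_open by (elim allE[of _ S]) auto
  have "((\<lambda>t. f (c t g)) has_vector_derivative frechet_derivative h (at g) (A g)) (at 0)"
    by (rule has_vector_derivative_transform_within_open[OF h' T(1,2)]) (simp add: eq cg(1) T(3))
  then show ?thesis using g by (simp add: flow_deriv_def vector_derivative_at)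
qed

lemma smooth_on_directional:
  assumes S: "open S" and h: "smooth_on S h" and A: "bounded_linear A"
  shows "smooth_on S (\<lambda>x. frechet_derivative h (at x) (A x))"
proof -
  have "Ck_on k (\<lambda>x. \<Sum>b\<in>Basis. of_real (A x \<bullet> b) * frechet_derivative h (at x) b) S" for k
  proof (intro Ck_on_sum[OF S] Ck_on_mult[OF S])
    fix b :: 'a
    show "Ck_on k (\<lambda>x. of_real (A x \<bullet> b)) S"
      by (intro Ck_on_linear[OF S] bounded_linear_compose[OF bounded_linear_of_real]
          bounded_linear_compose[OF bounded_linear_inner_left A])
    show "Ck_on k (\<lambda>x. frechet_derivative h (at x) b) S"
      using smooth_on_frechet[OF h] by (simp add: smooth_on_def)
  qed
  moreover have "frechet_derivative h (at x) (A x) =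
      (\<Sum>b\<in>Basis. of_real (A x \<bullet> b) * frechet_derivative h (at x) b)" if "x \<in> S" for x
  proof -
    have lin: "linear (frechet_derivative h (at x))"
      using smooth_on_has_derivative[OF h S that] has_derivative_linear by blast
    have "frechet_derivative h (at x) (A x) = frechet_derivative h (at x) (\<Sum>b\<in>Basis. (A x \<bullet> b) *\<^sub>R b)"
      by (simp add: euclidean_representation)
    then show ?thesis by (simp add: linear_sum[OF lin] linear_scale[OF lin] scaleR_conv_of_real)
  qed
  ultimately show ?thesis
    unfolding smooth_on_def using Ck_on_cong[OF S] by (metis (no_types, lifting))
qed

lemma flow_deriv_smooth:
  assumes c: "linear_flow (carrier G) c A" and f: "f \<in> C_infinity G"
  shows "flow_deriv (carrier G) c f \<in> C_infinity G"
proof (rule C_infinityI)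
  fix g assume g: "g \<in> carrier G"
  obtain S h where S: "open S" "g \<in> S" "smooth_on S h" "\<forall>x\<in>S \<inter> carrier G. f x = h x"
    using f g by (rule C_infinity_local)
  have "smooth_on S (\<lambda>x. frechet_derivative h (at x) (A x))"
    using c by (intro smooth_on_directional[OF S(1,3)]) (simp add: linear_flow_def)
  then show "\<exists>S h. open S \<and> g \<in> S \<and> smooth_on S h \<and> (\<forall>x\<in>S \<inter> carrier G. flow_deriv (carrier G) c f x = h x)"
    using S(1,2) flow_deriv_eq[OF c S(1,3,4)] by blast
qed (simp add: flow_deriv_def)

lemma flow_deriv_linear_combination:
  assumes c: "linear_flow (carrier G) c A" and f: "f \<in> C_infinity G" and k: "k \<in> C_infinity G"
    and g: "g \<in> carrier G"
  shows "flow_deriv (carrier G) c (\<lambda>g\<in>carrier G. a * f g + b * k g) g =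
    a * flow_deriv (carrier G) c f g + b * flow_deriv (carrier G) c k g"
proof -
  obtain S h where S: "open S" "g \<in> S" "smooth_on S h" "\<forall>x\<in>S \<inter> carrier G. f x = h x"
    using f g by (rule C_infinity_local)
  obtain T l where T: "open T" "g \<in> T" "smooth_on T l" "\<forall>x\<in>T \<inter> carrier G. k x = l x"
    using k g by (rule C_infinity_local)
  have O: "open (S \<inter> T)" "g \<in> S \<inter> T" using S T by auto
  have hl: "smooth_on (S \<inter> T) h" "smooth_on (S \<inter> T) l"
    using smooth_on_subset[OF S(3)] smooth_on_subset[OF T(3)] by auto
  have "((\<lambda>x. a * h x + b * l x) has_derivative
      (\<lambda>v. a * frechet_derivative h (at g) v + b * frechet_derivative l (at g) v)) (at g)"
    using smooth_on_has_derivative[OF hl(1) O] smooth_on_has_derivative[OF hl(2) O]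
    by (intro has_derivative_add has_derivative_mult_right)
  then have "frechet_derivative (\<lambda>x. a * h x + b * l x) (at g) =
      (\<lambda>v. a * frechet_derivative h (at g) v + b * frechet_derivative l (at g) v)"
    using frechet_derivative_at by metis
  moreover have "flow_deriv (carrier G) c (\<lambda>g\<in>carrier G. a * f g + b * k g) g =
      frechet_derivative (\<lambda>x. a * h x + b * l x) (at g) (A g)"
    using S(4) T(4) O g
    by (intro flow_deriv_eq[OF c O(1) smooth_on_linear_combination[OF O(1) hl]]) auto
  moreover have "flow_deriv (carrier G) c f g = frechet_derivative h (at g) (A g)"
    using S g by (intro flow_deriv_eq[OF c S(1,3)]) auto
  moreover have "flow_deriv (carrier G) c k g = frechet_derivative l (at g) (A g)"
    using T g by (intro flow_deriv_eq[OF c T(1,3)]) auto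
  ultimately show ?thesis by simp
qed

lemma flow_deriv_combine:
  assumes c: "linear_flow (carrier G) c A" and d: "linear_flow (carrier G) d B"
    and e: "linear_flow (carrier G) e (\<lambda>x. r *\<^sub>R A x + s *\<^sub>R B x)"
    and f: "f \<in> C_infinity G" and g: "g \<in> carrier G"
  shows "flow_deriv (carrier G) e f g =
    of_real r * flow_deriv (carrier G) c f g + of_real s * flow_deriv (carrier G) d f g"
proof -
  obtain S h where S: "open S" "g \<in> S" "smooth_on S h" "\<forall>x\<in>S \<inter> carrier G. f x = h x"
    using f g by (rule C_infinity_local)
  have lin: "linear (frechet_derivative h (at g))"
    using smooth_on_has_derivative[OF S(3,1,2)] has_derivative_linear by blast
  show ?thesis
    using flow_deriv_eq[OF c S(1,3,4,2) g] flow_deriv_eq[OF d S(1,3,4,2) g] flow_deriv_eq[OF e S(1,3,4,2) g]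
    by (simp add: linear_add[OF lin] linear_scale[OF lin] scaleR_conv_of_real)
qed

text \<open>Differentiating twice gives a second derivative of \<open>h\<close> in the directions
  \<open>A g\<close> and \<open>B g\<close>, which cancels by symmetry, and a first derivative along
  the derivative of the vector field. For linear fields the latter is \<open>B (A g)\<close> in one
  order and \<open>A (B g)\<close> in the other.\<close>

lemma flow_deriv_commutator:
  assumes c: "linear_flow (carrier G) c A" and d: "linear_flow (carrier G) d B"
    and e: "linear_flow (carrier G) e (\<lambda>x. B (A x) - A (B x))"
    and f: "f \<in> C_infinity G" and g: "g \<in> carrier G"
  shows "flow_deriv (carrier G) e f g =
    flow_deriv (carrier G) c (flow_deriv (carrier G) d f) g - flow_deriv (carrier G) d (flow_deriv (carrier G) c f) g"
proof -
  obtain S h where S: "open S" "g \<in> S" "smooth_on S h" "\<forall>x\<in>S \<inter> carrier G. f x = h x"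
    using f g by (rule C_infinity_local)
  have AB: "bounded_linear A" "bounded_linear B" using c d by (auto simp: linear_flow_def)
  let ?D = "\<lambda>x. frechet_derivative h (at x)"
  let ?D2 = "\<lambda>v. frechet_derivative (\<lambda>x. ?D x v) (at g)"
  have lin: "linear (?D g)"
    using smooth_on_has_derivative[OF S(3,1,2)] has_derivative_linear by blast
  have lin2: "linear (?D2 v)" for v
    using smooth_on_has_derivative[OF smooth_on_frechet[OF S(3)] S(1,2)] has_derivative_linear by blast
  have deriv: "frechet_derivative (\<lambda>x. ?D x (A x)) (at g) v = ?D2 (A g) v + ?D g (A v)"
    if A: "bounded_linear A" for A v
  proof -
    have eq: "?D x (A x) = (\<Sum>b\<in>Basis. (A x \<bullet> b) *\<^sub>R ?D x b)" if "x \<in> S" for x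
    proof -
      have lin: "linear (?D x)"
        using smooth_on_has_derivative[OF S(3,1) that] has_derivative_linear by blast
      have "?D x (A x) = ?D x (\<Sum>b\<in>Basis. (A x \<bullet> b) *\<^sub>R b)" by (simp add: euclidean_representation)
      then show ?thesis by (simp add: linear_sum[OF lin] linear_scale[OF lin])
    qed
    have "((\<lambda>x. \<Sum>b\<in>Basis. (A x \<bullet> b) *\<^sub>R ?D x b) has_derivative
        (\<lambda>v. \<Sum>b\<in>Basis. (A g \<bullet> b) *\<^sub>R ?D2 b v + (A v \<bullet> b) *\<^sub>R ?D g b)) (at g)"
      by (intro has_derivative_sum has_derivative_scaleR has_derivative_inner_left
          bounded_linear_imp_has_derivative[OF A]
          smooth_on_has_derivative[OF smooth_on_frechet[OF S(3)] S(1,2)])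
    note sum_deriv = frechet_derivative_at[OF this]
    have cong: "frechet_derivative (\<lambda>x. ?D x (A x)) (at g) =
        frechet_derivative (\<lambda>x. \<Sum>b\<in>Basis. (A x \<bullet> b) *\<^sub>R ?D x b) (at g)"
      by (rule frechet_derivative_cong_open[OF S(1,2) eq])
    have "frechet_derivative (\<lambda>x. ?D x (A x)) (at g) v = (\<Sum>b\<in>Basis. (A g \<bullet> b) *\<^sub>R ?D2 b v + (A v \<bullet> b) *\<^sub>R ?D g b)"
      unfolding cong by (rule fun_cong[OF sum_deriv, symmetric])
    \<comment> \<open>Linearity of \<open>?D2\<close> is known in the second direction only.
      Symmetry first moves the basis vector there, and after resumming a second use of symmetry
      moves \<open>A g\<close> back.\<close>
    also have "\<dots> = (\<Sum>b\<in>Basis. (A g \<bullet> b) *\<^sub>R ?D2 v b) + ?D g (A v)"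
    proof -
      have "?D g (A v) = ?D g (\<Sum>b\<in>Basis. (A v \<bullet> b) *\<^sub>R b)" by (simp add: euclidean_representation)
      then show ?thesis
        using smooth_on_second_derivative_symmetric[OF S(1,2,3)]
        by (simp add: sum.distrib linear_sum[OF lin] linear_scale[OF lin])
    qed
    also have "(\<Sum>b\<in>Basis. (A g \<bullet> b) *\<^sub>R ?D2 v b) = ?D2 v (\<Sum>b\<in>Basis. (A g \<bullet> b) *\<^sub>R b)"
      by (simp add: linear_sum[OF lin2] linear_scale[OF lin2])
    also have "\<dots> = ?D2 (A g) v"
      using smooth_on_second_derivative_symmetric[OF S(1,2,3)] by (simp add: euclidean_representation)
    finally show ?thesis .
  qed
  have "flow_deriv (carrier G) c (flow_deriv (carrier G) d f) g = frechet_derivative (\<lambda>x. ?D x (B x)) (at g) (A g)"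
    using flow_deriv_eq[OF d S(1,3,4)]
    by (intro flow_deriv_eq[OF c S(1) smooth_on_directional[OF S(1,3) AB(2)] _ S(2) g]) blast
  moreover have "flow_deriv (carrier G) d (flow_deriv (carrier G) c f) g = frechet_derivative (\<lambda>x. ?D x (A x)) (at g) (B g)"
    using flow_deriv_eq[OF c S(1,3,4)]
    by (intro flow_deriv_eq[OF d S(1) smooth_on_directional[OF S(1,3) AB(1)] _ S(2) g]) blast
  moreover have "flow_deriv (carrier G) e f g = ?D g (B (A g) - A (B g))"
    by (rule flow_deriv_eq[OF e S(1,3,4,2) g])
  ultimately show ?thesis
    using smooth_on_second_derivative_symmetric[OF S(1,2,3), of "A g" "B g"]
    by (simp add: deriv[OF AB(1)] deriv[OF AB(2)] linear_diff[OF lin])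
qed

text \<open>Differentiation passes through a finite combination of functions. It is used to apply
  right operators after a combination of left derivatives has been recognised as a multiple of
  \<open>f\<close>.\<close>

lemma (in lie_action) foldr_act_pairing:
  assumes w: "set w \<subseteq> LieCx H" and b: "fin_supp b" and F: "\<And>v. b v \<noteq> 0 \<Longrightarrow> F v \<in> M" and f: "f \<in> M" and g: "g \<in> C"
  shows "foldr act w (\<lambda>g\<in>C. pairing b (\<lambda>v. F v g)) g = pairing b (\<lambda>v. foldr act w (F v) g)"
proof -
  have "(\<lambda>g\<in>C. \<Sum>v\<in>A. b v * F v g) \<in> M \<and>
      foldr act w (\<lambda>g\<in>C. \<Sum>v\<in>A. b v * F v g) = (\<lambda>g\<in>C. \<Sum>v\<in>A. b v * foldr act w (F v) g)"
    if "finite A" "A \<subseteq> {v. b v \<noteq> 0}" for A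
    using that
  proof (induction A rule: finite_induct)
    case empty
    show ?case using M_lin[OF f f, of 0 0] foldr_act_lin[OF w f f, of 0 0] by (simp add: restrict_def)
  next
    case (insert v A)
    let ?s = "\<lambda>g\<in>C. \<Sum>v\<in>A. b v * F v g"
    have IH: "?s \<in> M" "foldr act w ?s = (\<lambda>g\<in>C. \<Sum>v\<in>A. b v * foldr act w (F v) g)"
      using insert.IH insert.prems by (metis (no_types, lifting) insert_subset)+
    have Fv: "F v \<in> M" using insert F by auto
    have eq: "(\<lambda>g\<in>C. \<Sum>v\<in>insert v A. b v * F v g) = (\<lambda>g\<in>C. b v * F v g + 1 * ?s g)"
      using insert by (auto simp: restrict_def fun_eq_iff)
    have "foldr act w (\<lambda>g\<in>C. \<Sum>v\<in>insert v A. b v * F v g) =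
        (\<lambda>g\<in>C. \<Sum>v\<in>insert v A. b v * foldr act w (F v) g)"
      unfolding eq foldr_act_lin[OF w Fv IH(1)] IH(2)
      using insert.hyps by (auto simp: restrict_def fun_eq_iff)
    moreover have "(\<lambda>g\<in>C. \<Sum>v\<in>insert v A. b v * F v g) \<in> M"
      unfolding eq by (rule M_lin[OF Fv IH(1)])
    ultimately show ?case by blast
  qed
  from this[OF b subset_refl] show ?thesis using g by (simp add: pairing_def)
qed

lemma C_infinity_extensional: "C_infinity G \<subseteq> extensional (carrier G)"
  by (auto simp: C_infinity_def)

text \<open>In \<open>A_bracket\<close> the order is reversed: composing linear fields as maps and
  composing their derivatives as operators are opposite. The minus sign in left translation makes
  its fields obey the same rule as those of right translation.\<close>

lemma lie_action_flows:
  assumes H: "lie_closed H"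
    and flow: "\<And>X. X \<in> Lie H \<Longrightarrow> linear_flow (carrier G) (c X) (A X)"
    and A_add: "\<And>X Y x. A (X + Y) x = A X x + A Y x"
    and A_scale: "\<And>r X x. A (r *\<^sub>R X) x = r *\<^sub>R A X x"
    and A_bracket: "\<And>X Y x. A (bracket H X Y) x = A Y (A X x) - A X (A Y x)"
    and D: "\<And>X. D X = flow_deriv (carrier G) (c X)"
  shows "lie_action H (carrier G) (C_infinity G) D"
proof -
  interpret H: lie_closed H by (rule H)
  show ?thesis
  proof
    fix X Y f g and r :: real
    assume X: "X \<in> Lie H" and f: "f \<in> C_infinity G" and g: "g \<in> carrier G"
    show "D (r *\<^sub>R X) f g = of_real r * D X f g"
      using flow_deriv_combine[OF flow[OF X] flow[OF X] _ f g, of _ r 0]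
        flow[OF subspace_scale[OF H.Lie_subspace X], of r]
      by (simp add: D A_scale[abs_def])
    assume Y: "Y \<in> Lie H"
    show "D (X + Y) f g = D X f g + D Y f g"
      using flow_deriv_combine[OF flow[OF X] flow[OF Y] _ f g, of _ 1 1]
        flow[OF subspace_add[OF H.Lie_subspace X Y]]
      by (simp add: D A_add[abs_def])
    show "D (bracket H X Y) f g = D X (D Y f) g - D Y (D X f) g"
      using flow_deriv_commutator[OF flow[OF X] flow[OF Y] _ f g] flow[OF H.Lie_bracket[OF X Y]]
      by (simp add: D A_bracket[abs_def])
  next
    fix X f assume "X \<in> Lie H" "f \<in> C_infinity G"
    then show "D X f \<in> C_infinity G" unfolding D by (rule flow_deriv_smooth[OF flow])
  next
    fix X f k g a b
    assume "X \<in> Lie H" "f \<in> C_infinity G" "k \<in> C_infinity G" "g \<in> carrier G"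
    then show "D X (\<lambda>g\<in>carrier G. a * f g + b * k g) g = a * D X f g + b * D X k g"
      unfolding D by (rule flow_deriv_linear_combination[OF flow])
  qed (rule C_infinity_extensional C_infinity_linear_combination; assumption?)+
qed

context closed_linear_group
begin

sublocale lie_closed G
  by unfold_locales (auto intro: subspace_Lie bracket_Lie)

lemma lie_hom_Ad:
  assumes g: "g \<in> carrier G"
  shows "lie_hom G G (AdCx G g)"
proof -
  have lin: "linear (Ad G g)" by (rule bounded_linear.linear[OF bounded_linear_Ad])
  show ?thesis
    unfolding lie_hom_def
    by (auto simp: complexify_def Ad_Lie[OF g] scaleCx_def bracketCx_def Ad_bracket[OF g]
        linear_add[OF lin] linear_diff[OF lin] linear_scale[OF lin])
qed

sublocale lie_group_data G
  by unfold_locales (rule lie_hom_Ad)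

lemma linear_flow_right:
  assumes X: "X \<in> Lie G"
  shows "linear_flow (carrier G) (\<lambda>t g. g \<otimes> Exp G (t *\<^sub>R X)) (\<lambda>g. g \<otimes> X)"
  unfolding linear_flow_def
proof (intro conjI ballI allI)
  show "bounded_linear (\<lambda>g. g \<otimes> X)" by (rule prod.bounded_linear_left)
  fix g assume g: "g \<in> carrier G"
  show "g \<otimes> Exp G (t *\<^sub>R X) \<in> carrier G" for t using g Lie_D[OF X] by simp
  show "g \<otimes> Exp G (0 *\<^sub>R X) = g" by (simp add: ambient_unit)
  show "((\<lambda>t. g \<otimes> Exp G (t *\<^sub>R X)) has_vector_derivative g \<otimes> X) (at 0)"
    by (rule bounded_linear.has_vector_derivative[OF prod.bounded_linear_right Exp_has_vector_derivative])
qed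

lemma linear_flow_left:
  assumes X: "X \<in> Lie G"
  shows "linear_flow (carrier G) (\<lambda>t g. Exp G ((- t) *\<^sub>R X) \<otimes> g) (\<lambda>g. - (X \<otimes> g))"
  unfolding linear_flow_def
proof (intro conjI ballI allI)
  show "bounded_linear (\<lambda>g. - (X \<otimes> g))" by (intro bounded_linear_minus prod.bounded_linear_right)
  fix g assume g: "g \<in> carrier G"
  show "Exp G ((- t) *\<^sub>R X) \<otimes> g \<in> carrier G" for t using g Lie_D[OF X] by (intro m_closed)
  show "Exp G ((- 0) *\<^sub>R X) \<otimes> g = g" by (simp add: ambient_unit)
  have "((\<lambda>t. Exp G (t *\<^sub>R (- X)) \<otimes> g) has_vector_derivative (- X) \<otimes> g) (at 0)"
    by (rule bounded_linear.has_vector_derivative[OF prod.bounded_linear_left Exp_has_vector_derivative])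
  then show "((\<lambda>t. Exp G ((- t) *\<^sub>R X) \<otimes> g) has_vector_derivative - (X \<otimes> g)) (at 0)"
    by (simp add: prod.minus_left)
qed

lemma R_vec_eq: "R_vec G X = flow_deriv (carrier G) (\<lambda>t g. g \<otimes> Exp G (t *\<^sub>R X))"
  by (simp add: fun_eq_iff R_vec_def flow_deriv_def)

lemma L_vec_eq: "L_vec G X = flow_deriv (carrier G) (\<lambda>t g. Exp G ((- t) *\<^sub>R X) \<otimes> g)"
  by (simp add: fun_eq_iff L_vec_def flow_deriv_def)

lemma lie_action_R: "lie_action G (carrier G) (C_infinity G) (R_vec G)"
  by (rule lie_action_flows[OF lie_closed_axioms linear_flow_right _ _ _ R_vec_eq])
    (simp_all add: prod.add_right prod.scaleR_right bracket_def prod.diff_right ambient_assoc)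

lemma lie_action_L:
  assumes "lie_closed H" "Lie H \<subseteq> Lie G" "bracket H = bracket G"
  shows "lie_action H (carrier G) (C_infinity G) (L_vec G)"
proof (rule lie_action_flows[OF assms(1) _ _ _ _ L_vec_eq])
  show "linear_flow (carrier G) (\<lambda>t g. Exp G ((- t) *\<^sub>R X) \<otimes> g) (\<lambda>g. - (X \<otimes> g))" if "X \<in> Lie H" for X
    using that assms(2) by (intro linear_flow_left) blast
qed (simp_all add: assms(3) prod.add_left prod.scaleR_left bracket_def prod.diff_left prod.minus_right ambient_assoc)

end

lemma lie_product_closed_linear_group:
  assumes "closed_linear_group G" "closed_linear_group H"
  shows "lie_product G H"
proof -
  interpret G: closed_linear_group G by fact
  interpret H: closed_linear_group H by fact
  interpret P: closed_linear_group "G \<times>\<times> H" by (rule closed_linear_group_DirProd[OF assms])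
  show ?thesis
    by (intro lie_product.intro lie_product_axioms.intro G.lie_group_data_axioms H.lie_group_data_axioms
        P.lie_group_data_axioms Lie_DirProd[OF assms] G.bracket_zero H.bracket_zero G.one_closed H.one_closed
        G.Ad_unit H.Ad_unit G.Ad_zero H.Ad_zero Ad_DirProd[OF assms])
qed

section \<open>Matrix groups as closed linear groups\<close>

lemma linear_group_simps [simp]:
  "carrier (linear_group S) = S" "x \<otimes>\<^bsub>linear_group S\<^esub> y = x ** y" "\<one>\<^bsub>linear_group S\<^esub> = mat 1"
  by (simp_all add: linear_group_def)

lemma group_linear_group_invertible: "group (linear_group {A :: real^'n^'n. invertible A})"
proof (rule groupI)
  fix A :: "real^'n^'n" assume "A \<in> carrier (linear_group {A. invertible A})"
  then obtain B where "A ** B = mat 1" "B ** A = mat 1" by (auto simp: invertible_def)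
  then show "\<exists>B\<in>carrier (linear_group {A. invertible A}). B \<otimes>\<^bsub>linear_group {A. invertible A}\<^esub> A = \<one>\<^bsub>linear_group {A. invertible A}\<^esub>"
    by (intro bexI[of _ B]) (auto simp: invertible_def)
qed (auto simp: invertible_mult matrix_mul_assoc invertible_def[of "mat 1"])

lemma group_linear_group:
  assumes "subgroup S (linear_group {A. invertible A})"
  shows "group (linear_group S)"
  using subgroup.subgroup_is_group[OF assms group_linear_group_invertible]
  by (simp add: linear_group_def)

lemma bounded_bilinear_matrix_mult: "bounded_bilinear ((**) :: real^'n^'n \<Rightarrow> real^'n^'n \<Rightarrow> real^'n^'n)"
  unfolding bilinear_conv_bounded_bilinear[symmetric] bilinear_def linear_iff
  by (auto simp: matrix_matrix_mult_def vec_eq_iff sum.distrib algebra_simps sum_distrib_left)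

text \<open>A locally closed subgroup is closed: an open subgroup of the algebraic group \<open>H\<close>
  contains every point of \<open>H\<close> in its closure.\<close>

lemma closed_linear_group_linear_group:
  fixes S H :: "(real^'n^'n) set"
  assumes S: "subgroup S (linear_group {A. invertible A})" and H: "algebraic_group H"
    and op: "openin (top_of_set H) S"
  shows "closed_linear_group (linear_group S)"
proof (rule closed_linear_group.intro)
  show "bounded_bilinear (\<lambda>x y. x \<otimes>\<^bsub>linear_group S\<^esub> y)"
    using bounded_bilinear_matrix_mult by simp
  show grp: "group (linear_group S)" by (rule group_linear_group[OF S])
  fix x y :: "real^'n^'n"
  assume "x \<in> closure (carrier (linear_group S))" and "x \<otimes>\<^bsub>linear_group S\<^esub> y = \<one>\<^bsub>linear_group S\<^esub>"
    and "y \<otimes>\<^bsub>linear_group S\<^esub> x = \<one>\<^bsub>linear_group S\<^esub>"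
  then have x: "x \<in> closure S" and xy: "x ** y = mat 1" "y ** x = mat 1" by simp_all
  obtain P where P: "\<forall>p\<in>P. real_polynomial_function p" "H = {A. invertible A \<and> (\<forall>p\<in>P. p A = 0)}"
    using H unfolding algebraic_group_def by blast
  have HG: "subgroup H (linear_group {A. invertible A})" using H unfolding algebraic_group_def by blast
  interpret S: group "linear_group S" by (rule grp)
  interpret Hs: group "linear_group H" by (rule group_linear_group[OF HG])
  obtain U where U: "open U" "S = H \<inter> U" using op unfolding openin_open by blast
  \<comment> \<open>The defining polynomials of \<open>H\<close> vanish on \<open>S\<close> and, by
    continuity, on its closure; since \<open>x\<close> is invertible, it lies in
    \<open>H\<close>.\<close>
  have "p x = 0" if p: "p \<in> P" for p
  proof -
    have "continuous_on UNIV p"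
      using P(1) p by (simp add: real_polynomial_function_eq continuous_on_polymonial_function)
    moreover have "\<forall>z\<in>S. p z = 0" using U P(2) p by auto
    ultimately show ?thesis
      using x continuous_constant_on_closure[of S p 0] continuous_on_subset by blast
  qed
  then have xH: "x \<in> H" using P(2) xy by (auto simp: invertible_def)
  have yH: "y \<in> H"
  proof -
    have "inv\<^bsub>linear_group H\<^esub> x ** x = mat 1" using Hs.l_inv[of x] xH by simp
    then have "inv\<^bsub>linear_group H\<^esub> x = y"
      using xy(1) by (metis matrix_mul_assoc matrix_mul_lid matrix_mul_rid)
    then show ?thesis using Hs.inv_closed[of x] xH by simp
  qed
  \<comment> \<open>Multiplication by the inverse \<open>y\<close> moves a neighbourhood of
    \<open>x\<close> to one of the unit. Some \<open>z\<close> in \<open>S\<close> close to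
    \<open>x\<close> then has \<open>y ** z\<close> in \<open>H\<close> and in \<open>U\<close>,
    hence in \<open>S\<close>, and \<open>x\<close> is recovered as \<open>z\<close> times the
    inverse of \<open>y ** z\<close>.\<close>
  have "continuous_on UNIV (\<lambda>z :: real^'n^'n. y ** z)"
    by (rule linear_continuous_on[OF bounded_bilinear.bounded_linear_right[OF bounded_bilinear_matrix_mult]])
  then have "open ((\<lambda>z :: real^'n^'n. y ** z) -` U)" using U(1) by (simp add: continuous_on_open_vimage)
  moreover have "x \<in> (\<lambda>z. y ** z) -` U" using xy S.one_closed U(2) by auto
  ultimately obtain z where z: "z \<in> S" "y ** z \<in> U"
    using x unfolding closure_iff_nhds_not_empty by blast
  have "y ** z \<in> S" using Hs.m_closed[of y z] yH z U(2) by auto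
  then have "z ** inv\<^bsub>linear_group S\<^esub> (y ** z) \<in> S" using S.m_closed[of z] S.inv_closed[of "y ** z"] z by simp
  moreover have "z ** inv\<^bsub>linear_group S\<^esub> (y ** z) = x"
  proof -
    have "y ** (z ** inv\<^bsub>linear_group S\<^esub> (y ** z)) = mat 1"
      using S.r_inv[of "y ** z"] \<open>y ** z \<in> S\<close> by (simp add: matrix_mul_assoc)
    then show ?thesis using xy(1) by (metis matrix_mul_assoc matrix_mul_lid matrix_mul_rid)
  qed
  ultimately show "x \<in> carrier (linear_group S)" by simp
qed (simp_all add: matrix_mul_assoc)


section \<open>Shintani functions\<close>

lemma smooth_on_det:
  fixes M :: "'a::euclidean_space \<Rightarrow> real^'n^'n"
  assumes "open S" "\<And>i j. smooth_on S (\<lambda>x. of_real (M x $ i $ j))"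
  shows "smooth_on S (\<lambda>x. of_real (det (M x)))"
  using assms unfolding smooth_on_def det_def of_real_sum of_real_mult of_real_prod
  by (intro allI Ck_on_sum Ck_on_mult Ck_on_prod Ck_on_const) auto

lemma matrix_inv_mult:
  assumes "invertible A"
  shows "A ** matrix_inv A = mat 1" "matrix_inv A ** A = mat 1"
  using someI_ex[OF assms[unfolded invertible_def]] unfolding matrix_inv_def by auto

text \<open>Cramer's rule, applied to the columns of the inverse. It makes the entries quotients of
  determinants, so that smoothness follows from that of products, sums and reciprocals.\<close>

lemma matrix_inv_entry:
  fixes A :: "real^'n^'n"
  assumes "det A \<noteq> 0"
  shows "matrix_inv A $ i $ k = det (\<chi> r c. if c = i then axis k 1 $ r else A $ r $ c) / det A"
proof -
  have "A *v (matrix_inv A *v axis k 1) = axis k 1"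
    using assms by (simp add: matrix_vector_mul_assoc matrix_inv_mult invertible_det_nz)
  then have "matrix_inv A *v axis k 1 = (\<chi> i. det (\<chi> r c. if c = i then axis k 1 $ r else A $ r $ c) / det A)"
    using cramer[OF assms] by blast
  moreover have "(matrix_inv A *v axis k 1) $ i = matrix_inv A $ i $ k"
    by (simp add: matrix_vector_mult_basis column_def)
  ultimately show ?thesis by simp
qed

lemma smooth_on_matrix_inv_entry:
  fixes M :: "'a::euclidean_space \<Rightarrow> real^'n^'n"
  assumes S: "open S" and M: "\<And>i j. smooth_on S (\<lambda>x. of_real (M x $ i $ j))"
    and det: "\<And>x. x \<in> S \<Longrightarrow> det (M x) \<noteq> 0"
  shows "smooth_on S (\<lambda>x. of_real (matrix_inv (M x) $ i $ k))"
  unfolding smooth_on_def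
proof
  fix n
  let ?N = "\<lambda>x. \<chi> r c. if c = i then axis k 1 $ r else M x $ r $ c"
  have "smooth_on S (\<lambda>x. of_real (?N x $ r $ c))" for r c
    using M[of r c] Ck_on_const[OF S] by (cases "c = i") (simp_all add: smooth_on_def)
  then have "Ck_on n (\<lambda>x. of_real (det (?N x))) S"
    using smooth_on_det[OF S, of ?N] by (simp add: smooth_on_def)
  moreover have "Ck_on n (\<lambda>x. inverse (of_real (det (M x)))) S"
    using smooth_on_det[OF S M] det by (intro Ck_on_inverse[OF S]) (auto simp: smooth_on_def)
  ultimately have "Ck_on n (\<lambda>x. of_real (det (?N x)) * inverse (of_real (det (M x)))) S"
    by (rule Ck_on_mult[OF S])
  moreover have "of_real (matrix_inv (M x) $ i $ k) = complex_of_real (det (?N x)) * inverse (of_real (det (M x)))"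
    if "x \<in> S" for x
    using matrix_inv_entry[OF det[OF that]] by (simp add: divide_inverse)
  ultimately show "Ck_on n (\<lambda>x. of_real (matrix_inv (M x) $ i $ k)) S"
    using Ck_on_cong[OF S, of "\<lambda>x. of_real (matrix_inv (M x) $ i $ k)"
        "\<lambda>x. of_real (det (?N x)) * inverse (of_real (det (M x)))" n] by simp
qed

lemma smooth_on_of_real_linear:
  assumes "open S" "bounded_linear L"
  shows "smooth_on S (\<lambda>x. of_real (L x))"
  unfolding smooth_on_def
  by (intro allI Ck_on_linear[OF assms(1)] bounded_linear_compose[OF bounded_linear_of_real assms(2)])

text \<open>A formula for \<open>psi\<close> that makes sense off the group: it is smooth on the
  open set where the second matrix is invertible, which is what smoothness on an embedded group asks
  for.\<close>

definition matrix_quotient :: "(real^'n^'n) \<times> (real^'n^'n) \<Rightarrow> real^'n^'n"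
  where "matrix_quotient x = matrix_inv (snd x) ** fst x"

lemma open_det_nonzero: "open {x :: (real^'n^'n) \<times> (real^'n^'n). det (snd x) \<noteq> 0}"
proof -
  have "smooth_on UNIV (\<lambda>x :: (real^'n^'n) \<times> (real^'n^'n). of_real (det (snd x)))"
  proof (rule smooth_on_det[OF open_UNIV])
    have "bounded_linear (\<lambda>x :: (real^'n^'n) \<times> (real^'n^'n). snd x $ i $ j)" for i j
      by (intro bounded_linear_compose[OF bounded_linear_vec_nth]
          bounded_linear_compose[OF bounded_linear_vec_nth] bounded_linear_snd)
    then show "smooth_on UNIV (\<lambda>x :: (real^'n^'n) \<times> (real^'n^'n). of_real (snd x $ i $ j))" for i j
      by (rule smooth_on_of_real_linear[OF open_UNIV])
  qed
  from continuous_on_Re[OF smooth_on_continuous[OF this]]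
  have "continuous_on UNIV (\<lambda>x :: (real^'n^'n) \<times> (real^'n^'n). det (snd x))" by simp
  then show ?thesis by (intro open_Collect_neq continuous_on_const)
qed

lemma smooth_on_matrix_quotient:
  assumes "b \<in> Basis"
  shows "smooth_on {x :: (real^'n^'n) \<times> (real^'n^'n). det (snd x) \<noteq> 0} (\<lambda>x. of_real (matrix_quotient x \<bullet> b))"
    (is "smooth_on ?U _")
proof -
  obtain i j where b: "b = axis i (axis j 1)"
    using assms by (auto simp: Basis_vec_def)
  have comp: "matrix_quotient x \<bullet> b = (\<Sum>k\<in>UNIV. matrix_inv (snd x) $ i $ k * fst x $ k $ j)" for x
    by (simp add: b inner_axis matrix_quotient_def matrix_matrix_mult_def)
  have lin: "bounded_linear (\<lambda>x :: (real^'n^'n) \<times> (real^'n^'n). snd x $ r $ c)"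
    "bounded_linear (\<lambda>x :: (real^'n^'n) \<times> (real^'n^'n). fst x $ r $ c)" for r c
    by (intro bounded_linear_compose[OF bounded_linear_vec_nth]
        bounded_linear_compose[OF bounded_linear_vec_nth] bounded_linear_snd bounded_linear_fst)+
  have inv: "smooth_on ?U (\<lambda>x. of_real (matrix_inv (snd x) $ i $ k))" for k
    by (rule smooth_on_matrix_inv_entry[OF open_det_nonzero
          smooth_on_of_real_linear[OF open_det_nonzero lin(1)]]) simp
  have fst: "smooth_on ?U (\<lambda>x. of_real (fst x $ k $ j))" for k
    by (rule smooth_on_of_real_linear[OF open_det_nonzero lin(2)])
  show ?thesis
    unfolding smooth_on_def comp of_real_sum of_real_mult
    using inv fst unfolding smooth_on_def
    by (intro allI Ck_on_sum[OF open_det_nonzero] Ck_on_mult[OF open_det_nonzero]) auto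
qed

lemma inv_linear_group:
  assumes "group (linear_group S)" "x \<in> S"
  shows "inv\<^bsub>linear_group S\<^esub> x = matrix_inv x"
proof -
  interpret group "linear_group S" by fact
  have "inv\<^bsub>linear_group S\<^esub> x ** x = mat 1" "x ** inv\<^bsub>linear_group S\<^esub> x = mat 1"
    using l_inv[of x] r_inv[of x] assms(2) by simp_all
  moreover from this have "invertible x" unfolding invertible_def by blast
  ultimately show ?thesis
    using matrix_inv_mult[of x] by (metis matrix_mul_assoc matrix_mul_lid matrix_mul_rid)
qed

lemma Exp_linear_group: "Exp (linear_group S) = Exp (linear_group T)"
  by (simp add: fun_eq_iff Exp_def nat_pow_def linear_group_def)

lemma bracket_linear_group: "bracket (linear_group S) = bracket (linear_group T)"
  by (simp add: fun_eq_iff bracket_def)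

lemma Lie_linear_group_mono: "S \<subseteq> T \<Longrightarrow> Lie (linear_group S) \<subseteq> Lie (linear_group T)"
  using Exp_linear_group[of S T] by (auto simp: Lie_def)

section \<open>Pull-back along psi: derivatives, smoothness and eigenfunctions\<close>

locale shintani_pair =
  fixes G G' :: "(real^'n^'n) set"
  assumes closed_G: "closed_linear_group (linear_group G)"
    and closed_G': "closed_linear_group (linear_group G')"
    and sub: "G' \<subseteq> G"
begin

abbreviation "gG \<equiv> linear_group G"
abbreviation "gH \<equiv> linear_group G'"
abbreviation "gP \<equiv> gG \<times>\<times> gH"

sublocale G: closed_linear_group gG by (rule closed_G)
sublocale H: closed_linear_group gH by (rule closed_G')
sublocale P: closed_linear_group gP by (rule closed_linear_group_DirProd[OF closed_G closed_G'])
sublocale prod: lie_product gG gH by (rule lie_product_closed_linear_group[OF closed_G closed_G'])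

sublocale RG: lie_action gG G "C_infinity gG" "R_vec gG"
  using G.lie_action_R by simp

sublocale LG: lie_action gH G "C_infinity gG" "L_vec gG"
  using G.lie_action_L[OF H.lie_closed_axioms Lie_linear_group_mono[OF sub] bracket_linear_group] by simp

sublocale RP: lie_action gP "G \<times> G'" "C_infinity gP" "R_vec gP"
  using P.lie_action_R by (simp add: DirProd_def)

lemma psi_eq: "y \<in> G' \<Longrightarrow> psi G (x, y) = matrix_inv y ** x"
  using inv_linear_group[OF G.group_G, of y] sub by (auto simp: psi_def)

lemma inv_in: "y \<in> G' \<Longrightarrow> matrix_inv y \<in> G'"
  using inv_linear_group[OF H.group_G, of y] H.inv_closed[of y] by simp

lemma mult_G: "x \<in> G \<Longrightarrow> y \<in> G \<Longrightarrow> x ** y \<in> G" and mult_G': "x \<in> G' \<Longrightarrow> y \<in> G' \<Longrightarrow> x ** y \<in> G'"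
  using G.m_closed[of x y] H.m_closed[of x y] by simp_all

lemma one_G': "mat 1 \<in> G'"
  using H.one_closed by simp

lemma invertible_G: "x \<in> G \<Longrightarrow> invertible x"
  using G.r_inv[of x] G.l_inv[of x] unfolding invertible_def by auto

lemma inv_mult_G: "x \<in> G \<Longrightarrow> matrix_inv x ** x = mat 1" "x \<in> G \<Longrightarrow> x ** matrix_inv x = mat 1"
  using matrix_inv_mult[OF invertible_G] by auto

lemma matrix_inv_prod: "x \<in> G \<Longrightarrow> y \<in> G \<Longrightarrow> matrix_inv (x ** y) = matrix_inv y ** matrix_inv x"
  using G.inv_mult_group[of x y] inv_linear_group[OF G.group_G] mult_G[of x y] by simp

lemma matrix_inv_one: "matrix_inv (mat 1) = (mat 1 :: real^'n^'n)"
  using G.inv_one inv_linear_group[OF G.group_G] G.one_closed by simp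

lemma psi_in: "x \<in> G \<Longrightarrow> y \<in> G' \<Longrightarrow> matrix_inv y ** x \<in> G"
  using inv_in sub by (intro mult_G) auto

lemma pullback_apply: "x \<in> G \<Longrightarrow> y \<in> G' \<Longrightarrow> psi_pullback G G' f (x, y) = f (matrix_inv y ** x)"
  by (simp add: psi_pullback_def psi_eq)

lemma pullback_eqI:
  assumes "F \<in> extensional (G \<times> G')" "\<And>x y. x \<in> G \<Longrightarrow> y \<in> G' \<Longrightarrow> F (x, y) = f (matrix_inv y ** x)"
  shows "F = psi_pullback G G' f"
  using assms by (intro extensionalityI[where A = "G \<times> G'"]) (auto simp: psi_eq psi_pullback_def)

lemma R_vec_emb1:
  assumes X: "X \<in> Lie gG"
  shows "R_vec gP (X, 0) (psi_pullback G G' f) = psi_pullback G G' (R_vec gG X f)"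
proof (rule pullback_eqI)
  fix x y assume x: "x \<in> G" and y: "y \<in> G'"
  have "psi_pullback G G' f ((x, y) \<otimes>\<^bsub>gP\<^esub> Exp gP (t *\<^sub>R (X, 0))) = f (matrix_inv y ** x ** Exp gG (t *\<^sub>R X))" for t
    using G.Lie_D[OF X, of t] x y
    by (simp add: Exp_DirProd[OF closed_G closed_G'] pullback_apply mult_G matrix_mul_assoc)
  then show "R_vec gP (X, 0) (psi_pullback G G' f) (x, y) = R_vec gG X f (matrix_inv y ** x)"
    using x y psi_in by (simp add: R_vec_def)
qed (simp add: R_vec_def)

text \<open>Inversion in \<open>psi\<close> turns right translation of the second variable into left
  translation: the inverse of y exp(tY) is exp(-tY) times the inverse of y, which is precisely the
  sign convention of \<open>L_vec\<close>.\<close>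

lemma R_vec_emb2:
  assumes Y: "Y \<in> Lie gH"
  shows "R_vec gP (0, Y) (psi_pullback G G' f) = psi_pullback G G' (L_vec gG Y f)"
proof (rule pullback_eqI)
  fix x y assume x: "x \<in> G" and y: "y \<in> G'"
  have YG: "Y \<in> Lie gG" using Y Lie_linear_group_mono[OF sub] by blast
  have "psi_pullback G G' f ((x, y) \<otimes>\<^bsub>gP\<^esub> Exp gP (t *\<^sub>R (0, Y))) = f (Exp gG ((- t) *\<^sub>R Y) ** (matrix_inv y ** x))" for t
  proof -
    have E: "Exp gH (t *\<^sub>R Y) = Exp gG (t *\<^sub>R Y)" "Exp gG (t *\<^sub>R Y) \<in> G'" "Exp gG (t *\<^sub>R Y) \<in> G"
      using H.Lie_D[OF Y, of t] sub Exp_linear_group[of G' G] by auto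
    have "matrix_inv (y ** Exp gG (t *\<^sub>R Y)) = Exp gG ((- t) *\<^sub>R Y) ** matrix_inv y"
      using G.inv_Exp[OF YG, of t] inv_linear_group[OF G.group_G E(3)] y sub E by (simp add: matrix_inv_prod subset_iff)
    then show ?thesis
      using x y E by (simp add: Exp_DirProd[OF closed_G closed_G'] pullback_apply mult_G' matrix_mul_assoc)
  qed
  then show "R_vec gP (0, Y) (psi_pullback G G' f) (x, y) = L_vec gG Y f (matrix_inv y ** x)"
    using x y psi_in by (simp add: R_vec_def L_vec_def)
qed (simp add: R_vec_def)

lemma act_emb1: "Z \<in> LieCx gG \<Longrightarrow> RP.act (emb1 Z) (psi_pullback G G' f) = psi_pullback G G' (RG.act Z f)"
  by (rule pullback_eqI; cases Z)
    (auto simp: act_Cx_def complexify_def R_vec_emb1 pullback_apply psi_in)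

lemma act_emb2: "Z \<in> LieCx gH \<Longrightarrow> RP.act (emb2 Z) (psi_pullback G G' f) = psi_pullback G G' (LG.act Z f)"
  by (rule pullback_eqI; cases Z)
    (auto simp: act_Cx_def complexify_def R_vec_emb2 pullback_apply psi_in)

lemma foldr_emb:
  assumes "set u \<subseteq> LieCx gG" "set v \<subseteq> LieCx gH"
  shows "foldr RP.act (map emb1 u @ map emb2 v) (psi_pullback G G' f) =
    psi_pullback G G' (foldr RG.act u (foldr LG.act v f))"
proof -
  have "foldr RP.act (map emb2 v) (psi_pullback G G' f) = psi_pullback G G' (foldr LG.act v f)"
    using assms(2) by (induction v) (simp_all add: act_emb2)
  moreover have "foldr RP.act (map emb1 u) (psi_pullback G G' f) = psi_pullback G G' (foldr RG.act u f)" for f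
    using assms(1) by (induction u) (simp_all add: act_emb1)
  ultimately show ?thesis by simp
qed

text \<open>A local extension of \<open>f\<close> is composed with \<open>matrix_quotient\<close>,
  on the part of its open domain that is mapped into the domain of the extension.\<close>

lemma pullback_smooth:
  assumes f: "f \<in> C_infinity gG"
  shows "psi_pullback G G' f \<in> C_infinity gP"
proof (rule C_infinityI)
  show "psi_pullback G G' f \<in> extensional (carrier gP)" by (simp add: psi_pullback_def)
  fix z assume "z \<in> carrier gP"
  then obtain x y where z: "z = (x, y)" and x: "x \<in> G" and y: "y \<in> G'" by auto
  let ?U = "{x :: (real^'n^'n) \<times> (real^'n^'n). det (snd x) \<noteq> 0}"
  have q: "matrix_quotient z \<in> carrier gG" using psi_in[OF x y] by (simp add: z matrix_quotient_def)
  obtain T h where T: "open T" "matrix_quotient z \<in> T" "smooth_on T h" "\<forall>x\<in>T \<inter> carrier gG. f x = h x"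
    using f q by (rule C_infinity_local)
  let ?S = "?U \<inter> matrix_quotient -` T"
  have "continuous_on ?U (\<lambda>x. matrix_quotient x \<bullet> b)" if "b \<in> Basis" for b
    using continuous_on_Re[OF smooth_on_continuous[OF smooth_on_matrix_quotient[OF that]]] by simp
  then have "continuous_on ?U matrix_quotient" using continuous_on_componentwise by blast
  then have S: "open ?S" using open_det_nonzero T(1) by (rule continuous_open_preimage)
  have "smooth_on ?S (\<lambda>x. h (matrix_quotient x))"
  proof (rule smooth_on_compose[OF S T(1) _ _ T(3)])
    show "smooth_on ?S (\<lambda>x. of_real (matrix_quotient x \<bullet> b))" if "b \<in> Basis" for b
      by (rule smooth_on_subset[OF smooth_on_matrix_quotient[OF that] Int_lower1])
  qed auto
  moreover have "z \<in> ?S"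
    using T(2) invertible_G[of y] y sub by (auto simp: z invertible_det_nz)
  moreover have "\<forall>x\<in>?S \<inter> carrier gP. psi_pullback G G' f x = h (matrix_quotient x)"
    using T(4) psi_in by (auto simp: pullback_apply matrix_quotient_def)
  ultimately show "\<exists>S h. open S \<and> z \<in> S \<and> smooth_on S h \<and> (\<forall>x\<in>S \<inter> carrier gP. psi_pullback G G' f x = h x)"
    using S by blast
qed

lemma slice_smooth:
  assumes F: "F \<in> C_infinity gP"
  shows "(\<lambda>x\<in>G. F (x, mat 1)) \<in> C_infinity gG"
proof (rule C_infinityI)
  fix x assume "x \<in> carrier gG"
  then have x: "(x, mat 1) \<in> carrier gP" using one_G' by simp
  obtain T h where T: "open T" "(x, mat 1) \<in> T" "smooth_on T h" "\<forall>x\<in>T \<inter> carrier gP. F x = h x"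
    using F x by (rule C_infinity_local)
  let ?e = "\<lambda>x :: real^'n^'n. (x, mat 1 :: real^'n^'n)"
  let ?S = "?e -` T"
  have S: "open ?S" using T(1) by (intro open_vimage continuous_intros)
  have "smooth_on ?S (\<lambda>x. h (?e x))"
  proof (rule smooth_on_compose[OF S T(1) _ _ T(3)])
    fix b :: "(real^'n^'n) \<times> (real^'n^'n)"
    have "Ck_on k (\<lambda>x. of_real (x \<bullet> fst b) + of_real (mat 1 \<bullet> snd b)) ?S" for k
      using smooth_on_of_real_linear[OF S bounded_linear_inner_left, of "fst b"]
      by (intro Ck_on_add[OF S] Ck_on_const[OF S]) (simp add: smooth_on_def)
    then show "smooth_on ?S (\<lambda>x. of_real (?e x \<bullet> b))"
      by (simp add: smooth_on_def inner_prod_def)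
  qed auto
  moreover have "\<forall>y\<in>?S \<inter> carrier gG. (\<lambda>x\<in>G. F (x, mat 1)) y = h (?e y)"
    using T(4) one_G' by simp
  moreover have "x \<in> ?S" using T(2) by simp
  ultimately show "\<exists>S h. open S \<and> x \<in> S \<and> smooth_on S h \<and> (\<forall>y\<in>S \<inter> carrier gG. (\<lambda>x\<in>G. F (x, mat 1)) y = h y)"
    using S by blast
qed simp

lemma R_op_class: "p \<in> carrier G.FA \<Longrightarrow> f \<in> C_infinity gG \<Longrightarrow> x \<in> G \<Longrightarrow>
    R_op gG (U_class gG p) f x = pairing p (\<lambda>w. foldr RG.act w f x)"
  using RG.act_U_class by (simp add: R_op_def)

lemma L_op_class: "p \<in> carrier H.FA \<Longrightarrow> f \<in> C_infinity gG \<Longrightarrow> x \<in> G \<Longrightarrow>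
    L_op gG (U_class gH p) f x = pairing p (\<lambda>w. foldr LG.act w f x)"
  using LG.act_U_class by (simp add: L_op_def)

lemma R_op_P_class: "p \<in> carrier P.FA \<Longrightarrow> F \<in> C_infinity gP \<Longrightarrow> z \<in> G \<times> G' \<Longrightarrow>
    R_op gP (U_class gP p) F z = pairing p (\<lambda>w. foldr RP.act w F z)"
  using RP.act_U_class by (simp add: R_op_def)

lemma pairing_emb_pullback:
  assumes "a \<in> carrier G.FA" "b \<in> carrier H.FA" "x \<in> G" "y \<in> G'"
  shows "pairing (free_mult (push emb1 a) (push emb2 b)) (\<lambda>w. foldr RP.act w (psi_pullback G G' f) (x, y)) =
    pairing2 a b (\<lambda>u v. foldr RG.act u (foldr LG.act v f) (matrix_inv y ** x))"
proof -
  have "pairing (free_mult (push emb1 a) (push emb2 b)) (\<lambda>w. foldr RP.act w (psi_pullback G G' f) (x, y)) =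
      pairing2 a b (\<lambda>u v. foldr RP.act (map emb1 u @ map emb2 v) (psi_pullback G G' f) (x, y))"
    using assms(1,2) by (intro pairing_emb_mult) (simp_all add: fin_supp_carrier)
  also have "\<dots> = pairing2 a b (\<lambda>u v. foldr RG.act u (foldr LG.act v f) (matrix_inv y ** x))"
  proof (intro pairing_cong)
    fix u v assume "a u \<noteq> 0" "b v \<noteq> 0"
    then have "set u \<subseteq> LieCx gG" "set v \<subseteq> LieCx gH"
      using assms(1,2) by (simp_all add: free_algebra_carrier_iff)
    then show "foldr RP.act (map emb1 u @ map emb2 v) (psi_pullback G G' f) (x, y) =
        foldr RG.act u (foldr LG.act v f) (matrix_inv y ** x)"
      by (simp only: foldr_emb pullback_apply[OF assms(3,4)])
  qed
  finally show ?thesis .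
qed

context
  fixes chi chi' f
  assumes f: "f \<in> C_infinity gG"
    and R: "\<forall>u\<in>ZG gG. \<forall>g\<in>G. R_op gG u f g = chi u * f g"
    and L: "\<forall>v\<in>ZG gH. \<forall>g\<in>G. L_op gG v f g = chi' v * f g"
begin

text \<open>On normally ordered words the pull-back relation turns derivatives into left derivatives
  followed by right ones. The left combination reproduces a multiple of \<open>f\<close>, the scalar
  comes out, and the right combination contributes the other eigenvalue.\<close>

lemma pairing_emb_eigen:
  assumes a: "a \<in> carrier G.FA" "U_class gG a \<in> ZG gG" and b: "b \<in> carrier H.FA" "U_class gH b \<in> ZG gH"
    and xy: "x \<in> G" "y \<in> G'"
  shows "pairing (free_mult (push emb1 a) (push emb2 b)) (\<lambda>w. foldr RP.act w (psi_pullback G G' f) (x, y)) =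
    chi (U_class gG a) * chi' (U_class gH b) * psi_pullback G G' f (x, y)"
proof -
  let ?z = "matrix_inv y ** x" and ?c = "chi' (U_class gH b)"
  have z: "?z \<in> G" by (rule psi_in[OF xy])
  \<comment> \<open>The summand \<open>0 * f g\<close> only brings the multiple of \<open>f\<close>
    into the shape of a linear combination expected by \<open>foldr_act_lin\<close>.\<close>
  have Lb: "(\<lambda>g\<in>G. pairing b (\<lambda>v. foldr LG.act v f g)) = (\<lambda>g\<in>G. ?c * f g + 0 * f g)"
    using L b L_op_class[OF b(1) f] by (auto simp: restrict_def fun_eq_iff)
  have "pairing b (\<lambda>v. foldr RG.act u (foldr LG.act v f) ?z) = ?c * foldr RG.act u f ?z" if "a u \<noteq> 0" for u
  proof -
    have u: "set u \<subseteq> LieCx gG" using that a(1) by (simp add: free_algebra_carrier_iff)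
    have bV: "set v \<subseteq> LieCx gH" if "b v \<noteq> 0" for v
      using that b(1) by (simp add: free_algebra_carrier_iff)
    have "pairing b (\<lambda>v. foldr RG.act u (foldr LG.act v f) ?z) =
        foldr RG.act u (\<lambda>g\<in>G. pairing b (\<lambda>v. foldr LG.act v f g)) ?z"
      by (rule RG.foldr_act_pairing[OF u fin_supp_carrier[OF b(1)] LG.foldr_act_M[OF bV f] f z, symmetric])
    then show ?thesis
      unfolding Lb RG.foldr_act_lin[OF u f f] using z by simp
  qed
  then have "pairing2 a b (\<lambda>u v. foldr RG.act u (foldr LG.act v f) ?z) = pairing a (\<lambda>u. ?c * foldr RG.act u f ?z)"
    by (rule pairing_cong)
  also have "\<dots> = ?c * R_op gG (U_class gG a) f ?z"
    by (simp add: pairing_right_scale R_op_class[OF a(1) f z])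
  also have "\<dots> = chi (U_class gG a) * ?c * f ?z" using R a(2) z by simp
  finally show ?thesis
    unfolding pairing_emb_pullback[OF a(1) b(1) xy] pullback_apply[OF xy] .
qed

lemma pullback_eigen:
  assumes chi: "chi \<in> ZG_characters gG" "chi' \<in> ZG_characters gH"
    and u: "u \<in> ZG gP" and xy: "x \<in> G" "y \<in> G'"
  shows "R_op gP u (psi_pullback G G' f) (x, y) =
    product_character gG gH chi chi' u * psi_pullback G G' f (x, y)"
  using u
proof (rule prod.ZG_product_decomposition)
  fix A :: "((((real^'n^'n) \<times> (real^'n^'n)) \<times> ((real^'n^'n) \<times> (real^'n^'n))) list \<times> nat) set" and a b
  assume A: "finite A"
    "\<And>i. i \<in> A \<Longrightarrow> a i \<in> carrier G.FA" "\<And>i. i \<in> A \<Longrightarrow> b i \<in> carrier H.FA"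
    "\<And>i. i \<in> A \<Longrightarrow> U_class gG (a i) \<in> ZG gG" "\<And>i. i \<in> A \<Longrightarrow> U_class gH (b i) \<in> ZG gH"
    and u: "u = U_class gP (\<lambda>w. \<Sum>i\<in>A. free_mult (push emb1 (a i)) (push emb2 (b i)) w)"
  let ?x = "\<lambda>i. free_mult (push emb1 (a i)) (push emb2 (b i))"
  let ?F = "\<lambda>w. foldr RP.act w (psi_pullback G G' f) (x, y)"
  have x: "?x i \<in> carrier P.FA" if "i \<in> A" for i using that A by (intro prod.emb_mult_in)
  have X: "(\<lambda>w. \<Sum>i\<in>A. ?x i w) \<in> carrier P.FA"
    using x by (induction rule: finite_induct[OF A(1)]) (auto simp: carrier_zero carrier_add)
  have "R_op gP u (psi_pullback G G' f) (x, y) = pairing (\<lambda>w. \<Sum>i\<in>A. ?x i w) ?F"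
    unfolding u using xy by (intro R_op_P_class[OF X pullback_smooth[OF f]]) simp
  also have "\<dots> = (\<Sum>i\<in>A. pairing (?x i) ?F)"
    by (intro conjunct2[OF pairing_sum_left] A(1) fin_supp_carrier[OF x])
  also have "\<dots> = (\<Sum>i\<in>A. chi (U_class gG (a i)) * chi' (U_class gH (b i))) * psi_pullback G G' f (x, y)"
    unfolding sum_distrib_right using A xy by (intro sum.cong refl pairing_emb_eigen)
  also have "(\<Sum>i\<in>A. chi (U_class gG (a i)) * chi' (U_class gH (b i))) = product_character gG gH chi chi' u"
    unfolding u
    by (rule prod.extends_pair_sum[OF chi prod.product_character_extends[OF chi] A, symmetric])
  finally show ?thesis .
qed

end

lemma pullback_inj: "inj_on (psi_pullback G G') (extensional G)"
proof (rule inj_onI)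
  fix f k :: "real^'n^'n \<Rightarrow> complex"
  assume fk: "f \<in> extensional G" "k \<in> extensional G" and eq: "psi_pullback G G' f = psi_pullback G G' k"
  show "f = k"
  proof (rule extensionalityI[OF fk])
    fix x assume "x \<in> G"
    then show "f x = k x"
      using fun_cong[OF eq, of "(x, mat 1)"] one_G' by (simp add: pullback_apply matrix_inv_one)
  qed
qed

context
  fixes K K' chi chi'
  assumes K: "K \<subseteq> G" and K': "subgroup K' gH"
    and chi: "chi \<in> ZG_characters gG" "chi' \<in> ZG_characters gH"
begin

abbreviation "target \<equiv> left_invariants gP ((\<lambda>x. (x, x)) ` G')
  (C_infinity_eigen gP (K \<times> K') (product_character gG gH chi chi'))"

lemma K'_inv: "k \<in> K' \<Longrightarrow> matrix_inv k \<in> K'" and K'_G': "k \<in> K' \<Longrightarrow> k \<in> G'"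
proof -
  have sub: "K' \<subseteq> G'" using subgroup.subset[OF K'] by simp
  show "k \<in> K' \<Longrightarrow> matrix_inv k \<in> K'"
    using subgroup.m_inv_closed[OF K', of k] inv_linear_group[OF H.group_G, of k] sub by auto
  show "k \<in> K' \<Longrightarrow> k \<in> G'" using sub by blast
qed

lemma pullback_Sh:
  assumes "f \<in> Sh G G' K K' chi chi'"
  shows "psi_pullback G G' f \<in> target"
proof -
  have f: "f \<in> C_infinity gG"
    and inv: "\<And>k' g k. k' \<in> K' \<Longrightarrow> g \<in> G \<Longrightarrow> k \<in> K \<Longrightarrow> f (k' ** g ** k) = f g"
    and R: "\<forall>u\<in>ZG gG. \<forall>g\<in>G. R_op gG u f g = chi u * f g"
    and L: "\<forall>v\<in>ZG gH. \<forall>g\<in>G. L_op gG v f g = chi' v * f g"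
    using assms unfolding Sh_def by blast+
  show ?thesis
    unfolding left_invariants_def C_infinity_eigen_def
  proof (intro CollectI conjI ballI pullback_smooth f)
    fix z kk assume "z \<in> carrier gP" "kk \<in> K \<times> K'"
    then obtain x y k k' where z: "z = (x, y)" "kk = (k, k')" "x \<in> G" "y \<in> G'" "k \<in> K" "k' \<in> K'" by auto
    have in_G: "k \<in> G" "k' \<in> G'" "y \<in> G" "k' \<in> G" using z K K'_G' sub by auto
    have "psi_pullback G G' f (z \<otimes>\<^bsub>gP\<^esub> kk) = f (matrix_inv k' ** (matrix_inv y ** x) ** k)"
      using z in_G by (simp add: pullback_apply mult_G mult_G' matrix_inv_prod matrix_mul_assoc)
    also have "\<dots> = f (matrix_inv y ** x)"
      using z K'_inv psi_in by (intro inv) auto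
    finally show "psi_pullback G G' f (z \<otimes>\<^bsub>gP\<^esub> kk) = psi_pullback G G' f z"
      using z by (simp add: pullback_apply)
  next
    fix u z assume "u \<in> ZG gP" "z \<in> carrier gP"
    then show "R_op gP u (psi_pullback G G' f) z = product_character gG gH chi chi' u * psi_pullback G G' f z"
      using pullback_eigen[OF f R L chi] by auto
  next
    fix d z assume "d \<in> (\<lambda>x. (x, x)) ` G'" "z \<in> carrier gP"
    then obtain h x y where z: "d = (h, h)" "z = (x, y)" "h \<in> G'" "x \<in> G" "y \<in> G'" by auto
    have in_G: "h \<in> G" "y \<in> G" using z sub by auto
    have "matrix_inv (h ** y) ** (h ** x) = matrix_inv y ** ((matrix_inv h ** h) ** x)"
      using in_G by (simp add: matrix_inv_prod matrix_mul_assoc)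
    then show "psi_pullback G G' f (d \<otimes>\<^bsub>gP\<^esub> z) = psi_pullback G G' f z"
      using z in_G by (simp add: pullback_apply mult_G mult_G' inv_mult_G)
  qed
qed

text \<open>The preimage is the slice of \<open>F\<close> at \<open>mat 1\<close>. Its two
  eigenvalue equations come from the single one for \<open>F\<close> by testing products of an
  invariant of one factor with the unit of the other.\<close>

lemma target_pullback:
  assumes "F \<in> target"
  shows "F \<in> psi_pullback G G' ` Sh G G' K K' chi chi'"
proof -
  let ?pc = "product_character gG gH chi chi'"
  have F: "F \<in> C_infinity gP"
    and inv: "\<And>z k. z \<in> carrier gP \<Longrightarrow> k \<in> K \<times> K' \<Longrightarrow> F (z \<otimes>\<^bsub>gP\<^esub> k) = F z"
    and R: "\<And>u z. u \<in> ZG gP \<Longrightarrow> z \<in> carrier gP \<Longrightarrow> R_op gP u F z = ?pc u * F z"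
    and diag: "\<And>h z. h \<in> G' \<Longrightarrow> z \<in> carrier gP \<Longrightarrow> F ((h, h) \<otimes>\<^bsub>gP\<^esub> z) = F z"
    using assms unfolding left_invariants_def C_infinity_eigen_def by blast+
  define f where "f = (\<lambda>x\<in>G. F (x, mat 1))"
  have f: "f \<in> C_infinity gG" unfolding f_def by (rule slice_smooth[OF F])
  have F_eq: "F = psi_pullback G G' f"
  proof (rule pullback_eqI)
    show "F \<in> extensional (G \<times> G')" using F C_infinity_extensional[of gP] by auto
    fix x y assume xy: "x \<in> G" "y \<in> G'"
    \<comment> \<open>Every orbit of the diagonal meets the slice: translating by the inverse of
      \<open>y\<close> in both components moves \<open>(x, y)\<close> to second component 1.\<close>
    then have "F ((matrix_inv y, matrix_inv y) \<otimes>\<^bsub>gP\<^esub> (x, y)) = F (x, y)"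
      using inv_in by (intro diag) auto
    then show "F (x, y) = f (matrix_inv y ** x)"
      using xy psi_in inv_mult_G[of y] sub by (auto simp: f_def)
  qed
  have eigen: "pairing2 a b (\<lambda>u v. foldr RG.act u (foldr LG.act v f) x) = chi (U_class gG a) * chi' (U_class gH b) * f x"
    if a: "a \<in> carrier G.FA" "U_class gG a \<in> ZG gG" and b: "b \<in> carrier H.FA" "U_class gH b \<in> ZG gH"
      and x: "x \<in> G" for a b x
  proof -
    let ?p = "free_mult (push emb1 a) (push emb2 b)"
    have p: "?p \<in> carrier P.FA" "U_class gP ?p \<in> ZG gP"
      using prod.emb_mult_in prod.ZG_emb_mult a b by blast+
    have z: "(x, mat 1) \<in> carrier gP" using x one_G' by simp
    have "?pc (U_class gP ?p) = chi (U_class gG a) * chi' (U_class gH b)"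
      using prod.product_character_extends[OF chi] a b
      unfolding prod.extends_pair_def[OF chi] by (simp add: prod.U_map_emb_mult[symmetric])
    moreover have "R_op gP (U_class gP ?p) F (x, mat 1) = pairing ?p (\<lambda>w. foldr RP.act w F (x, mat 1))"
      using x one_G' by (intro R_op_P_class[OF p(1) F]) simp
    moreover have "\<dots> = pairing2 a b (\<lambda>u v. foldr RG.act u (foldr LG.act v f) x)"
      unfolding F_eq pairing_emb_pullback[OF a(1) b(1) x one_G'] by (simp add: matrix_inv_one)
    moreover have "F (x, mat 1) = f x" using x by (simp add: f_def)
    ultimately show ?thesis using R[OF p(2) z] by simp
  qed
  have "f \<in> Sh G G' K K' chi chi'"
    unfolding Sh_def
  proof (intro CollectI conjI ballI f)
    fix k' g k assume k': "k' \<in> K'" and g: "g \<in> G" and k: "k \<in> K"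
    have in_G: "k' \<in> G'" "k' \<in> G" "matrix_inv k' \<in> G'" "matrix_inv k' \<in> K'" "k \<in> G"
      using k' k K K'_G' K'_inv inv_in sub by auto
    \<comment> \<open>The left factor \<open>k'\<close> is removed by a diagonal translation, which
      leaves its inverse in the second component. There it is absorbed by right invariance under
      \<open>K'\<close>, together with \<open>k\<close> in the first.\<close>
    have "f (k' ** g ** k) = F ((k', k') \<otimes>\<^bsub>gP\<^esub> (g ** k, matrix_inv k'))"
      using g in_G by (simp add: f_def mult_G inv_mult_G matrix_mul_assoc)
    also have "\<dots> = F (g ** k, matrix_inv k')"
      using g in_G by (intro diag) (simp_all add: mult_G)
    also have "\<dots> = F ((g, mat 1) \<otimes>\<^bsub>gP\<^esub> (k, matrix_inv k'))" by simp
    also have "\<dots> = F (g, mat 1)"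
      using g k in_G one_G' by (intro inv) auto
    finally show "f (k' ** g ** k) = f g" using g by (simp add: f_def)
  next
    fix u g assume u: "u \<in> ZG gG" and g: "g \<in> G"
    obtain a where a: "a \<in> carrier G.FA" "u = U_class gG a" using u by (rule G.ZG_cases)
    \<comment> \<open>Pairing with the unit of the other enveloping algebra leaves \<open>f\<close>
      unchanged, and characters are 1 at the unit.\<close>
    have "pairing2 a (word []) (\<lambda>u v. foldr RG.act u (foldr LG.act v f) g) =
        chi (U_class gG a) * chi' (U_class gH (word [])) * f g"
      using u a g by (intro eigen H.ZG_one) auto
    then show "R_op gG u f g = chi u * f g"
      using H.character_one[OF chi(2)] by (simp add: a R_op_class[OF a(1) f g])
  next
    fix v g assume v: "v \<in> ZG gH" and g: "g \<in> G"
    obtain b where b: "b \<in> carrier H.FA" "v = U_class gH b" using v by (rule H.ZG_cases)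
    have "pairing2 (word []) b (\<lambda>u v. foldr RG.act u (foldr LG.act v f) g) =
        chi (U_class gG (word [])) * chi' (U_class gH b) * f g"
      using v b g by (intro eigen G.ZG_one) auto
    then show "L_op gG v f g = chi' v * f g"
      using G.character_one[OF chi(1)] by (simp add: b L_op_class[OF b(1) f g])
  qed
  then show ?thesis using F_eq by blast
qed

lemma bij_betw_pullback: "bij_betw (psi_pullback G G') (Sh G G' K K' chi chi') target"
proof (rule bij_betw_imageI)
  have "Sh G G' K K' chi chi' \<subseteq> extensional G"
    using C_infinity_extensional[of gG] by (auto simp: Sh_def)
  then show "inj_on (psi_pullback G G') (Sh G G' K K' chi chi')"
    by (rule inj_on_subset[OF pullback_inj])
  show "psi_pullback G G' ` Sh G G' K K' chi chi' = target"
    using pullback_Sh target_pullback by blast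
qed

end

end

text \<open>Each of the two groups is open in an algebraic group, of its own for \<open>G'\<close>,
  and hence closed among invertible matrices. The subgroup \<open>G\<close> of \<open>H\<close> is
  first viewed as a subgroup of GL(n), so that the intersection with the other algebraic group is a
  subgroup too.\<close>

lemma reductive_shintani_pair:
  assumes "real_reductive_linear_group G" "algebraic_reductive_subgroup G' G"
  shows "shintani_pair G G'"
proof -
  let ?GL = "{A :: real^'n^'n. invertible A}"
  interpret GL: group "linear_group ?GL" by (rule group_linear_group_invertible)
  obtain H where H: "algebraic_group H" "subgroup G (linear_group H)" "openin (top_of_set H) G"
    using assms(1) unfolding real_reductive_linear_group_def reductive_algebraic_group_def by blast
  have HG: "subgroup H (linear_group ?GL)" using H(1) by (simp add: algebraic_group_def)
  have "(linear_group ?GL)\<lparr>carrier := H\<rparr> = linear_group H" by (simp add: linear_group_def)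
  then have G: "subgroup G (linear_group ?GL)"
    using GL.incl_subgroup[OF HG] H(2) by simp
  obtain H' where H': "algebraic_group H'" "G' = G \<inter> H'" "openin (top_of_set H') G'"
    using assms(2) unfolding algebraic_reductive_subgroup_def reductive_algebraic_group_def by blast
  have G': "subgroup G' (linear_group ?GL)"
    unfolding H'(2) using G H'(1) by (intro GL.subgroups_Inter_pair) (simp_all add: algebraic_group_def)
  show ?thesis
    by (intro shintani_pair.intro closed_linear_group_linear_group[OF G H(1,3)]
        closed_linear_group_linear_group[OF G' H'(1,3)]) (use H'(2) in blast)
qed

theorem lemma8p6:
  fixes G G' K K' \<jj> \<jj>' :: "(real^'n^'n) set"
    and lam nu :: "((real^'n^'n) \<times> (real^'n^'n) \<Rightarrow> complex) set"
    and chi_lam chi_nu :: "(((real^'n^'n) \<times> (real^'n^'n)) list \<Rightarrow> complex) set \<Rightarrow> complex"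
  assumes "real_reductive_linear_group G"
    and "algebraic_reductive_subgroup G' G"
    and "maximal_compact_subgroup K G"
    and "K' = K \<inter> G'"
    and "maximal_compact_subgroup K' G'"
    and "cartan_subalgebra (linear_group G) \<jj>"
    and "cartan_subalgebra (linear_group G') \<jj>'"
    and "lam \<in> dual_mod_weyl (linear_group G) \<jj>"
    and "nu \<in> dual_mod_weyl (linear_group G') \<jj>'"
    and "harish_chandra_character (linear_group G) \<jj> lam chi_lam"
    and "harish_chandra_character (linear_group G') \<jj>' nu chi_nu"
  shows "bij_betw (psi_pullback G G')
    (Sh G G' K K' chi_lam chi_nu)
    (left_invariants (linear_group G \<times>\<times> linear_group G') ((\<lambda>x. (x, x)) ` G')
      (C_infinity_eigen (linear_group G \<times>\<times> linear_group G') (K \<times> K')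
        (product_character (linear_group G) (linear_group G') chi_lam chi_nu)))"
proof -
  interpret shintani_pair G G' by (rule reductive_shintani_pair[OF assms(1,2)])
  show ?thesis
  proof (rule bij_betw_pullback)
    show "K \<subseteq> G"
      using assms(3) subgroup.subset[of K "linear_group G"] by (simp add: maximal_compact_subgroup_def)
    show "subgroup K' (linear_group G')" using assms(5) by (simp add: maximal_compact_subgroup_def)
    show "chi_lam \<in> ZG_characters (linear_group G)" "chi_nu \<in> ZG_characters (linear_group G')"
      using assms(10,11) by (simp_all add: harish_chandra_character_def)
  qed
qed

end
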